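(* Let $\xi$ be a unit geodesic vector field on the unit sphere $S^{n+1}$. (i) If $n=2m$ and $\xi$ is a Hopf vector field, then $\xi$ is a totally geodesic vector field. (ii) Conversely, if $\xi$ is a totally geodesic vector field and $\xi$ is covariantly normal, i.e. $A_\xi A_\xi^*=A_\xi^*A_\xi$, then $n=2m$ is even and $\xi$ is a Hopf vector field.
   Context: For a unit vector field $\xi$ on a Riemannian manifold $(M,g)$ with Levi-Civita connection $\nabla$, the shape operator is $A_\xi X=-\nabla_X\xi$ and $A_\xi^*$ is its pointwise adjoint: $\langle A_\xi^*X,Y\rangle=\langle X,A_\xi Y\rangle$. The tangent bundle $TM$ carries the Sasaki metric $\langle\langle \tilde X,\tilde Y\rangle\rangle=\langle \pi_*\tilde X,\pi_*\tilde Y\rangle+\langle K\tilde X,K\tilde Y\rangle$ ($\pi:TM\to M$ the projection, $K$ the connection map), and the unit tangent bundle $T_1M$ carries the induced metric. $\xi$ is called totally geodesic if the image $\xi(M)$ of the map $\xi:M\to T_1M$ is a totally geodesic submanifold of $T_1M$. $\xi$ is geodesic if its integral curves are geodesics. A Hopf vector field on the unit sphere $S^{2m+1}\subset\mathbb R^{2m+2}$ is a field of the form $\xi(x)=Jx$, where $J$ is an orthogonal complex structure on $\mathbb R^{2m+2}$ (the unit vector field tangent to the fibers of the Hopf fibration $S^{2m+1}\to\mathbb{C}P^m$). *)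

theory Defs
  imports "HOL-Analysis.Analysis"
begin

fun Ck_on :: "nat \<Rightarrow> 'a::euclidean_space set \<Rightarrow> ('a \<Rightarrow> 'b::real_normed_vector) \<Rightarrow> bool" where
  "Ck_on 0 U f = continuous_on U f"
| "Ck_on (Suc k) U f =
     ((\<forall>x\<in>U. f differentiable (at x)) \<and>
      (\<forall>v. Ck_on k U (\<lambda>x. frechet_derivative f (at x) v)))"

definition smooth_map_on :: "'a::euclidean_space set \<Rightarrow> ('a \<Rightarrow> 'b::real_normed_vector) \<Rightarrow> bool" where
  "smooth_map_on U f \<longleftrightarrow> open U \<and> (\<forall>k. Ck_on k U f)"

text \<open>Geodesics of a Riemannian metric on a subset M of a Euclidean space, where
  G p w is the squared length of the tangent vector w at the point p:
  smooth curves in M that are critical points of the energy functional with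
  respect to all compactly supported smooth variations through curves in M.\<close>
definition geodesic_in ::
  "('p::euclidean_space \<Rightarrow> 'p \<Rightarrow> real) \<Rightarrow> 'p set \<Rightarrow> real set \<Rightarrow> (real \<Rightarrow> 'p) \<Rightarrow> bool" where
  "geodesic_in G M I \<gamma> \<longleftrightarrow>
     open I \<and> smooth_map_on I \<gamma> \<and> \<gamma> ` I \<subseteq> M \<and>
     (\<forall>(h :: real \<times> real \<Rightarrow> 'p) \<epsilon> c d.
        \<epsilon> > 0 \<and> {c..d} \<subseteq> I \<and> smooth_map_on ({-\<epsilon><..<\<epsilon>} \<times> I) h \<and>
        (\<forall>s\<in>{-\<epsilon><..<\<epsilon>}. \<forall>t\<in>I. h (s, t) \<in> M) \<and>
        (\<forall>t\<in>I. h (0, t) = \<gamma> t) \<and>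
        (\<forall>s\<in>{-\<epsilon><..<\<epsilon>}. \<forall>t\<in>I - {c..d}. h (s, t) = \<gamma> t)
        \<longrightarrow> ((\<lambda>s. integral {c..d}
                (\<lambda>t. G (h (s, t)) (frechet_derivative h (at (s, t)) (0, 1))))
             has_real_derivative 0) (at 0))"

definition eucl_metric :: "'a::euclidean_space \<Rightarrow> 'a \<Rightarrow> real" where
  "eucl_metric p w = w \<bullet> w"

definition unit_tangent_sphere :: "('a::euclidean_space \<times> 'a) set" where
  "unit_tangent_sphere = {(x, v). norm x = 1 \<and> norm v = 1 \<and> x \<bullet> v = 0}"

text \<open>Sasaki metric on T S (squared length): a tangent vector (X,V) at (x,v) has
  horizontal part X and vertical part K(X,V) = V + (v.X) x, the tangential
  projection of V (Levi-Civita covariant derivative of v along x).\<close>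
definition sasaki_metric :: "('a::euclidean_space \<times> 'a) \<Rightarrow> ('a \<times> 'a) \<Rightarrow> real" where
  "sasaki_metric p w =
     (let x = fst p; v = snd p; X = fst w; V = snd w;
          K = V + (v \<bullet> X) *\<^sub>R x
      in X \<bullet> X + K \<bullet> K)"

definition unit_vector_field_sphere :: "('a::euclidean_space \<Rightarrow> 'a) \<Rightarrow> bool" where
  "unit_vector_field_sphere \<xi> \<longleftrightarrow>
     (\<exists>U. sphere 0 1 \<subseteq> U \<and> smooth_map_on U \<xi>) \<and>
     (\<forall>x\<in>sphere 0 1. norm (\<xi> x) = 1 \<and> x \<bullet> \<xi> x = 0)"

definition geodesic_field_sphere :: "('a::euclidean_space \<Rightarrow> 'a) \<Rightarrow> bool" where
  "geodesic_field_sphere \<xi> \<longleftrightarrow>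
     (\<forall>I c. open I \<and> (\<forall>t\<in>I. c t \<in> sphere 0 1 \<and> (c has_vector_derivative \<xi> (c t)) (at t))
        \<longrightarrow> geodesic_in eucl_metric (sphere 0 1) I c)"

definition totally_geodesic_field :: "('a::euclidean_space \<Rightarrow> 'a) \<Rightarrow> bool" where
  "totally_geodesic_field \<xi> \<longleftrightarrow>
     (\<forall>I \<gamma>. geodesic_in sasaki_metric ((\<lambda>x. (x, \<xi> x)) ` sphere 0 1) I \<gamma>
        \<longrightarrow> geodesic_in sasaki_metric unit_tangent_sphere I \<gamma>)"

text \<open>Shape operator A_\<xi> X = - \<nabla>_X \<xi> at x on the sphere, where \<nabla>_X \<xi> is the tangential
  projection of the ambient derivative.\<close>
definition shape_op :: "('a::euclidean_space \<Rightarrow> 'a) \<Rightarrow> 'a \<Rightarrow> 'a \<Rightarrow> 'a" where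
  "shape_op \<xi> x X =
     (let D = frechet_derivative \<xi> (at x) X in - (D - (x \<bullet> D) *\<^sub>R x))"

definition shape_op_adj :: "('a::euclidean_space \<Rightarrow> 'a) \<Rightarrow> 'a \<Rightarrow> 'a \<Rightarrow> 'a" where
  "shape_op_adj \<xi> x X =
     (THE Z. x \<bullet> Z = 0 \<and> (\<forall>Y. x \<bullet> Y = 0 \<longrightarrow> Z \<bullet> Y = X \<bullet> shape_op \<xi> x Y))"

definition covariantly_normal :: "('a::euclidean_space \<Rightarrow> 'a) \<Rightarrow> bool" where
  "covariantly_normal \<xi> \<longleftrightarrow>
     (\<forall>x\<in>sphere 0 1. \<forall>X. x \<bullet> X = 0 \<longrightarrow>
        shape_op \<xi> x (shape_op_adj \<xi> x X) = shape_op_adj \<xi> x (shape_op \<xi> x X))"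

definition hopf_field :: "(real^'d \<Rightarrow> real^'d) \<Rightarrow> bool" where
  "hopf_field \<xi> \<longleftrightarrow>
     (\<exists>J :: real^'d^'d. J ** J = - mat 1 \<and> transpose J ** J = mat 1 \<and>
        (\<forall>x\<in>sphere 0 1. \<xi> x = J *v x))"

end

theory Submission
  imports Defs
begin

text \<open>Extend the field to F(x) = |x| xi(x/|x|) and write D for the derivative of F at a unit vector x.
  Geodesics of the image of xi exist by Picard--Lindeloef, since the induced metric
  y.w - (F.y)(F.w) + (D y).(D w) dominates the Euclidean one. If all of them are geodesics of the unit
  tangent bundle, then varying them vertically expresses the second derivative of F in a tangent
  direction through D alone. Polarising this in the direction of F and comparing with the derivative of
  the geodesic equation D(F) = -x forces D D = -1. Normality turns D into an isometry,
  hence skew, and then the second derivative vanishes: D is constant and xi is the linear map D.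
  Conversely, for xi = J the Euler--Lagrange equation of a curve x in the image gives
  x'' = l J x' + m x with constant l = J x . x', so that its Euler--Lagrange vector in the unit
  tangent bundle is m (x, J x), which is normal to that bundle.\<close>

section \<open>Calculus of smooth maps\<close>

text \<open>Geodesics are given as critical points of the energy and total geodesy only through
  geodesics, so no second fundamental form is at hand: every equation is won by testing with an
  explicit admissible variation, and the hypothesis says nothing until a geodesic of the image with
  prescribed initial velocity exists. Vertical tests suffice because the tangent vectors
  \<open>(w, D x w)\<close> of the image and the vertical vectors together span the tangent spaces
  of the unit tangent bundle. The unknown acceleration b occurs in both systems. It can be
  eliminated because differentiating \<open>x \<bullet> F x = 0\<close> and
  \<open>norm (F x) = norm x\<close> fixes the components of \<open>D x b\<close> and of the second
  derivative along x and \<open>F x\<close>. Why \<open>D D = -1\<close>: for Y orthogonal to x and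
  \<open>F x\<close> put S = -(Y + D D Y). Differentiating D(F) = -x gives S as the mixed second
  derivative in the directions F and Y, while polarising the quadratic formula gives S as twice that
  derivative; so S = 0. Why normality matters: a square root of -1 need not be orthogonal, but a
  normal one is, since A and its adjoint then have equal norms on each vector.\<close>

lemma Ck_on_cong:
  assumes "open U" "\<And>x. x \<in> U \<Longrightarrow> f x = g x" "Ck_on k U f"
  shows "Ck_on k U g"
  using assms(2,3)
proof (induction k arbitrary: f g)
  case 0
  then show ?case by (simp cong: continuous_on_cong)
next
  case (Suc k)
  have D: "(g has_derivative frechet_derivative f (at x)) (at x)" if "x \<in> U" for x
  proof (rule has_derivative_transform_within_open[OF _ \<open>open U\<close> that Suc.prems(1)])
    show "(f has_derivative frechet_derivative f (at x)) (at x)"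
      using Suc.prems(2) that by (simp add: frechet_derivative_works[symmetric])
  qed
  have "frechet_derivative f (at x) = frechet_derivative g (at x)" if "x \<in> U" for x
    using D[OF that] frechet_derivative_at by blast
  then have "Ck_on k U (\<lambda>x. frechet_derivative g (at x) v)" for v
    using Suc.prems(2) Suc.IH[of "\<lambda>x. frechet_derivative f (at x) v" "\<lambda>x. frechet_derivative g (at x) v"] by simp
  then show ?case using D by (auto simp: differentiable_def)
qed

lemma Ck_on_SucI:
  assumes "open U" and D: "\<And>x. x \<in> U \<Longrightarrow> (f has_derivative f' x) (at x)"
    and "\<And>v. Ck_on k U (\<lambda>x. f' x v)"
  shows "Ck_on (Suc k) U f"
proof -
  have "f' x = frechet_derivative f (at x)" if "x \<in> U" for x
    using D[OF that] frechet_derivative_at by blast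
  then have "Ck_on k U (\<lambda>x. frechet_derivative f (at x) v)" for v
    using Ck_on_cong[OF assms(1) _ assms(3)[of v]] by simp
  then show ?thesis using D by (auto simp: differentiable_def)
qed

lemma Ck_on_SucD: "Ck_on (Suc k) U f \<Longrightarrow> Ck_on k U f"
proof (induction k arbitrary: f)
  case 0
  then show ?case
    by (simp add: continuous_at_imp_continuous_on differentiable_imp_continuous_within)
next
  case (Suc k)
  then show ?case by simp
qed

lemma Ck_on_has_derivative:
  "Ck_on (Suc k) U f \<Longrightarrow> x \<in> U \<Longrightarrow> (f has_derivative frechet_derivative f (at x)) (at x)"
  by (simp add: frechet_derivative_works[symmetric])

lemma Ck_on_const: "open U \<Longrightarrow> Ck_on k U (\<lambda>x. c)"
proof (induction k arbitrary: c)
  case (Suc k)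
  show ?case by (rule Ck_on_SucI[where f' = "\<lambda>x v. 0"]) (use Suc in auto)
qed auto

lemma Ck_on_bounded_linear:
  assumes "bounded_linear L" "open U"
  shows "Ck_on k U L"
proof (cases k)
  case 0
  then show ?thesis using assms linear_continuous_on by auto
next
  case (Suc k')
  show ?thesis unfolding Suc
    by (rule Ck_on_SucI[where f' = "\<lambda>x. L"])
       (use assms Ck_on_const bounded_linear_imp_has_derivative in auto)
qed

lemma Ck_on_bounded_linear_comp:
  assumes "bounded_linear L" "open U" "Ck_on k U f"
  shows "Ck_on k U (\<lambda>x. L (f x))"
  using assms(3)
proof (induction k arbitrary: f)
  case 0
  then show ?case using assms(1) by (simp add: bounded_linear.continuous_on)
next
  case (Suc k)
  show ?case
    by (rule Ck_on_SucI[OF assms(2), where f' = "\<lambda>x v. L (frechet_derivative f (at x) v)"])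
       (use Suc Ck_on_has_derivative[OF Suc.prems] in
         \<open>auto intro!: bounded_linear.has_derivative[OF assms(1)]\<close>)
qed

lemma Ck_on_add:
  assumes "open U" "Ck_on k U f" "Ck_on k U g"
  shows "Ck_on k U (\<lambda>x. f x + g x)"
  using assms(2,3)
proof (induction k arbitrary: f g)
  case 0
  then show ?case by (simp add: continuous_on_add)
next
  case (Suc k)
  show ?case
    by (rule Ck_on_SucI[OF assms(1), where f' = "\<lambda>x v. frechet_derivative f (at x) v + frechet_derivative g (at x) v"])
       (use Suc Ck_on_has_derivative[OF Suc.prems(1)] Ck_on_has_derivative[OF Suc.prems(2)]
         in \<open>auto intro!: has_derivative_add\<close>)
qed

lemma Ck_on_sum:
  assumes "open U" "\<And>i. i \<in> A \<Longrightarrow> Ck_on k U (f i)"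
  shows "Ck_on k U (\<lambda>x. \<Sum>i\<in>A. f i x)"
  using assms(2)
  by (induction A rule: infinite_finite_induct) (auto simp: Ck_on_const Ck_on_add assms(1))

lemma Ck_on_bilinear:
  assumes B: "bounded_bilinear B" and "open U" "Ck_on k U f" "Ck_on k U g"
  shows "Ck_on k U (\<lambda>x. B (f x) (g x))"
  using assms(3,4)
proof (induction k arbitrary: f g)
  case 0
  then show ?case using bounded_bilinear.continuous_on[OF B] by auto
next
  case (Suc k)
  show ?case
  proof (rule Ck_on_SucI[OF assms(2), where
        f' = "\<lambda>x v. B (f x) (frechet_derivative g (at x) v) + B (frechet_derivative f (at x) v) (g x)"])
    show "((\<lambda>x. B (f x) (g x)) has_derivative
         (\<lambda>v. B (f x) (frechet_derivative g (at x) v) + B (frechet_derivative f (at x) v) (g x))) (at x)"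
      if "x \<in> U" for x
      by (rule bounded_bilinear.FDERIV[OF B Ck_on_has_derivative[OF Suc.prems(1) that]
            Ck_on_has_derivative[OF Suc.prems(2) that]])
    show "Ck_on k U (\<lambda>x. B (f x) (frechet_derivative g (at x) v) + B (frechet_derivative f (at x) v) (g x))" for v
      using Suc.prems Ck_on_SucD[OF Suc.prems(1)] Ck_on_SucD[OF Suc.prems(2)]
      by (intro Ck_on_add[OF assms(2)] Suc.IH) auto
  qed
qed

lemma linear_Basis_expansion:
  fixes L :: "'a::euclidean_space \<Rightarrow> 'b::real_vector"
  assumes "linear L"
  shows "L v = (\<Sum>b\<in>Basis. (v \<bullet> b) *\<^sub>R L b)"
proof -
  have "L v = L (\<Sum>b\<in>Basis. (v \<bullet> b) *\<^sub>R b)" by (simp add: euclidean_representation)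
  then show ?thesis using assms by (simp add: linear_sum linear_scale)
qed

text \<open>The chain rule differentiates g in the direction Df(x)v, which moves with x, whereas the
  induction hypothesis covers derivatives of g in fixed directions only. Expanding Df(x)v in the
  basis leaves sums of products that are covered.\<close>

lemma Ck_on_compose:
  fixes f :: "'a::euclidean_space \<Rightarrow> 'b::euclidean_space" and g :: "'b \<Rightarrow> 'c::real_normed_vector"
  assumes "open U" "open V" "f ` U \<subseteq> V" "Ck_on k U f" "Ck_on k V g"
  shows "Ck_on k U (\<lambda>x. g (f x))"
  using assms(4,5)
proof (induction k arbitrary: g)
  case 0
  then show ?case using assms(3) by (auto intro: continuous_on_compose2)
next
  case (Suc k)
  have D: "(g has_derivative frechet_derivative g (at (f x))) (at (f x))" if "x \<in> U" for x
    using Ck_on_has_derivative[OF Suc.prems(2)] that assms(3) by blast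
  show ?case
  proof (rule Ck_on_SucI[OF assms(1), where
        f' = "\<lambda>x v. \<Sum>b\<in>Basis. (frechet_derivative f (at x) v \<bullet> b) *\<^sub>R frechet_derivative g (at (f x)) b"])
    show "((\<lambda>x. g (f x)) has_derivative (\<lambda>v. \<Sum>b\<in>Basis. (frechet_derivative f (at x) v \<bullet> b) *\<^sub>R
        frechet_derivative g (at (f x)) b)) (at x)" if "x \<in> U" for x
      using has_derivative_compose[OF Ck_on_has_derivative[OF Suc.prems(1) that] D[OF that]]
        linear_Basis_expansion[OF has_derivative_linear[OF D[OF that]], symmetric] by simp
    have "Ck_on k U (\<lambda>x. frechet_derivative g (at (f x)) b)" for b
      using Suc by (intro Suc.IH Ck_on_SucD[OF Suc.prems(1)]) auto
    moreover have "Ck_on k U (\<lambda>x. frechet_derivative f (at x) v \<bullet> b)" for v b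
      using Suc.prems by (intro Ck_on_bounded_linear_comp[OF bounded_linear_inner_left] assms) auto
    ultimately show "Ck_on k U (\<lambda>x. \<Sum>b\<in>Basis. (frechet_derivative f (at x) v \<bullet> b) *\<^sub>R
        frechet_derivative g (at (f x)) b)" for v
      by (intro Ck_on_sum assms Ck_on_bilinear[OF bounded_bilinear_scaleR])
  qed
qed

lemma smooth_map_on_open: "smooth_map_on U f \<Longrightarrow> open U"
  by (simp add: smooth_map_on_def)

lemma smooth_map_on_cong:
  assumes "smooth_map_on U f" "\<And>x. x \<in> U \<Longrightarrow> f x = g x"
  shows "smooth_map_on U g"
  using assms Ck_on_cong unfolding smooth_map_on_def by blast

lemma smooth_map_on_const: "open U \<Longrightarrow> smooth_map_on U (\<lambda>x. c)"
  by (simp add: smooth_map_on_def Ck_on_const)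

lemma smooth_map_on_bounded_linear: "bounded_linear L \<Longrightarrow> open U \<Longrightarrow> smooth_map_on U L"
  by (simp add: smooth_map_on_def Ck_on_bounded_linear)

lemma smooth_map_on_bounded_linear_comp:
  "bounded_linear L \<Longrightarrow> smooth_map_on U f \<Longrightarrow> smooth_map_on U (\<lambda>x. L (f x))"
  by (simp add: smooth_map_on_def Ck_on_bounded_linear_comp)

lemma smooth_map_on_bilinear:
  "bounded_bilinear B \<Longrightarrow> smooth_map_on U f \<Longrightarrow> smooth_map_on U g \<Longrightarrow> smooth_map_on U (\<lambda>x. B (f x) (g x))"
  by (simp add: smooth_map_on_def Ck_on_bilinear)

lemma smooth_map_on_add:
  "smooth_map_on U f \<Longrightarrow> smooth_map_on U g \<Longrightarrow> smooth_map_on U (\<lambda>x. f x + g x)"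
  by (simp add: smooth_map_on_def Ck_on_add)

lemma smooth_map_on_minus: "smooth_map_on U f \<Longrightarrow> smooth_map_on U (\<lambda>x. - f x)"
  by (rule smooth_map_on_bounded_linear_comp[OF bounded_linear_minus[OF bounded_linear_ident]])

lemma smooth_map_on_diff:
  "smooth_map_on U f \<Longrightarrow> smooth_map_on U g \<Longrightarrow> smooth_map_on U (\<lambda>x. f x - g x)"
  using smooth_map_on_add[OF _ smooth_map_on_minus, of U f g] by simp

lemma smooth_map_on_sum:
  "open U \<Longrightarrow> (\<And>i. i \<in> A \<Longrightarrow> smooth_map_on U (f i)) \<Longrightarrow> smooth_map_on U (\<lambda>x. \<Sum>i\<in>A. f i x)"
  by (simp add: smooth_map_on_def Ck_on_sum)

lemma smooth_map_on_prod:
  fixes f :: "'i \<Rightarrow> 'a::euclidean_space \<Rightarrow> real"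
  assumes "open U" "\<And>i. i \<in> A \<Longrightarrow> smooth_map_on U (f i)"
  shows "smooth_map_on U (\<lambda>x. \<Prod>i\<in>A. f i x)"
  using assms(2)
  by (induction A rule: infinite_finite_induct)
     (auto intro: smooth_map_on_const[OF assms(1)] smooth_map_on_bilinear[OF bounded_bilinear_mult])

lemma smooth_map_on_compose:
  fixes f :: "'a::euclidean_space \<Rightarrow> 'b::euclidean_space" and g :: "'b \<Rightarrow> 'c::real_normed_vector"
  assumes "smooth_map_on V g" "smooth_map_on U f" "\<And>x. x \<in> U \<Longrightarrow> f x \<in> V"
  shows "smooth_map_on U (\<lambda>x. g (f x))"
  using assms Ck_on_compose[of U V f _ g] unfolding smooth_map_on_def by (meson image_subsetI)

lemma smooth_map_on_Pair:
  assumes "smooth_map_on U f" "smooth_map_on U g"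
  shows "smooth_map_on U (\<lambda>x. (f x, g x))"
proof -
  have 1: "bounded_linear (\<lambda>y. (y, 0))" "bounded_linear (\<lambda>z. (0, z))"
    by (auto intro!: bounded_linear_Pair bounded_linear_ident bounded_linear_zero)
  show ?thesis
    using smooth_map_on_add[OF smooth_map_on_bounded_linear_comp[OF 1(1) assms(1)]
        smooth_map_on_bounded_linear_comp[OF 1(2) assms(2)]] by simp
qed

lemma smooth_map_on_continuous: "smooth_map_on U f \<Longrightarrow> continuous_on U f"
  unfolding smooth_map_on_def using Ck_on.simps(1)[of U f] by presburger

lemma smooth_map_on_has_derivative:
  "smooth_map_on U f \<Longrightarrow> x \<in> U \<Longrightarrow> (f has_derivative frechet_derivative f (at x)) (at x)"
  unfolding smooth_map_on_def by (rule Ck_on_has_derivative) auto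

lemma smooth_map_on_frechet:
  assumes "smooth_map_on U f"
  shows "smooth_map_on U (\<lambda>x. frechet_derivative f (at x) v)"
proof -
  have "Ck_on (Suc k) U f" for k using assms by (simp add: smooth_map_on_def del: Ck_on.simps)
  then show ?thesis using smooth_map_on_open[OF assms] by (simp add: smooth_map_on_def)
qed

text \<open>Again a direction that moves with the point is traded for fixed basis directions with
  smooth coefficients.\<close>

lemma smooth_map_on_frechet_comp:
  fixes f :: "'a::euclidean_space \<Rightarrow> 'c::real_normed_vector"
  assumes "smooth_map_on U f" "smooth_map_on V g" "smooth_map_on V w" "\<And>z. z \<in> V \<Longrightarrow> g z \<in> U"
  shows "smooth_map_on V (\<lambda>z. frechet_derivative f (at (g z)) (w z))"
proof (rule smooth_map_on_cong)
  show "smooth_map_on V (\<lambda>z. \<Sum>b\<in>Basis. (w z \<bullet> b) *\<^sub>R frechet_derivative f (at (g z)) b)"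
    by (intro smooth_map_on_sum smooth_map_on_open[OF assms(2)]
          smooth_map_on_bilinear[OF bounded_bilinear_scaleR]
          smooth_map_on_bounded_linear_comp[OF bounded_linear_inner_left] assms
          smooth_map_on_compose[OF smooth_map_on_frechet[OF assms(1)]])
  show "(\<Sum>b\<in>Basis. (w z \<bullet> b) *\<^sub>R frechet_derivative f (at (g z)) b) = frechet_derivative f (at (g z)) (w z)"
    if "z \<in> V" for z
    using linear_Basis_expansion[OF has_derivative_linear[OF smooth_map_on_has_derivative[OF assms(1) assms(4)[OF that]]], symmetric] .
qed

lemmas smooth_map_on_scaleR = smooth_map_on_bilinear[OF bounded_bilinear_scaleR]
lemmas smooth_map_on_mult = smooth_map_on_bilinear[OF bounded_bilinear_mult]
lemmas smooth_map_on_inner = smooth_map_on_bilinear[OF bounded_bilinear_inner]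
lemmas smooth_map_on_fst = smooth_map_on_bounded_linear_comp[OF bounded_linear_fst]
lemmas smooth_map_on_snd = smooth_map_on_bounded_linear_comp[OF bounded_linear_snd]
lemmas smooth_map_on_ident = smooth_map_on_bounded_linear[OF bounded_linear_ident]

lemmas smooth_intros = smooth_map_on_const smooth_map_on_add smooth_map_on_minus smooth_map_on_diff
  smooth_map_on_sum smooth_map_on_prod smooth_map_on_Pair smooth_map_on_scaleR smooth_map_on_mult
  smooth_map_on_inner smooth_map_on_fst smooth_map_on_snd smooth_map_on_ident

section \<open>Smooth powers, quotients and norms\<close>

lemma smooth_map_on_powr: "smooth_map_on {0<..} (\<lambda>r::real. r powr a)"
proof -
  \<comment> \<open>With a free factor and a free exponent the family is closed under
    differentiation, which the induction on k needs.\<close>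
  have "Ck_on k {0<..} (\<lambda>r::real. c * r powr a)" for k and a c :: real
  proof (induction k arbitrary: a c)
    case 0
    then show ?case by (auto intro!: continuous_intros)
  next
    case (Suc k)
    show ?case
    proof (rule Ck_on_SucI[where f' = "\<lambda>r v. (v * c * a) * r powr (a - 1)"])
      show "((\<lambda>r. c * r powr a) has_derivative (\<lambda>v. (v * c * a) * r powr (a - 1))) (at r)"
        if "r \<in> {0<..}" for r
        using that by (auto intro!: derivative_eq_intros simp: field_simps powr_diff)
    qed (use Suc in auto)
  qed
  from this[of _ 1] show ?thesis by (simp add: smooth_map_on_def)
qed

lemma smooth_map_on_powr_comp:
  fixes f :: "'a::euclidean_space \<Rightarrow> real" and a :: real
  assumes "smooth_map_on U f" "\<And>x. x \<in> U \<Longrightarrow> f x > 0"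
  shows "smooth_map_on U (\<lambda>x. f x powr a)"
  using smooth_map_on_compose[OF smooth_map_on_powr assms(1)] assms(2) by simp

lemma smooth_map_on_divide:
  fixes f g :: "'a::euclidean_space \<Rightarrow> real"
  assumes "smooth_map_on U f" "smooth_map_on U g" "\<And>x. x \<in> U \<Longrightarrow> g x \<noteq> 0"
  shows "smooth_map_on U (\<lambda>x. f x / g x)"
proof (rule smooth_map_on_cong)
  \<comment> \<open>Powers are smooth on positive reals only; squaring the denominator removes its
    sign.\<close>
  show "smooth_map_on U (\<lambda>x. f x * g x * (g x * g x) powr (-1))"
    using assms by (intro smooth_map_on_mult smooth_map_on_powr_comp) (auto simp: zero_less_mult_iff linorder_neq_iff)
  show "f x * g x * (g x * g x) powr (-1) = f x / g x" if "x \<in> U" for x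
    using assms(3)[OF that] by (simp add: powr_minus_divide)
qed

lemma smooth_map_on_norm:
  fixes f :: "'a::euclidean_space \<Rightarrow> 'b::euclidean_space"
  assumes "smooth_map_on U f" "\<And>x. x \<in> U \<Longrightarrow> f x \<noteq> 0"
  shows "smooth_map_on U (\<lambda>x. norm (f x))"
proof (rule smooth_map_on_cong)
  show "smooth_map_on U (\<lambda>x. (f x \<bullet> f x) powr (1/2))"
    using assms by (intro smooth_map_on_powr_comp smooth_map_on_inner) auto
qed (simp only: norm_eq_sqrt_inner powr_half_sqrt inner_ge_zero)

lemma frechet_derivative_real_line:
  fixes g :: "real \<Rightarrow> 'a::euclidean_space"
  assumes "smooth_map_on I g" "t \<in> I"
  shows "frechet_derivative g (at t) 1 = vector_derivative g (at t)"
    "(g has_vector_derivative vector_derivative g (at t)) (at t)"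
proof -
  have D: "(g has_derivative frechet_derivative g (at t)) (at t)"
    using smooth_map_on_has_derivative[OF assms] .
  have "frechet_derivative g (at t) = (\<lambda>r. r *\<^sub>R vector_derivative g (at t))"
    by (rule frechet_derivative_eq_vector_derivative) (use D in \<open>auto simp: differentiable_def\<close>)
  then show "frechet_derivative g (at t) 1 = vector_derivative g (at t)"
    "(g has_vector_derivative vector_derivative g (at t)) (at t)"
    using D by (simp_all add: has_vector_derivative_def)
qed

lemma smooth_map_on_vector_derivative:
  fixes g :: "real \<Rightarrow> 'a::euclidean_space"
  assumes "smooth_map_on I g"
  shows "smooth_map_on I (\<lambda>t. vector_derivative g (at t))"
  by (rule smooth_map_on_cong[OF smooth_map_on_frechet[OF assms, of 1]
        frechet_derivative_real_line(1)[OF assms]])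

section \<open>Symmetry of second derivatives\<close>

lemma line_has_derivative:
  fixes f :: "'a::euclidean_space \<Rightarrow> 'b::euclidean_space"
  assumes "smooth_map_on U f" "p + s *\<^sub>R a \<in> U"
  shows "((\<lambda>s. f (p + s *\<^sub>R a)) has_vector_derivative frechet_derivative f (at (p + s *\<^sub>R a)) a) (at s)"
proof -
  have "((\<lambda>s. p + s *\<^sub>R a) has_vector_derivative a) (at s)"
    by (auto intro!: derivative_eq_intros)
  then show ?thesis
    using vector_derivative_diff_chain_within[of "\<lambda>s. p + s *\<^sub>R a" a s UNIV f]
      has_derivative_at_withinI[OF smooth_map_on_has_derivative[OF assms]] by (simp add: o_def)
qed

text \<open>Two applications of the mean value theorem, first along a to a difference of f in
  direction b, then along b. The second difference is symmetric in a and b, so exchanging them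
  yields the other mixed derivative from the same number.\<close>

lemma second_difference_mvt:
  fixes f :: "'a::euclidean_space \<Rightarrow> real"
  assumes f: "smooth_map_on U f" and U: "\<And>y. norm (y - x) \<le> h * (norm a + norm b) \<Longrightarrow> y \<in> U" and "h > 0"
  obtains y where "norm (y - x) \<le> h * (norm a + norm b)"
    "f (x + h *\<^sub>R a + h *\<^sub>R b) - f (x + h *\<^sub>R a) - f (x + h *\<^sub>R b) + f x =
     h^2 * frechet_derivative (\<lambda>z. frechet_derivative f (at z) a) (at y) b"
proof -
  let ?D = "\<lambda>z. frechet_derivative f (at z) a"
  have near: "norm (x + s *\<^sub>R a + t *\<^sub>R b - x) \<le> h * (norm a + norm b)"
    if "0 \<le> s" "s \<le> h" "0 \<le> t" "t \<le> h" for s t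
  proof -
    have "norm (x + s *\<^sub>R a + t *\<^sub>R b - x) \<le> s * norm a + t * norm b"
      using that norm_triangle_ineq[of "s *\<^sub>R a" "t *\<^sub>R b"] by (simp add: algebra_simps)
    also have "\<dots> \<le> h * norm a + h * norm b"
      using that by (intro add_mono mult_right_mono) auto
    finally show ?thesis by (simp add: algebra_simps)
  qed
  let ?\<phi> = "\<lambda>s. f (x + s *\<^sub>R a + h *\<^sub>R b) - f (x + s *\<^sub>R a)"
  have d1: "(?\<phi> has_real_derivative (?D (x + s *\<^sub>R a + h *\<^sub>R b) - ?D (x + s *\<^sub>R a))) (at s)"
    if "0 \<le> s" "s \<le> h" for s
  proof -
    have eq: "x + h *\<^sub>R b + r *\<^sub>R a = x + r *\<^sub>R a + h *\<^sub>R b" for r by simp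
    have 1: "x + h *\<^sub>R b + s *\<^sub>R a \<in> U" "x + s *\<^sub>R a \<in> U"
      using U[OF near[of s h]] U[OF near[of s 0]] that \<open>h > 0\<close> by (simp_all add: eq)
    show ?thesis
      using has_vector_derivative_diff[OF line_has_derivative[OF f 1(1)] line_has_derivative[OF f 1(2)]]
      unfolding has_real_derivative_iff_has_vector_derivative eq .
  qed
  then obtain s where s: "0 < s" "s < h"
    and s': "?\<phi> h - ?\<phi> 0 = (h - 0) * (?D (x + s *\<^sub>R a + h *\<^sub>R b) - ?D (x + s *\<^sub>R a))"
    using MVT2[OF \<open>h > 0\<close> d1] by auto
  let ?\<psi> = "\<lambda>t. ?D (x + s *\<^sub>R a + t *\<^sub>R b)"
  have d2: "(?\<psi> has_real_derivative frechet_derivative ?D (at (x + s *\<^sub>R a + t *\<^sub>R b)) b) (at t)"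
    if "0 \<le> t" "t \<le> h" for t
    using line_has_derivative[OF smooth_map_on_frechet[OF f] U[OF near[of s t]]] that s
    by (simp add: has_real_derivative_iff_has_vector_derivative)
  then obtain t where t: "0 < t" "t < h"
    and t': "?\<psi> h - ?\<psi> 0 = (h - 0) * frechet_derivative ?D (at (x + s *\<^sub>R a + t *\<^sub>R b)) b"
    using MVT2[OF \<open>h > 0\<close> d2] by auto
  show ?thesis
    by (rule that[OF near[of s t]]) (use s s' t t' in \<open>auto simp: power2_eq_square algebra_simps\<close>)
qed

text \<open>Schwarz's theorem: both mixed derivatives take a common value at points arbitrarily
  close to x, so by continuity they agree at x.\<close>

lemma second_derivative_symmetric_real:
  fixes f :: "'a::euclidean_space \<Rightarrow> real"
  assumes f: "smooth_map_on U f" and "x \<in> U"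
  shows "frechet_derivative (\<lambda>z. frechet_derivative f (at z) a) (at x) b =
    frechet_derivative (\<lambda>z. frechet_derivative f (at z) b) (at x) a"
proof (rule ccontr)
  let ?D = "\<lambda>a b z. frechet_derivative (\<lambda>z. frechet_derivative f (at z) a) (at z) b"
  assume "?D a b x \<noteq> ?D b a x"
  define e where "e = dist (?D a b x) (?D b a x) / 2"
  have "e > 0" using \<open>?D a b x \<noteq> ?D b a x\<close> by (simp add: e_def)
  have U: "open U" using smooth_map_on_open[OF f] .
  have c: "isCont (?D a b) x" for a b
    using smooth_map_on_continuous[OF smooth_map_on_frechet[OF smooth_map_on_frechet[OF f]]]
      continuous_on_eq_continuous_at[OF U] \<open>x \<in> U\<close> by blast
  obtain r0 where r0: "r0 > 0" "ball x r0 \<subseteq> U" using U \<open>x \<in> U\<close> openE by blast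
  obtain r1 where r1: "r1 > 0" "\<And>y. dist y x < r1 \<Longrightarrow> dist (?D a b y) (?D a b x) < e"
    using c[of a b] \<open>e > 0\<close> unfolding continuous_at_eps_delta by blast
  obtain r2 where r2: "r2 > 0" "\<And>y. dist y x < r2 \<Longrightarrow> dist (?D b a y) (?D b a x) < e"
    using c[of b a] \<open>e > 0\<close> unfolding continuous_at_eps_delta by blast
  define r where "r = min r0 (min r1 r2)"
  \<comment> \<open>The parallelogram with sides \<open>h *\<^sub>R a\<close> and
    \<open>h *\<^sub>R b\<close> then lies within distance r of x; the summand 1 keeps the quotient
    defined when a and b vanish.\<close>
  define h where "h = r / (norm a + norm b + 1)"
  have "r > 0" using r0 r1 r2 by (simp add: r_def)
  then have "h > 0" unfolding h_def by (intro divide_pos_pos) (auto simp: add_nonneg_pos)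
  have "h * (norm a + norm b + 1) = r" using add_nonneg_pos[of "norm a + norm b" 1] by (simp add: h_def)
  then have hr: "h * (norm a + norm b) < r" using \<open>h > 0\<close> by (simp add: algebra_simps)
  have inU: "y \<in> U" if "norm (y - x) \<le> h * (norm a + norm b)" for y
    using that hr r0(2) by (auto simp: r_def dist_norm norm_minus_commute)
  obtain y where y: "norm (y - x) \<le> h * (norm a + norm b)"
    "f (x + h *\<^sub>R a + h *\<^sub>R b) - f (x + h *\<^sub>R a) - f (x + h *\<^sub>R b) + f x = h^2 * ?D a b y"
    using second_difference_mvt[OF f _ \<open>h > 0\<close>, of x a b] inU by blast
  obtain z where z: "norm (z - x) \<le> h * (norm b + norm a)"
    "f (x + h *\<^sub>R b + h *\<^sub>R a) - f (x + h *\<^sub>R b) - f (x + h *\<^sub>R a) + f x = h^2 * ?D b a z"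
    using second_difference_mvt[OF f _ \<open>h > 0\<close>, of x b a] inU by (metis add.commute)
  have "h^2 * ?D a b y = h^2 * ?D b a z" unfolding y(2)[symmetric] z(2)[symmetric] by (simp add: algebra_simps)
  then have "?D a b y = ?D b a z" using \<open>h > 0\<close> by simp
  moreover have "dist (?D a b y) (?D a b x) < e" using r1(2)[of y] y(1) hr by (simp add: dist_norm r_def)
  moreover have "dist (?D b a z) (?D b a x) < e" using r2(2)[of z] z(1) hr by (simp add: dist_norm r_def add.commute)
  ultimately have "dist (?D a b x) (?D b a x) < 2 * e"
    using dist_triangle_half_r[of "?D a b y" "?D a b x" "2 * e" "?D b a x"] by simp
  then show False by (simp add: e_def)
qed

lemma frechet_derivative_inner:
  fixes f :: "'a::euclidean_space \<Rightarrow> 'b::euclidean_space"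
  assumes "smooth_map_on U f" "x \<in> U"
  shows "frechet_derivative (\<lambda>z. f z \<bullet> i) (at x) a = frechet_derivative f (at x) a \<bullet> i"
  using fun_cong[OF frechet_derivative_at[OF bounded_linear.has_derivative[OF bounded_linear_inner_left
        smooth_map_on_has_derivative[OF assms]], of i], of a] by simp

lemma frechet_derivative_cong:
  assumes "open U" "x \<in> U" "f differentiable (at x)" "\<And>x. x \<in> U \<Longrightarrow> f x = g x"
  shows "frechet_derivative f (at x) = frechet_derivative g (at x)"
  by (rule frechet_derivative_transform_within_open[OF assms(3,1,2,4)])

lemma smooth_map_on_differentiable: "smooth_map_on U f \<Longrightarrow> x \<in> U \<Longrightarrow> f differentiable (at x)"
  using smooth_map_on_has_derivative differentiable_def by blast

lemma second_derivative_symmetric: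
  fixes f :: "'a::euclidean_space \<Rightarrow> 'b::euclidean_space"
  assumes f: "smooth_map_on U f" and x: "x \<in> U"
  shows "frechet_derivative (\<lambda>z. frechet_derivative f (at z) a) (at x) b =
    frechet_derivative (\<lambda>z. frechet_derivative f (at z) b) (at x) a"
proof (rule euclidean_eqI)
  fix i :: 'b
  have fi: "smooth_map_on U (\<lambda>z. f z \<bullet> i)"
    by (rule smooth_map_on_bounded_linear_comp[OF bounded_linear_inner_left f])
  have *: "frechet_derivative (\<lambda>z. frechet_derivative (\<lambda>z. f z \<bullet> i) (at z) a) (at x) b =
    frechet_derivative (\<lambda>z. frechet_derivative f (at z) a) (at x) b \<bullet> i" for a b
  proof -
    have "frechet_derivative (\<lambda>z. frechet_derivative (\<lambda>z. f z \<bullet> i) (at z) a) (at x) =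
      frechet_derivative (\<lambda>z. frechet_derivative f (at z) a \<bullet> i) (at x)"
      by (rule frechet_derivative_cong[OF smooth_map_on_open[OF f] x
        smooth_map_on_differentiable[OF smooth_map_on_frechet[OF fi] x]])
        (rule frechet_derivative_inner[OF f])
    then show ?thesis by (simp only: frechet_derivative_inner[OF smooth_map_on_frechet[OF f] x])
  qed
  show "frechet_derivative (\<lambda>z. frechet_derivative f (at z) a) (at x) b \<bullet> i =
    frechet_derivative (\<lambda>z. frechet_derivative f (at z) b) (at x) a \<bullet> i"
    using second_derivative_symmetric_real[OF fi x, of a b] by (simp only: *)
qed

lemma partial_derivative:
  fixes h :: "real \<times> real \<Rightarrow> 'p::euclidean_space"
  assumes "smooth_map_on U h" "(s, t) \<in> U"
  shows "((\<lambda>s. h (s, t)) has_vector_derivative frechet_derivative h (at (s, t)) (1, 0)) (at s)"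
    and "((\<lambda>t. h (s, t)) has_vector_derivative frechet_derivative h (at (s, t)) (0, 1)) (at t)"
  using line_has_derivative[OF assms(1), of "(0, t)" s "(1, 0)"]
    line_has_derivative[OF assms(1), of "(s, 0)" t "(0, 1)"] assms(2) by simp_all

section \<open>First variation of the energy\<close>

definition flat_poly :: "real poly \<Rightarrow> real \<Rightarrow> real" where
  "flat_poly p t = (if t > 0 then poly p (1/t) * exp (- 1/t) else 0)"

lemma tendsto_poly_div_exp_0: "((\<lambda>u::real. poly p u * exp (- u)) \<longlongrightarrow> 0) at_top"
proof -
  have "((\<lambda>u::real. \<Sum>i\<le>degree p. coeff p i * (u ^ i / exp u)) \<longlongrightarrow> (\<Sum>i\<le>degree p. coeff p i * 0)) at_top"
    by (intro tendsto_sum tendsto_mult tendsto_const tendsto_power_div_exp_0)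
  then show ?thesis by (simp add: poly_altdef exp_minus divide_inverse sum_distrib_right mult.assoc)
qed

lemma flat_poly_tendsto_0: "(flat_poly p \<longlongrightarrow> 0) (at 0)"
proof (rule filterlim_split_at)
  show "(flat_poly p \<longlongrightarrow> 0) (at_left 0)"
    by (rule tendsto_eventually) (auto simp: flat_poly_def eventually_at_filter)
  have "((\<lambda>t::real. poly p (inverse t) * exp (- inverse t)) \<longlongrightarrow> 0) (at_right 0)"
    using filterlim_compose[OF tendsto_poly_div_exp_0 filterlim_inverse_at_top_right] .
  then show "(flat_poly p \<longlongrightarrow> 0) (at_right 0)"
    by (rule Lim_transform_eventually)
      (auto simp: flat_poly_def eventually_at_filter divide_inverse)
qed

text \<open>In terms of u = 1/t, differentiation of p(u) exp(-u) gives u^2 (p - p')(u) exp(-u). The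
  family is thus closed under derivatives, and smoothness of exp(-1/t) across 0 follows by one
  induction over all p.\<close>

lemma flat_poly_has_derivative:
  "(flat_poly p has_real_derivative flat_poly ([:0,0,1:] * (p - pderiv p)) t) (at t)"
proof -
  consider "t > 0" | "t < 0" | "t = 0" by linarith
  then show ?thesis
  proof cases
    case 1
    have "((\<lambda>t. poly p (1/t) * exp (- 1/t)) has_real_derivative
       flat_poly ([:0,0,1:] * (p - pderiv p)) t) (at t)"
      using 1 by (auto intro!: derivative_eq_intros DERIV_chain'[OF _ poly_DERIV]
          simp: flat_poly_def field_simps power2_eq_square)
    then show ?thesis
      by (rule has_field_derivative_transform_within_open[where S = "{0<..}"])
        (use 1 in \<open>auto simp: flat_poly_def\<close>)
  next
    case 2
    have "((\<lambda>t. 0) has_real_derivative 0) (at t)" by simp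
    then have "(flat_poly p has_real_derivative 0) (at t)"
      by (rule has_field_derivative_transform_within_open[where S = "{..<0}"])
        (use 2 in \<open>auto simp: flat_poly_def\<close>)
    then show ?thesis using 2 by (simp add: flat_poly_def)
  next
    case 3
    \<comment> \<open>Dividing by h multiplies the polynomial in 1/h by its variable, so the
      difference quotient is again a flat function and tends to 0.\<close>
    have "(flat_poly p (0 + h) - flat_poly p 0) / h = flat_poly (pCons 0 p) h" for h
      by (simp add: flat_poly_def field_simps)
    then have "(flat_poly p has_real_derivative 0) (at 0)"
      using flat_poly_tendsto_0[of "pCons 0 p"] by (simp add: DERIV_def)
    then show ?thesis using 3 by (simp add: flat_poly_def)
  qed
qed

lemma smooth_map_on_flat_poly: "smooth_map_on UNIV (flat_poly p)"
proof -
  have "Ck_on k UNIV (flat_poly p)" for k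
  proof (induction k arbitrary: p)
    case 0
    then show ?case
      using flat_poly_has_derivative by (auto intro!: continuous_at_imp_continuous_on DERIV_isCont)
  next
    case (Suc k)
    show ?case
      by (rule Ck_on_SucI[where f' = "\<lambda>t v. flat_poly ([:0,0,1:] * (p - pderiv p)) t * v"])
        (use flat_poly_has_derivative[of p] in
          \<open>auto simp: has_field_derivative_def simp del: mult_pCons_left
             intro: Ck_on_bilinear[OF bounded_bilinear_mult open_UNIV Suc Ck_on_const]\<close>)
  qed
  then show ?thesis by (simp add: smooth_map_on_def)
qed

text \<open>One factor is flat to the left of c, the other to the right of d. A variation multiplied
  by this function is compactly supported, as \<open>geodesic_in\<close> demands.\<close>

definition bump :: "real \<Rightarrow> real \<Rightarrow> real \<Rightarrow> real" where
  "bump c d t = flat_poly 1 (t - c) * flat_poly 1 (d - t)"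

lemma bump_pos: "c < t \<Longrightarrow> t < d \<Longrightarrow> bump c d t > 0"
  by (simp add: bump_def flat_poly_def)

lemma bump_nonneg: "bump c d t \<ge> 0"
  by (simp add: bump_def flat_poly_def)

lemma bump_eq_0: "t \<notin> {c..d} \<Longrightarrow> bump c d t = 0"
  by (auto simp: bump_def flat_poly_def)

lemma smooth_map_on_bump: "smooth_map_on UNIV (bump c d)"
proof -
  have "smooth_map_on UNIV (\<lambda>t. flat_poly 1 (t - c) * flat_poly 1 (d - t))"
    by (intro smooth_map_on_mult smooth_map_on_compose[OF smooth_map_on_flat_poly] smooth_map_on_diff
          smooth_map_on_ident smooth_map_on_const) auto
  then show ?thesis by (simp add: bump_def[abs_def])
qed

lemma smooth_map_on_bump_comp: "smooth_map_on U f \<Longrightarrow> smooth_map_on U (\<lambda>x. bump c d (f x))"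
  using smooth_map_on_compose[OF smooth_map_on_bump] by simp

lemma fundamental_lemma_variations:
  fixes f :: "real \<Rightarrow> real"
  assumes "open I" and f: "continuous_on I f"
    and int0: "\<And>c d. c < d \<Longrightarrow> {c..d} \<subseteq> I \<Longrightarrow> integral {c..d} (\<lambda>t. bump c d t * f t) = 0"
    and "t \<in> I"
  shows "f t = 0"
proof (rule ccontr)
  assume "f t \<noteq> 0"
  \<comment> \<open>The set where f keeps the sign it has at t; multiplying by \<open>f t\<close>
    treats both signs at once and makes the integrand nonnegative.\<close>
  let ?S = "I \<inter> (\<lambda>\<tau>. f t * f \<tau>) -` {0<..}"
  have "open ?S"
    by (rule continuous_open_preimage) (use f \<open>open I\<close> in \<open>auto intro!: continuous_intros\<close>)
  moreover have "t \<in> ?S"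
    using \<open>f t \<noteq> 0\<close> \<open>t \<in> I\<close> by (auto simp: zero_less_mult_iff linorder_neq_iff)
  ultimately obtain e where "e > 0" and e: "cball t e \<subseteq> ?S"
    using open_contains_cball by blast
  have cd: "{t - e..t + e} \<subseteq> ?S" using e by (simp add: cball_eq_atLeastAtMost)
  have "integral {t-e..t+e} (\<lambda>\<tau>. bump (t-e) (t+e) \<tau> * f \<tau>) = 0"
    using int0[of "t-e" "t+e"] cd \<open>e > 0\<close> by auto
  then have "integral {t-e..t+e} (\<lambda>\<tau>. f t * (bump (t-e) (t+e) \<tau> * f \<tau>)) = 0" by simp
  moreover have "continuous_on {t-e..t+e} (\<lambda>\<tau>. f t * (bump (t-e) (t+e) \<tau> * f \<tau>))"
    using continuous_on_subset[OF f] continuous_on_subset[OF smooth_map_on_continuous[OF smooth_map_on_bump]] cd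
    by (intro continuous_intros) auto
  moreover have "0 \<le> f t * (bump (t-e) (t+e) \<tau> * f \<tau>)" if "\<tau> \<in> {t-e..t+e}" for \<tau>
  proof -
    have "f t * f \<tau> > 0" using cd that by auto
    then have "0 \<le> bump (t-e) (t+e) \<tau> * (f t * f \<tau>)" by (rule mult_nonneg_nonneg[OF bump_nonneg less_imp_le])
    then show ?thesis by (simp only: mult.left_commute)
  qed
  ultimately have "\<forall>\<tau>\<in>{t-e..t+e}. f t * (bump (t-e) (t+e) \<tau> * f \<tau>) = 0"
    using integral_eq_0_iff[of "t-e" "t+e" "\<lambda>\<tau>. f t * (bump (t-e) (t+e) \<tau> * f \<tau>)"] \<open>e > 0\<close> by simp
  then have "f t * (bump (t-e) (t+e) t * f t) = 0" using \<open>e > 0\<close> by (rule_tac bspec) auto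
  then show False using bump_pos[of "t-e" t "t+e"] \<open>e > 0\<close> \<open>f t \<noteq> 0\<close> by auto
qed

text \<open>Up to the factor -2 this is the first variation density of the Lagrangian |p'|^2 -
  \<beta>(p,p')^2 after integration by parts. It stays paired with a test vector w because the
  equation is to hold for w tangent to the manifold only.\<close>

definition euler_lagrange :: "('p::euclidean_space \<Rightarrow> 'p \<Rightarrow> real) \<Rightarrow> (real \<Rightarrow> 'p) \<Rightarrow> real \<Rightarrow> 'p \<Rightarrow> real" where
  "euler_lagrange \<beta> \<gamma> t w =
    (let p = \<gamma> t; p' = vector_derivative \<gamma> (at t);
         p'' = vector_derivative (\<lambda>t. vector_derivative \<gamma> (at t)) (at t)
     in p'' \<bullet> w + \<beta> p p' * \<beta> w p' - (\<beta> p p'' + \<beta> p' p') * \<beta> p w - \<beta> p p' * \<beta> p' w)"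

text \<open>Differentiation under the integral, then integration by parts in t. The density g is
  prescribed along h alone, since a metric need agree with the model Lagrangian only on velocities
  of curves inside the manifold.\<close>

lemma first_variation:
  fixes h :: "real \<times> real \<Rightarrow> 'p::euclidean_space" and \<beta> :: "'p \<Rightarrow> 'p \<Rightarrow> real"
  assumes \<beta>: "bounded_bilinear \<beta>" and "\<epsilon> > 0" and cdI: "{c..d} \<subseteq> I"
    and h: "smooth_map_on ({-\<epsilon><..<\<epsilon>} \<times> I) h" and "open I"
    and h0: "\<And>t. t \<in> I \<Longrightarrow> h (0, t) = \<gamma> t"
    and hout: "\<And>s t. s \<in> {-\<epsilon><..<\<epsilon>} \<Longrightarrow> t \<in> I - {c..d} \<Longrightarrow> h (s, t) = \<gamma> t"
    and \<gamma>: "smooth_map_on I \<gamma>"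
    and G: "\<And>s t. s \<in> {-\<epsilon><..<\<epsilon>} \<Longrightarrow> t \<in> I \<Longrightarrow> g (s, t) =
      frechet_derivative h (at (s, t)) (0, 1) \<bullet> frechet_derivative h (at (s, t)) (0, 1)
      - (\<beta> (h (s, t)) (frechet_derivative h (at (s, t)) (0, 1)))\<^sup>2"
  shows "((\<lambda>s. integral {c..d} (\<lambda>t. g (s, t))) has_real_derivative
     - 2 * integral {c..d} (\<lambda>t. euler_lagrange \<beta> \<gamma> t (frechet_derivative h (at (0, t)) (1, 0)))) (at 0)"
proof (cases "c \<le> d")
  case False
  then show ?thesis by simp
next
  case True
  let ?U = "{-\<epsilon><..<\<epsilon>} \<times> I"
  have inU: "(0, t) \<in> ?U" if "t \<in> I" for t using that \<open>\<epsilon> > 0\<close> by simp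
  define X where "X z = frechet_derivative h (at z) (0, 1)" for z
  define W where "W t = frechet_derivative h (at (0, t)) (1, 0)" for t
  define \<gamma>1 where "\<gamma>1 t = vector_derivative \<gamma> (at t)" for t
  define \<gamma>2 where "\<gamma>2 t = vector_derivative \<gamma>1 (at t)" for t
  have X: "smooth_map_on ?U X" unfolding X_def[abs_def] by (rule smooth_map_on_frechet[OF h])
  have emb: "smooth_map_on I (\<lambda>t. (0::real, t))"
    by (intro smooth_intros \<open>open I\<close>)
  have W: "smooth_map_on I W" unfolding W_def[abs_def]
    by (rule smooth_map_on_compose[OF smooth_map_on_frechet[OF h] emb inU])
  have \<gamma>1: "smooth_map_on I \<gamma>1" unfolding \<gamma>1_def[abs_def] by (rule smooth_map_on_vector_derivative[OF \<gamma>])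
  have d\<gamma>: "(\<gamma> has_vector_derivative \<gamma>1 t) (at t)" if "t \<in> I" for t
    using frechet_derivative_real_line(2)[OF \<gamma> that] by (simp add: \<gamma>1_def)
  have d\<gamma>1: "(\<gamma>1 has_vector_derivative \<gamma>2 t) (at t)" if "t \<in> I" for t
    using frechet_derivative_real_line(2)[OF \<gamma>1 that] by (simp add: \<gamma>2_def)
  have X0: "X (0, t) = \<gamma>1 t" if "t \<in> I" for t
  proof -
    have "((\<lambda>t. h (0, t)) has_vector_derivative \<gamma>1 t) (at t)"
      by (rule has_vector_derivative_transform_within_open[OF d\<gamma>[OF that] \<open>open I\<close> that])
        (simp add: h0)
    then show ?thesis
      unfolding X_def using vector_derivative_unique_at[OF partial_derivative(2)[OF h inU[OF that]]] by blast
  qed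
  define f where "f z = X z \<bullet> X z - (\<beta> (h z) (X z))\<^sup>2" for z
  have f: "smooth_map_on ?U f" unfolding f_def[abs_def] power2_eq_square
    by (intro smooth_intros smooth_map_on_bilinear[OF \<beta>] X h)
  define f1 where "f1 z = frechet_derivative f (at z) (1, 0)" for z
  have f1: "smooth_map_on ?U f1" unfolding f1_def[abs_def] by (rule smooth_map_on_frechet[OF f])
  \<comment> \<open>Symmetry of second derivatives: the t-derivative of the variation field is the
    s-derivative of the velocity.\<close>
  have dW: "(W has_vector_derivative frechet_derivative X (at (0, t)) (1, 0)) (at t)" if "t \<in> I" for t
  proof -
    have "(W has_vector_derivative frechet_derivative (\<lambda>z. frechet_derivative h (at z) (1, 0)) (at (0, t)) (0, 1)) (at t)"
      unfolding W_def[abs_def] by (rule partial_derivative(2)[OF smooth_map_on_frechet[OF h] inU[OF that]])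
    then show ?thesis
      by (simp add: second_derivative_symmetric[OF h inU[OF that], of "(1,0)"] X_def[abs_def])
  qed
  define W1 where "W1 t = frechet_derivative X (at (0, t)) (1, 0)" for t
  have f1_eq: "f1 (0, t) = 2 * (\<gamma>1 t \<bullet> W1 t) - 2 * \<beta> (\<gamma> t) (\<gamma>1 t) * (\<beta> (\<gamma> t) (W1 t) + \<beta> (W t) (\<gamma>1 t))"
    if "t \<in> I" for t
  proof -
    note p = partial_derivative(1)[OF h inU[OF that]] partial_derivative(1)[OF X inU[OF that]]
    have "((\<lambda>s. f (s, t)) has_real_derivative
      2 * (X (0, t) \<bullet> W1 t) - 2 * \<beta> (h (0, t)) (X (0, t)) * (\<beta> (h (0, t)) (W1 t) + \<beta> (W t) (X (0, t)))) (at 0)"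
      using has_vector_derivative_diff[OF bounded_bilinear.has_vector_derivative[OF bounded_bilinear_inner p(2) p(2)]
        bounded_bilinear.has_vector_derivative[OF bounded_bilinear_mult
         bounded_bilinear.has_vector_derivative[OF \<beta> p(1) p(2)] bounded_bilinear.has_vector_derivative[OF \<beta> p(1) p(2)]]]
      unfolding f_def has_real_derivative_iff_has_vector_derivative W1_def W_def power2_eq_square
      by (elim has_vector_derivative_eq_rhs) (simp add: inner_commute algebra_simps)
    then have "((\<lambda>s. f (s, t)) has_vector_derivative
       2 * (\<gamma>1 t \<bullet> W1 t) - 2 * \<beta> (\<gamma> t) (\<gamma>1 t) * (\<beta> (\<gamma> t) (W1 t) + \<beta> (W t) (\<gamma>1 t))) (at 0)"
      by (simp add: has_real_derivative_iff_has_vector_derivative X0[OF that] h0[OF that])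
    then show ?thesis
      unfolding f1_def using vector_derivative_unique_at[OF partial_derivative(1)[OF f inU[OF that]]] by blast
  qed
  have leib: "((\<lambda>s. integral (cbox c d) (\<lambda>t. f (s, t))) has_field_derivative integral (cbox c d) (\<lambda>t. f1 (0, t)))
    (at 0 within {-\<epsilon><..<\<epsilon>})"
  proof (rule leibniz_rule_field_derivative)
    show "((\<lambda>s. f (s, t)) has_field_derivative f1 (s, t)) (at s within {-\<epsilon><..<\<epsilon>})"
      if "s \<in> {-\<epsilon><..<\<epsilon>}" "t \<in> cbox c d" for s t
    proof -
      have "(s, t) \<in> ?U" using that cdI by auto
      from partial_derivative(1)[OF f this] show ?thesis
        unfolding f1_def by (simp add: has_real_derivative_iff_has_vector_derivative has_vector_derivative_at_within)
    qed
    show "(\<lambda>t. f (s, t)) integrable_on cbox c d" if "s \<in> {-\<epsilon><..<\<epsilon>}" for s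
      by (rule integrable_continuous, rule continuous_on_compose2[OF smooth_map_on_continuous[OF f]])
        (use that cdI in \<open>auto intro!: continuous_intros\<close>)
    show "continuous_on ({-\<epsilon><..<\<epsilon>} \<times> cbox c d) (\<lambda>(s, t). f1 (s, t))"
      using continuous_on_subset[OF smooth_map_on_continuous[OF f1], of "{-\<epsilon><..<\<epsilon>} \<times> cbox c d"] cdI
      by (auto simp: subset_iff)
  qed (use \<open>\<epsilon> > 0\<close> in auto)
  have leib': "((\<lambda>s. integral {c..d} (\<lambda>t. g (s, t))) has_real_derivative integral {c..d} (\<lambda>t. f1 (0, t))) (at 0)"
  proof (rule has_field_derivative_transform_within_open)
    show "((\<lambda>s. integral {c..d} (\<lambda>t. f (s, t))) has_real_derivative integral {c..d} (\<lambda>t. f1 (0, t))) (at 0)"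
      using leib \<open>\<epsilon> > 0\<close> by (simp add: at_within_open[of 0 "{-\<epsilon><..<\<epsilon>}"])
    show "integral {c..d} (\<lambda>t. f (s, t)) = integral {c..d} (\<lambda>t. g (s, t))" if "s \<in> {-\<epsilon><..<\<epsilon>}" for s
      using that cdI by (intro integral_cong) (auto simp: G f_def X_def)
  qed (use \<open>\<epsilon> > 0\<close> in auto)
  have Wout: "W t = 0" if "t \<in> I - {c..d}" for t
  proof -
    have "((\<lambda>s. \<gamma> t) has_vector_derivative 0) (at 0)" by simp
    then have "((\<lambda>s. h (s, t)) has_vector_derivative 0) (at 0)"
      by (rule has_vector_derivative_transform_within_open[where S = "{-\<epsilon><..<\<epsilon>}"])
        (use that hout \<open>\<epsilon> > 0\<close> in auto)
    then show ?thesis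
      unfolding W_def using that vector_derivative_unique_at[OF partial_derivative(1)[OF h inU]] by blast
  qed
  \<comment> \<open>The variation is fixed outside the closed interval only. At an endpoint W
    vanishes by continuity, because the open set I contains points just beyond it.\<close>
  have Wend: "W t = 0" if t: "t \<in> {c, d}" for t
  proof (rule ccontr)
    assume "W t \<noteq> 0"
    let ?S = "I \<inter> W -` (- {0})"
    have "open ?S"
      by (rule continuous_open_preimage[OF smooth_map_on_continuous[OF W] \<open>open I\<close>]) auto
    moreover have "t \<in> ?S" using t cdI True \<open>W t \<noteq> 0\<close> by auto
    ultimately obtain e where "e > 0" and e: "ball t e \<subseteq> ?S" using openE by blast
    have "t - e/2 \<in> ?S" "t + e/2 \<in> ?S"
      using e \<open>e > 0\<close> by (auto simp: dist_real_def subset_iff)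
    moreover have "t - e/2 \<notin> {c..d} \<or> t + e/2 \<notin> {c..d}" using t \<open>e > 0\<close> by auto
    ultimately show False using Wout by auto
  qed
  \<comment> \<open>The boundary term of the integration by parts; it vanishes at c and d together
    with W.\<close>
  define F where "F t = \<gamma>1 t \<bullet> W t - \<beta> (\<gamma> t) (\<gamma>1 t) * \<beta> (\<gamma> t) (W t)" for t
  have "((\<lambda>t. f1 (0, t) / 2 + euler_lagrange \<beta> \<gamma> t (W t)) has_integral F d - F c) {c..d}"
  proof (rule fundamental_theorem_of_calculus[OF True])
    fix t assume "t \<in> {c..d}"
    then have t: "t \<in> I" using cdI by auto
    have f1_half: "f1 (0, t) / 2 = \<gamma>1 t \<bullet> W1 t - \<beta> (\<gamma> t) (\<gamma>1 t) * (\<beta> (\<gamma> t) (W1 t) + \<beta> (W t) (\<gamma>1 t))"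
      by (simp add: f1_eq[OF t])
    have "(F has_vector_derivative (f1 (0, t) / 2 + euler_lagrange \<beta> \<gamma> t (W t))) (at t)"
      using has_vector_derivative_diff[OF bounded_bilinear.has_vector_derivative[OF bounded_bilinear_inner d\<gamma>1[OF t] dW[OF t]]
        bounded_bilinear.has_vector_derivative[OF bounded_bilinear_mult
         bounded_bilinear.has_vector_derivative[OF \<beta> d\<gamma>[OF t] d\<gamma>1[OF t]]
         bounded_bilinear.has_vector_derivative[OF \<beta> d\<gamma>[OF t] dW[OF t]]]]
      unfolding F_def f1_half W1_def[symmetric] euler_lagrange_def Let_def \<gamma>1_def[symmetric] \<gamma>2_def[symmetric]
      by (elim has_vector_derivative_eq_rhs) (simp add: \<gamma>1_def[symmetric, abs_def] \<gamma>2_def[symmetric] algebra_simps)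
    then show "(F has_vector_derivative (f1 (0, t) / 2 + euler_lagrange \<beta> \<gamma> t (W t))) (at t within {c..d})"
      by (rule has_vector_derivative_at_within)
  qed
  moreover have "F d - F c = 0"
    using Wend \<beta> by (simp add: F_def bounded_bilinear.zero_right)
  moreover have "((\<lambda>t. f1 (0, t)) has_integral integral {c..d} (\<lambda>t. f1 (0, t))) {c..d}"
    by (intro integrable_integral integrable_continuous_real
        continuous_on_compose2[OF smooth_map_on_continuous[OF f1]] continuous_intros)
      (use cdI \<open>\<epsilon> > 0\<close> in auto)
  ultimately have "((\<lambda>t. (f1 (0, t) / 2 + euler_lagrange \<beta> \<gamma> t (W t)) - f1 (0, t) / 2) has_integral
      0 - integral {c..d} (\<lambda>t. f1 (0, t)) / 2) {c..d}"
    by (intro has_integral_diff has_integral_divide) simp_all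
  then have "integral {c..d} (\<lambda>t. f1 (0, t)) = - 2 * integral {c..d} (\<lambda>t. euler_lagrange \<beta> \<gamma> t (W t))"
    by (simp add: integral_unique)
  then show ?thesis using leib' by (simp add: W_def)
qed

section \<open>Geodesics and the Euler--Lagrange equation\<close>

text \<open>Along curves in the unit tangent bundle of the sphere the Sasaki metric is the flat metric minus
  the square of a bilinear form, because x.V = - v.X there; with the zero form the same
  variational formulas cover the round sphere.\<close>

definition energy_form :: "('p::euclidean_space \<Rightarrow> 'p \<Rightarrow> real) \<Rightarrow> ('p \<Rightarrow> 'p \<Rightarrow> real) \<Rightarrow> 'p set \<Rightarrow> bool" where
  "energy_form G \<beta> M \<longleftrightarrow> bounded_bilinear \<beta> \<and>
    (\<forall>(h :: real \<times> real \<Rightarrow> 'p) \<epsilon> I s t. open I \<and> smooth_map_on ({-\<epsilon><..<\<epsilon>} \<times> I) h \<and>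
      (\<forall>s\<in>{-\<epsilon><..<\<epsilon>}. \<forall>t\<in>I. h (s, t) \<in> M) \<and> s \<in> {-\<epsilon><..<\<epsilon>} \<and> t \<in> I \<longrightarrow>
      G (h (s, t)) (frechet_derivative h (at (s, t)) (0, 1)) =
      frechet_derivative h (at (s, t)) (0, 1) \<bullet> frechet_derivative h (at (s, t)) (0, 1)
      - (\<beta> (h (s, t)) (frechet_derivative h (at (s, t)) (0, 1)))\<^sup>2)"

lemma energy_form_bilinear: "energy_form G \<beta> M \<Longrightarrow> bounded_bilinear \<beta>"
  by (simp add: energy_form_def)

lemma energy_formD:
  fixes h :: "real \<times> real \<Rightarrow> 'p::euclidean_space"
  assumes "energy_form G \<beta> M" "open I" "smooth_map_on ({-\<epsilon><..<\<epsilon>} \<times> I) h"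
    "\<And>s t. s \<in> {-\<epsilon><..<\<epsilon>} \<Longrightarrow> t \<in> I \<Longrightarrow> h (s, t) \<in> M" "s \<in> {-\<epsilon><..<\<epsilon>}" "t \<in> I"
  shows "G (h (s, t)) (frechet_derivative h (at (s, t)) (0, 1)) =
      frechet_derivative h (at (s, t)) (0, 1) \<bullet> frechet_derivative h (at (s, t)) (0, 1)
      - (\<beta> (h (s, t)) (frechet_derivative h (at (s, t)) (0, 1)))\<^sup>2"
  using assms(1)[unfolded energy_form_def, THEN conjunct2, rule_format, of I \<epsilon> h s t] assms(2-) by blast

text \<open>Only fields that arise from actual variations inside M have to be tested, so the tangent
  spaces of M need no separate description.\<close>

lemma geodesic_inI:
  fixes \<gamma> :: "real \<Rightarrow> 'p::euclidean_space"
  assumes G: "energy_form G \<beta> M" and I: "open I" and \<gamma>: "smooth_map_on I \<gamma>" "\<gamma> ` I \<subseteq> M"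
    and EL: "\<And>(h :: real \<times> real \<Rightarrow> 'p) \<epsilon> t. \<epsilon> > 0 \<Longrightarrow> smooth_map_on ({-\<epsilon><..<\<epsilon>} \<times> I) h \<Longrightarrow>
      (\<And>s t. s \<in> {-\<epsilon><..<\<epsilon>} \<Longrightarrow> t \<in> I \<Longrightarrow> h (s, t) \<in> M) \<Longrightarrow> (\<And>t. t \<in> I \<Longrightarrow> h (0, t) = \<gamma> t) \<Longrightarrow> t \<in> I \<Longrightarrow>
      euler_lagrange \<beta> \<gamma> t (frechet_derivative h (at (0, t)) (1, 0)) = 0"
  shows "geodesic_in G M I \<gamma>"
  unfolding geodesic_in_def
proof (intro conjI allI impI I \<gamma>, elim conjE)
  fix h :: "real \<times> real \<Rightarrow> 'p" and \<epsilon> c d :: real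
  assume h: "0 < \<epsilon>" "{c..d} \<subseteq> I" "smooth_map_on ({-\<epsilon><..<\<epsilon>} \<times> I) h"
    "\<forall>s\<in>{-\<epsilon><..<\<epsilon>}. \<forall>t\<in>I. h (s, t) \<in> M" "\<forall>t\<in>I. h (0, t) = \<gamma> t"
    "\<forall>s\<in>{-\<epsilon><..<\<epsilon>}. \<forall>t\<in>I - {c..d}. h (s, t) = \<gamma> t"
  have "((\<lambda>s. integral {c..d} (\<lambda>t. (\<lambda>z. G (h z) (frechet_derivative h (at z) (0, 1))) (s, t))) has_real_derivative
     - 2 * integral {c..d} (\<lambda>t. euler_lagrange \<beta> \<gamma> t (frechet_derivative h (at (0, t)) (1, 0)))) (at 0)"
    by (rule first_variation[OF _ h(1-3) I _ _ \<gamma>(1)])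
      (use h energy_formD[OF G I h(3)] energy_form_bilinear[OF G] in auto)
  moreover have "integral {c..d} (\<lambda>t. euler_lagrange \<beta> \<gamma> t (frechet_derivative h (at (0, t)) (1, 0))) = integral {c..d} (\<lambda>t. 0)"
    by (rule integral_cong) (use EL[OF h(1,3)] h(2,4,5) in auto)
  ultimately show "((\<lambda>s. integral {c..d} (\<lambda>t. G (h (s, t)) (frechet_derivative h (at (s, t)) (0, 1))))
      has_real_derivative 0) (at 0)"
    by simp
qed

lemma euler_lagrange_scaleR:
  assumes "bounded_bilinear \<beta>"
  shows "euler_lagrange \<beta> \<gamma> t (r *\<^sub>R w) = r * euler_lagrange \<beta> \<gamma> t w"
  by (simp add: euler_lagrange_def Let_def bounded_bilinear.scaleR_left[OF assms]
      bounded_bilinear.scaleR_right[OF assms] algebra_simps)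

lemma continuous_on_euler_lagrange:
  assumes \<beta>: "bounded_bilinear \<beta>" and \<gamma>: "smooth_map_on I \<gamma>" and w: "continuous_on I w"
  shows "continuous_on I (\<lambda>t. euler_lagrange \<beta> \<gamma> t (w t))"
proof -
  note c = smooth_map_on_continuous[OF \<gamma>] smooth_map_on_continuous[OF smooth_map_on_vector_derivative[OF \<gamma>]]
    smooth_map_on_continuous[OF smooth_map_on_vector_derivative[OF smooth_map_on_vector_derivative[OF \<gamma>]]]
  show ?thesis
    unfolding euler_lagrange_def Let_def
    by (intro continuous_intros bounded_bilinear.continuous_on[OF \<beta>] c w)
qed

text \<open>If every bump multiple of w is realised by a variation inside M, the bumps localise the
  integral identity to a pointwise one. At each use it remains to construct such variations.\<close>

lemma geodesic_in_euler_lagrange: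
  fixes \<gamma> w :: "real \<Rightarrow> 'p::euclidean_space"
  assumes G: "energy_form G \<beta> M" and geo: "geodesic_in G M I \<gamma>" and w: "continuous_on I w"
    and vari: "\<And>c d. c < d \<Longrightarrow> {c..d} \<subseteq> I \<Longrightarrow> \<exists>h. smooth_map_on ({-1<..<1} \<times> I) h \<and>
      (\<forall>s\<in>{-1<..<1}. \<forall>t\<in>I. h (s, t) \<in> M \<and> (bump c d t = 0 \<longrightarrow> h (s, t) = \<gamma> t)) \<and>
      (\<forall>t\<in>I. h (0, t) = \<gamma> t \<and> ((\<lambda>s. h (s, t)) has_vector_derivative bump c d t *\<^sub>R w t) (at 0))"
    and "t \<in> I"
  shows "euler_lagrange \<beta> \<gamma> t (w t) = 0"
proof (rule fundamental_lemma_variations[where f = "\<lambda>t. euler_lagrange \<beta> \<gamma> t (w t)" and t = t and I = I])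
  have \<beta>: "bounded_bilinear \<beta>" using G by (simp add: energy_form_def)
  have I: "open I" and \<gamma>: "smooth_map_on I \<gamma>" using geo by (simp_all add: geodesic_in_def)
  show "open I" "t \<in> I" by fact+
  show "continuous_on I (\<lambda>t. euler_lagrange \<beta> \<gamma> t (w t))" by (rule continuous_on_euler_lagrange[OF \<beta> \<gamma> w])
  fix c d :: real assume cd: "c < d" "{c..d} \<subseteq> I"
  obtain h where h: "smooth_map_on ({-1<..<1} \<times> I) h"
      "\<And>s t. s \<in> {-1<..<1} \<Longrightarrow> t \<in> I \<Longrightarrow> h (s, t) \<in> M"
      "\<And>s t. s \<in> {-1<..<1} \<Longrightarrow> t \<in> I \<Longrightarrow> bump c d t = 0 \<Longrightarrow> h (s, t) = \<gamma> t"
      "\<And>t. t \<in> I \<Longrightarrow> h (0, t) = \<gamma> t"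
      "\<And>t. t \<in> I \<Longrightarrow> ((\<lambda>s. h (s, t)) has_vector_derivative bump c d t *\<^sub>R w t) (at 0)"
    using vari[OF cd] by metis
  have hW: "frechet_derivative h (at (0, t)) (1, 0) = bump c d t *\<^sub>R w t" if "t \<in> I" for t
    using vector_derivative_unique_at[OF partial_derivative(1)[OF h(1)] h(5)[OF that]] that by simp
  let ?E = "\<lambda>s. integral {c..d} (\<lambda>t. G (h (s, t)) (frechet_derivative h (at (s, t)) (0, 1)))"
  have fv: "((\<lambda>s. integral {c..d} (\<lambda>t. (\<lambda>z. G (h z) (frechet_derivative h (at z) (0, 1))) (s, t))) has_real_derivative
     - 2 * integral {c..d} (\<lambda>t. euler_lagrange \<beta> \<gamma> t (frechet_derivative h (at (0, t)) (1, 0)))) (at 0)"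
    by (rule first_variation[OF \<beta> zero_less_one cd(2) h(1) I _ _ \<gamma>])
      (use h(3,4) bump_eq_0 energy_formD[OF G I h(1,2)] in auto)
  have "(?E has_real_derivative 0) (at 0)"
  proof -
    have 1: "(0::real) < 1 \<and> {c..d} \<subseteq> I \<and> smooth_map_on ({-1<..<1} \<times> I) h \<and>
        (\<forall>s\<in>{-1<..<1}. \<forall>t\<in>I. h (s, t) \<in> M) \<and> (\<forall>t\<in>I. h (0, t) = \<gamma> t) \<and>
        (\<forall>s\<in>{-1<..<1}. \<forall>t\<in>I - {c..d}. h (s, t) = \<gamma> t)"
      using cd h bump_eq_0 by auto
    show ?thesis
      by (rule geo[unfolded geodesic_in_def, THEN conjunct2, THEN conjunct2, THEN conjunct2, rule_format, OF 1])
  qed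
  then have "integral {c..d} (\<lambda>t. euler_lagrange \<beta> \<gamma> t (frechet_derivative h (at (0, t)) (1, 0))) = 0"
    by (auto dest: DERIV_unique[OF fv])
  moreover have "integral {c..d} (\<lambda>t. euler_lagrange \<beta> \<gamma> t (frechet_derivative h (at (0, t)) (1, 0))) =
      integral {c..d} (\<lambda>t. bump c d t * euler_lagrange \<beta> \<gamma> t (w t))"
    by (rule integral_cong) (use cd(2) hW in \<open>auto simp: euler_lagrange_scaleR[OF \<beta>]\<close>)
  ultimately show "integral {c..d} (\<lambda>t. bump c d t * euler_lagrange \<beta> \<gamma> t (w t)) = 0" by simp
qed

section \<open>The round and the Sasaki metric as energy forms\<close>

definition sasaki_form :: "('a::euclidean_space \<times> 'a) \<Rightarrow> ('a \<times> 'a) \<Rightarrow> real" where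
  "sasaki_form p w = snd p \<bullet> fst w"

lemma bounded_bilinear_sasaki_form: "bounded_bilinear sasaki_form"
  unfolding sasaki_form_def[abs_def]
  by (rule bounded_bilinear.comp[OF bounded_bilinear_inner bounded_linear_snd bounded_linear_fst])

lemma energy_form_eucl: "energy_form eucl_metric (\<lambda>_ _. 0) M"
  by (simp add: energy_form_def eucl_metric_def bounded_bilinear.intro exI[of _ 0])

lemma sasaki_metric_tangent:
  assumes "x \<bullet> x = 1" "x \<bullet> V + X \<bullet> v = 0"
  shows "sasaki_metric (x, v) (X, V) = (X, V) \<bullet> (X, V) - (sasaki_form (x, v) (X, V))\<^sup>2"
proof -
  have "x \<bullet> V = - (v \<bullet> X)" using assms(2) by (simp add: inner_commute)
  then show ?thesis using assms(1)
    by (simp add: sasaki_metric_def sasaki_form_def Let_def inner_add inner_commute power2_eq_square algebra_simps)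
qed

text \<open>The Sasaki expression matches the model only on vectors tangent to the bundle;
  velocities qualify because \<open>x \<bullet> v = 0\<close> can be differentiated along the
  curve.\<close>

lemma energy_form_sasaki:
  assumes M: "M \<subseteq> unit_tangent_sphere"
  shows "energy_form sasaki_metric sasaki_form M"
  unfolding energy_form_def
proof (intro conjI allI impI bounded_bilinear_sasaki_form, elim conjE)
  fix h :: "real \<times> real \<Rightarrow> 'a \<times> 'a" and \<epsilon> I s t
  assume "open I" and h: "smooth_map_on ({-\<epsilon><..<\<epsilon>} \<times> I) h"
    and hM: "\<forall>s\<in>{-\<epsilon><..<\<epsilon>}. \<forall>t\<in>I. h (s, t) \<in> M" and st: "s \<in> {-\<epsilon><..<\<epsilon>}" "t \<in> I"
  have T: "norm (fst (h (s, t))) = 1 \<and> fst (h (s, t)) \<bullet> snd (h (s, t)) = 0" if "t \<in> I" for t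
  proof -
    have "h (s, t) \<in> unit_tangent_sphere" using hM M st that by blast
    then show ?thesis by (auto simp: unit_tangent_sphere_def)
  qed
  have D: "((\<lambda>t. h (s, t)) has_vector_derivative frechet_derivative h (at (s, t)) (0, 1)) (at t)"
    by (rule partial_derivative(2)[OF h]) (use st in simp)
  define x v X V where "x = fst (h (s, t))" and "v = snd (h (s, t))"
    and "X = fst (frechet_derivative h (at (s, t)) (0, 1))" and "V = snd (frechet_derivative h (at (s, t)) (0, 1))"
  have "((\<lambda>t. fst (h (s, t)) \<bullet> snd (h (s, t))) has_vector_derivative x \<bullet> V + X \<bullet> v) (at t)"
    unfolding x_def v_def X_def V_def
    by (rule bounded_bilinear.has_vector_derivative[OF bounded_bilinear_inner
          bounded_linear.has_vector_derivative[OF bounded_linear_fst D]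
          bounded_linear.has_vector_derivative[OF bounded_linear_snd D]])
  moreover have "((\<lambda>t. fst (h (s, t)) \<bullet> snd (h (s, t))) has_vector_derivative 0) (at t)"
    by (rule has_vector_derivative_transform_within_open[OF has_vector_derivative_const \<open>open I\<close> st(2)])
      (use T in simp)
  ultimately have "x \<bullet> V + X \<bullet> v = 0" by (rule vector_derivative_unique_at)
  moreover have "x \<bullet> x = 1" using T[OF st(2)] by (simp add: x_def dot_square_norm)
  ultimately have "sasaki_metric (x, v) (X, V) = (X, V) \<bullet> (X, V) - (sasaki_form (x, v) (X, V))\<^sup>2"
    by (rule sasaki_metric_tangent[rotated])
  then show "sasaki_metric (h (s, t)) (frechet_derivative h (at (s, t)) (0, 1)) =
      frechet_derivative h (at (s, t)) (0, 1) \<bullet> frechet_derivative h (at (s, t)) (0, 1)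
      - (sasaki_form (h (s, t)) (frechet_derivative h (at (s, t)) (0, 1)))\<^sup>2"
    by (simp add: x_def v_def X_def V_def)
qed

text \<open>A rational parametrisation of the great circle through p in direction b
  (stereographic projection), smooth also where b vanishes.\<close>

definition sphere_push :: "'a::euclidean_space \<Rightarrow> 'a \<Rightarrow> real \<Rightarrow> 'a" where
  "sphere_push p b s = ((1 - s\<^sup>2 * (b \<bullet> b) / 4) / (1 + s\<^sup>2 * (b \<bullet> b) / 4)) *\<^sub>R p
     + (s / (1 + s\<^sup>2 * (b \<bullet> b) / 4)) *\<^sub>R b"

lemma sphere_push_denominator: "1 + s\<^sup>2 * (b \<bullet> b) / 4 > (0::real)"
  by (simp add: add_pos_nonneg)

lemma sphere_push_0 [simp]: "sphere_push p b 0 = p" "sphere_push p 0 s = p"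
  by (simp_all add: sphere_push_def)

lemma norm_sphere_push:
  assumes "norm p = 1" "p \<bullet> b = 0"
  shows "norm (sphere_push p b s) = 1"
proof -
  define q where "q = s\<^sup>2 * (b \<bullet> b) / 4"
  have q: "1 + q \<noteq> 0" using sphere_push_denominator[of s b] by (simp add: q_def)
  have pb: "p \<bullet> p = 1" "p \<bullet> b = 0" "b \<bullet> p = 0" using assms by (simp_all add: norm_eq_1 inner_commute)
  have "sphere_push p b s \<bullet> sphere_push p b s = ((1 - q) / (1 + q))\<^sup>2 + (s / (1 + q))\<^sup>2 * (b \<bullet> b)"
    unfolding sphere_push_def q_def[symmetric]
    by (simp only: inner_add_left inner_add_right inner_scaleR_left inner_scaleR_right pb)
       (simp add: power2_eq_square)
  also have "\<dots> = ((1 - q)\<^sup>2 + 4 * q) / (1 + q)\<^sup>2"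
    by (simp add: power_divide add_divide_distrib q_def)
  also have "(1 - q)\<^sup>2 + 4 * q = (1 + q)\<^sup>2" by (simp add: power2_eq_square algebra_simps)
  also have "(1 + q)\<^sup>2 / (1 + q)\<^sup>2 = 1" using q by simp
  finally show ?thesis by (simp add: norm_eq_1)
qed

lemma smooth_map_on_sphere_push:
  fixes p b :: "'z::euclidean_space \<Rightarrow> 'a::euclidean_space"
  assumes "smooth_map_on U p" "smooth_map_on U b" "smooth_map_on U s"
  shows "smooth_map_on U (\<lambda>z. sphere_push (p z) (b z) (s z))"
  unfolding sphere_push_def power2_eq_square
  by (intro smooth_intros smooth_map_on_divide assms smooth_map_on_open[OF assms(1)])
    (use sphere_push_denominator in \<open>auto simp: power2_eq_square less_le\<close>)

lemma sphere_push_has_vector_derivative: "(sphere_push p b has_vector_derivative b) (at 0)"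
  unfolding sphere_push_def[abs_def]
  by (auto intro!: derivative_eq_intros simp: has_real_derivative_iff_has_vector_derivative[symmetric])

section \<open>Local existence for ordinary differential equations\<close>

text \<open>Bootstrapping: if y is of class k, so is its derivative \<open>f (y t)\<close>, hence y
  is of class k + 1.\<close>

lemma smooth_ode_solution:
  fixes f :: "'a::euclidean_space \<Rightarrow> 'a"
  assumes f: "smooth_map_on U f" and "open J"
    and y: "\<And>t. t \<in> J \<Longrightarrow> y t \<in> U" "\<And>t. t \<in> J \<Longrightarrow> (y has_vector_derivative f (y t)) (at t)"
  shows "smooth_map_on J y"
proof -
  have "Ck_on k J y" for k
  proof (induction k)
    case 0
    show ?case
      using y(2) by (auto intro!: continuous_at_imp_continuous_on has_vector_derivative_continuous)
  next
    case (Suc k)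
    have "Ck_on k J (\<lambda>t. f (y t))"
      by (rule Ck_on_compose[OF \<open>open J\<close> smooth_map_on_open[OF f] _ Suc])
        (use f y(1) in \<open>auto simp: smooth_map_on_def\<close>)
    then have "Ck_on k J (\<lambda>t. v *\<^sub>R f (y t))" for v
      by (rule Ck_on_bounded_linear_comp[OF bounded_linear_scaleR_right \<open>open J\<close>])
    then show ?case
      by (intro Ck_on_SucI[OF \<open>open J\<close>, of y "\<lambda>t v. v *\<^sub>R f (y t)"] y(2)[unfolded has_vector_derivative_def])
  qed
  then show ?thesis using \<open>open J\<close> by (simp add: smooth_map_on_def)
qed

lemma smooth_map_on_lipschitz_cball:
  fixes f :: "'a::euclidean_space \<Rightarrow> 'b::euclidean_space"
  assumes f: "smooth_map_on U f" and "cball y0 r \<subseteq> U"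
  obtains L where "L \<ge> 0" "\<And>x z. x \<in> cball y0 r \<Longrightarrow> z \<in> cball y0 r \<Longrightarrow> norm (f x - f z) \<le> L * norm (x - z)"
proof -
  have "continuous_on (cball y0 r) (\<lambda>x. \<Sum>b\<in>Basis. norm (frechet_derivative f (at x) b))"
    by (intro continuous_intros continuous_on_subset[OF smooth_map_on_continuous[OF smooth_map_on_frechet[OF f]] assms(2)])
  then obtain L where L: "L \<ge> 0" "\<And>x. x \<in> cball y0 r \<Longrightarrow> norm (\<Sum>b\<in>Basis. norm (frechet_derivative f (at x) b)) \<le> L"
    by (rule continuous_on_compact_bound[OF compact_cball]) auto
  show ?thesis
  proof (rule that[OF L(1)])
    fix x z assume xz: "x \<in> cball y0 r" "z \<in> cball y0 r"
    show "norm (f x - f z) \<le> L * norm (x - z)"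
    proof (rule differentiable_bound[OF convex_cball])
      fix w assume w: "w \<in> cball y0 r"
      have D: "(f has_derivative frechet_derivative f (at w)) (at w)"
        using smooth_map_on_has_derivative[OF f] assms(2) w by blast
      show "(f has_derivative frechet_derivative f (at w)) (at w within cball y0 r)"
        by (rule has_derivative_at_withinI[OF D])
      show "onorm (frechet_derivative f (at w)) \<le> L"
        using onorm_componentwise[OF has_derivative_bounded_linear[OF D]] L(2)[OF w] by simp
    qed (fact xz)+
  qed
qed

text \<open>Freezing time outside [-d, d] lets the Picard operator act on bounded continuous
  functions of the whole line, a complete space.\<close>

definition clamp_real :: "real \<Rightarrow> real \<Rightarrow> real" where
  "clamp_real d t = max (- d) (min d t)"

lemma clamp_real_in: "d \<ge> 0 \<Longrightarrow> clamp_real d t \<in> {-d..d}"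
  and clamp_real_eq: "t \<in> {-d..d} \<Longrightarrow> clamp_real d t = t"
  by (auto simp: clamp_real_def)

text \<open>The oriented integral from 0 to t. The difference form is needed for negative t, where
  the integral over \<open>{0..t}\<close> is taken over an empty set.\<close>

definition centered_integral :: "real \<Rightarrow> (real \<Rightarrow> 'a::euclidean_space) \<Rightarrow> real \<Rightarrow> 'a" where
  "centered_integral d k t = integral {-d..t} k - integral {-d..0} k"

lemma centered_integral_has_vector_derivative:
  assumes "continuous_on {-d..d} k" "t \<in> {-d..d}"
  shows "(centered_integral d k has_vector_derivative k t) (at t within {-d..d})"
  unfolding centered_integral_def[abs_def]
  using has_vector_derivative_diff[OF integral_has_vector_derivative[OF assms] has_vector_derivative_const] by simp

lemma norm_centered_integral_le:
  assumes "continuous_on {-d..d} k" "\<And>t. t \<in> {-d..d} \<Longrightarrow> norm (k t) \<le> B" "t \<in> {-d..d}"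
  shows "norm (centered_integral d k t) \<le> B * d"
proof -
  have "d \<ge> 0" using assms(3) by auto
  then have 0: "0 \<in> {-d..d}" by auto
  have "norm (centered_integral d k t - centered_integral d k 0) \<le> B * norm (t - 0)"
  proof (rule differentiable_bound[where S = "{-d..d}" and f' = "\<lambda>t h. h *\<^sub>R k t"])
    show "onorm (\<lambda>h. h *\<^sub>R k t) \<le> B" if "t \<in> {-d..d}" for t
    proof (rule onorm_bound)
      show "norm (h *\<^sub>R k t) \<le> B * norm h" for h
        using mult_left_mono[OF assms(2)[OF that], of "\<bar>h\<bar>"] by (simp add: mult.commute)
      show "0 \<le> B" using assms(2)[OF that] norm_ge_zero order_trans by blast
    qed
  qed (use centered_integral_has_vector_derivative[OF assms(1)] assms(3) 0 in \<open>auto simp: has_vector_derivative_def\<close>)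
  also have "\<dots> \<le> B * d"
    using order_trans[OF norm_ge_zero assms(2)[OF 0]] assms(3) by (intro mult_left_mono) auto
  finally show ?thesis by (simp add: centered_integral_def)
qed

text \<open>Banach's fixed point theorem: the global bound M keeps the Picard iterates bounded, and
  the Lipschitz constant L over time d makes the operator a contraction with factor
  \<open>L * d\<close>.\<close>

lemma picard_fixpoint:
  fixes g :: "'a::euclidean_space \<Rightarrow> 'a"
  assumes lip: "\<And>x z. norm (g x - g z) \<le> L * norm (x - z)" and bdd: "\<And>x. norm (g x) \<le> M"
    and "L \<ge> 0" "d > 0" "L * d < 1"
  obtains y where "continuous_on UNIV y" "\<And>t. t \<in> {-d..d} \<Longrightarrow> y t = y0 + centered_integral d (\<lambda>t. g (y t)) t"
proof -
  have gc: "continuous_on UNIV g"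
    by (rule lipschitz_on_continuous_on[of L]) (use lip \<open>L \<ge> 0\<close> in \<open>auto simp: lipschitz_on_def dist_norm\<close>)
  have cu: "continuous_on S (\<lambda>t. g (apply_bcontfun u t))" for u :: "real \<Rightarrow>\<^sub>C 'a" and S
    by (rule continuous_on_compose2[OF gc]) (auto intro!: continuous_intros)
  define P where "P u t = y0 + centered_integral d (\<lambda>t. g (apply_bcontfun u t)) (clamp_real d t)"
    for u :: "real \<Rightarrow>\<^sub>C 'a" and t
  have Pb: "P u \<in> bcontfun" for u
  proof -
    have ci: "continuous_on {-d..d} (centered_integral d (\<lambda>t. g (apply_bcontfun u t)))"
      using centered_integral_has_vector_derivative[OF cu] has_vector_derivative_continuous
      by (metis continuous_on_eq_continuous_within)
    have cc: "continuous_on UNIV (clamp_real d)"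
      unfolding clamp_real_def[abs_def] by (intro continuous_intros)
    have "clamp_real d ` UNIV \<subseteq> {-d..d}" using clamp_real_in[of d] \<open>d > 0\<close> by auto
    then have "continuous_on UNIV (P u)"
      unfolding P_def[abs_def]
      by (intro continuous_on_add[OF continuous_on_const continuous_on_compose2[OF ci cc]])
    moreover have "norm (P u t) \<le> norm y0 + M * d" for t
      using norm_centered_integral_le[OF cu bdd clamp_real_in[OF less_imp_le[OF \<open>d > 0\<close>]], of u t]
      unfolding P_def by (rule norm_triangle_le[OF add_left_mono])
    then have "bounded (range (P u))" by (auto simp: bounded_iff)
    ultimately show ?thesis by (simp add: bcontfun_def)
  qed
  have "\<exists>!u. Bcontfun (P u) = u"
  proof (rule banach_fix_type[of "L * d"])
    show "\<forall>u v. dist (Bcontfun (P u)) (Bcontfun (P v)) \<le> L * d * dist u v"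
    proof (intro allI dist_bound)
      fix u v :: "real \<Rightarrow>\<^sub>C 'a" and t
      let ?k = "\<lambda>t. g (apply_bcontfun u t) - g (apply_bcontfun v t)"
      have c: "clamp_real d t \<in> {-d..d}" using clamp_real_in \<open>d > 0\<close> by simp
      have "norm (?k t) \<le> L * dist u v" for t
        using lip[of "apply_bcontfun u t" "apply_bcontfun v t"]
          mult_left_mono[OF dist_bounded[of u t v] \<open>L \<ge> 0\<close>] by (simp add: dist_norm)
      then have "norm (centered_integral d ?k (clamp_real d t)) \<le> L * dist u v * d"
        by (intro norm_centered_integral_le c continuous_on_diff cu)
      moreover have "centered_integral d ?k (clamp_real d t) = P u t - P v t"
        using c \<open>d > 0\<close> by (simp add: centered_integral_def P_def integral_diff integrable_continuous_real cu)
      ultimately show "dist (apply_bcontfun (Bcontfun (P u)) t) (apply_bcontfun (Bcontfun (P v)) t) \<le> L * d * dist u v"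
        by (simp add: Bcontfun_inverse[OF Pb] dist_norm mult_ac)
    qed
  qed (use assms in auto)
  then obtain u where "Bcontfun (P u) = u" by blast
  then have u: "apply_bcontfun u = P u" using Bcontfun_inverse[OF Pb] by metis
  show ?thesis
  proof (rule that)
    show "continuous_on UNIV (apply_bcontfun u)" by (auto intro!: continuous_intros)
    show "apply_bcontfun u t = y0 + centered_integral d (\<lambda>t. g (apply_bcontfun u t)) t" if "t \<in> {-d..d}" for t
      using fun_cong[OF u, of t] clamp_real_eq[OF that] by (simp add: P_def)
  qed
qed

lemma ode_local_existence:
  fixes f :: "'a::euclidean_space \<Rightarrow> 'a"
  assumes f: "smooth_map_on U f" and "y0 \<in> U"
  obtains d y where "d > 0" "y 0 = y0" "smooth_map_on {-d<..<d} y"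
    "\<And>t. t \<in> {-d<..<d} \<Longrightarrow> y t \<in> U" "\<And>t. t \<in> {-d<..<d} \<Longrightarrow> (y has_vector_derivative f (y t)) (at t)"
proof -
  obtain r where "r > 0" and r: "cball y0 r \<subseteq> U"
    using smooth_map_on_open[OF f] \<open>y0 \<in> U\<close> open_contains_cball by blast
  obtain L where L: "L \<ge> 0" "\<And>x z. x \<in> cball y0 r \<Longrightarrow> z \<in> cball y0 r \<Longrightarrow> norm (f x - f z) \<le> L * norm (x - z)"
    using smooth_map_on_lipschitz_cball[OF f r] by metis
  obtain M where M: "M \<ge> 0" "\<And>x. x \<in> cball y0 r \<Longrightarrow> norm (f x) \<le> M"
    using continuous_on_compact_bound[OF compact_cball continuous_on_subset[OF smooth_map_on_continuous[OF f] r]] by metis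
  \<comment> \<open>Precomposing f with this 1-Lipschitz retraction onto the ball makes it globally
    bounded and Lipschitz.\<close>
  let ?c = "closest_point (cball y0 r)"
  have ne: "cball y0 r \<noteq> {}" using \<open>r > 0\<close> by simp
  have c_in: "?c x \<in> cball y0 r" for x by (rule closest_point_in_set[OF closed_cball ne])
  have c_lip: "norm (?c x - ?c z) \<le> norm (x - z)" for x z
    using closest_point_lipschitz[OF convex_cball closed_cball ne, of x z] by (simp only: dist_norm)
  \<comment> \<open>The first bound gives the contraction; the second keeps the solution in the
    ball, where the retraction is the identity and the original equation holds.\<close>
  define d where "d = min (1 / (L + 1)) (r / (M + 1))"
  have "d > 0" using L M \<open>r > 0\<close> by (simp add: d_def)
  have "d * (L + 1) \<le> 1" "d * (M + 1) \<le> r" using L(1) M(1)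
    by (simp_all add: pos_le_divide_eq[symmetric] d_def)
  then have Ld: "L * d < 1" and Md: "M * d \<le> r" using \<open>d > 0\<close> by (simp_all add: algebra_simps)
  have lip: "norm (f (?c x) - f (?c z)) \<le> L * norm (x - z)" for x z
    using L(2)[OF c_in c_in, of x z] mult_left_mono[OF c_lip[of x z] L(1)] by linarith
  have bdd: "norm (f (?c x)) \<le> M" for x by (rule M(2)[OF c_in])
  obtain y where yc: "continuous_on UNIV y"
    and y: "\<And>t. t \<in> {-d..d} \<Longrightarrow> y t = y0 + centered_integral d (\<lambda>t. f (?c (y t))) t"
    using picard_fixpoint[OF lip bdd L(1) \<open>d > 0\<close> Ld] by metis
  have fc: "continuous_on UNIV (\<lambda>x. f (?c x))"
    by (rule lipschitz_on_continuous_on[of L]) (use lip L(1) in \<open>auto simp: lipschitz_on_def dist_norm\<close>)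
  have kc: "continuous_on {-d..d} (\<lambda>t. f (?c (y t)))"
    by (rule continuous_on_compose2[OF fc continuous_on_subset[OF yc]]) auto
  have y_in: "y t \<in> cball y0 r" if "t \<in> {-d..d}" for t
    using norm_centered_integral_le[OF kc bdd that] y[OF that] Md by (simp add: dist_norm)
  have yd: "(y has_vector_derivative f (y t)) (at t)" if t: "t \<in> {-d<..<d}" for t
  proof -
    have t': "t \<in> {-d..d}" using t by auto
    have "(centered_integral d (\<lambda>t. f (?c (y t))) has_vector_derivative f (?c (y t))) (at t within {-d<..<d})"
      by (rule has_vector_derivative_within_subset[OF centered_integral_has_vector_derivative[OF kc t']]) auto
    then have "((\<lambda>t. y0 + centered_integral d (\<lambda>t. f (?c (y t))) t) has_vector_derivative f (?c (y t))) (at t)"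
      using has_vector_derivative_add[OF has_vector_derivative_const[of y0]]
      unfolding at_within_open[OF t open_greaterThanLessThan] by fastforce
    then have "(y has_vector_derivative f (?c (y t))) (at t)"
      by (rule has_vector_derivative_transform_within_open[where S = "{-d<..<d}"]) (use t y in auto)
    then show ?thesis by (simp add: closest_point_self[OF y_in[OF t']])
  qed
  show ?thesis
  proof (rule that[OF \<open>d > 0\<close>])
    show "y 0 = y0" using y[of 0] \<open>d > 0\<close> by (simp add: centered_integral_def)
    show "smooth_map_on {-d<..<d} y"
      by (rule smooth_ode_solution[OF f]) (use yd y_in r in auto)
  qed (use yd y_in r in auto)
qed

section \<open>Unit vector fields and their conical extension\<close>

lemma frechet_curve_derivative:
  fixes f :: "'a::euclidean_space \<Rightarrow> 'b::euclidean_space"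
  assumes f: "smooth_map_on U f" and "open I" and xU: "\<And>t. t \<in> I \<Longrightarrow> x t \<in> U" and t: "t \<in> I"
    and x: "(x has_vector_derivative X) (at t)" and y: "(y has_vector_derivative Y) (at t)"
  shows "((\<lambda>t. frechet_derivative f (at (x t)) (y t)) has_vector_derivative
    frechet_derivative (\<lambda>z. frechet_derivative f (at z) (y t)) (at (x t)) X + frechet_derivative f (at (x t)) Y) (at t)"
proof (rule has_vector_derivative_transform_within_open[OF _ \<open>open I\<close> t])
  let ?g = "\<lambda>b z. frechet_derivative f (at z) b"
  have lin: "linear (frechet_derivative f (at (x t)))" if "t \<in> I" for t
    by (rule has_derivative_linear[OF smooth_map_on_has_derivative[OF f xU[OF that]]])
  show "(\<Sum>b\<in>Basis. (y t \<bullet> b) *\<^sub>R ?g b (x t)) = frechet_derivative f (at (x t)) (y t)" if "t \<in> I" for t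
    by (rule linear_Basis_expansion[OF lin[OF that], symmetric])
  have dg: "((\<lambda>t. ?g b (x t)) has_vector_derivative frechet_derivative (?g b) (at (x t)) X) (at t)" for b
    using vector_derivative_diff_chain_within[OF x has_derivative_at_withinI[OF
        smooth_map_on_has_derivative[OF smooth_map_on_frechet[OF f] xU[OF t]]]] by (simp add: o_def)
  have "((\<lambda>t. \<Sum>b\<in>Basis. (y t \<bullet> b) *\<^sub>R ?g b (x t)) has_vector_derivative
     (\<Sum>b\<in>Basis. (y t \<bullet> b) *\<^sub>R frechet_derivative (?g b) (at (x t)) X + (Y \<bullet> b) *\<^sub>R ?g b (x t))) (at t)"
    by (intro has_vector_derivative_sum bounded_bilinear.has_vector_derivative[OF bounded_bilinear_scaleR _ dg]
        bounded_linear.has_vector_derivative[OF bounded_linear_inner_left y])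
  moreover have "(\<Sum>b\<in>Basis. (Y \<bullet> b) *\<^sub>R ?g b (x t)) = frechet_derivative f (at (x t)) Y"
    by (rule linear_Basis_expansion[OF lin[OF t], symmetric])
  moreover have "(\<Sum>b\<in>Basis. (y t \<bullet> b) *\<^sub>R frechet_derivative (?g b) (at (x t)) X) =
      frechet_derivative (?g (y t)) (at (x t)) X"
  proof -
    \<comment> \<open>Linearity of the second derivative is immediate in the outer direction only,
      so b is moved there before the basis expansion is summed up.\<close>
    have sym: "frechet_derivative (?g b) (at (x t)) X = frechet_derivative (?g X) (at (x t)) b" for b
      by (rule second_derivative_symmetric[OF f xU[OF t]])
    show ?thesis unfolding sym
      by (rule linear_Basis_expansion[symmetric])
         (rule has_derivative_linear[OF smooth_map_on_has_derivative[OF smooth_map_on_frechet[OF f] xU[OF t]]])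
  qed
  ultimately show "((\<lambda>t. \<Sum>b\<in>Basis. (y t \<bullet> b) *\<^sub>R ?g b (x t)) has_vector_derivative
    frechet_derivative (?g (y t)) (at (x t)) X + frechet_derivative f (at (x t)) Y) (at t)"
    by (simp add: sum.distrib)
qed

lemma second_vector_derivative:
  fixes y :: "real \<Rightarrow> 'a::euclidean_space"
  assumes "open I" "t \<in> I" and y: "\<And>t. t \<in> I \<Longrightarrow> (y has_vector_derivative a t) (at t)"
    and a: "(a has_vector_derivative b) (at t)"
  shows "vector_derivative y (at t) = a t" "vector_derivative (\<lambda>t. vector_derivative y (at t)) (at t) = b"
proof -
  have *: "vector_derivative y (at s) = a s" if "s \<in> I" for s by (rule vector_derivative_at[OF y[OF that]])
  then show "vector_derivative y (at t) = a t" using \<open>t \<in> I\<close> .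
  have "((\<lambda>t. vector_derivative y (at t)) has_vector_derivative b) (at t)"
    by (rule has_vector_derivative_transform_within_open[OF a assms(1,2)]) (simp add: *)
  then show "vector_derivative (\<lambda>t. vector_derivative y (at t)) (at t) = b" by (rule vector_derivative_at)
qed

lemma vector_derivative_zero_interval_constant:
  fixes f :: "real \<Rightarrow> 'a::euclidean_space"
  assumes "\<And>t. t \<in> {a<..<b} \<Longrightarrow> (f has_vector_derivative 0) (at t)" "s \<in> {a<..<b}" "t \<in> {a<..<b}"
  shows "f s = f t"
proof -
  obtain c where "\<And>x. x \<in> {a<..<b} \<Longrightarrow> f x = c"
    using has_vector_derivative_zero_constant[of "{a<..<b}" f] assms(1) has_vector_derivative_at_within
    by (metis convex_real_interval(8))
  then show ?thesis using assms by simp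
qed

text \<open>The values of \<xi> off the sphere are arbitrary. This extension depends on the sphere
  alone, and homogeneity carries unit length and tangency to all nonzero points, so that these
  identities may be differentiated in every direction.\<close>

definition cone_ext :: "('a::euclidean_space \<Rightarrow> 'a) \<Rightarrow> 'a \<Rightarrow> 'a" where
  "cone_ext \<xi> x = norm x *\<^sub>R \<xi> (x /\<^sub>R norm x)"

locale unit_field =
  fixes \<xi> :: "'a::euclidean_space \<Rightarrow> 'a"
  assumes unit_field: "unit_vector_field_sphere \<xi>"
begin

abbreviation "F \<equiv> cone_ext \<xi>"
abbreviation "D x y \<equiv> frechet_derivative F (at x) y"
abbreviation "D2 x y z \<equiv> frechet_derivative (\<lambda>w. D w y) (at x) z"

lemma smooth_F: "smooth_map_on (- {0}) F"
proof -
  obtain U where U: "sphere 0 1 \<subseteq> U" "smooth_map_on U \<xi>"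
    using unit_field by (auto simp: unit_vector_field_sphere_def)
  have n: "smooth_map_on (- {0}) (\<lambda>x::'a. norm x)"
    by (intro smooth_map_on_norm smooth_intros) auto
  have "smooth_map_on (- {0}) (\<lambda>x. norm x *\<^sub>R \<xi> ((1 / norm x) *\<^sub>R x))"
    by (intro smooth_map_on_scaleR n smooth_map_on_compose[OF U(2)] smooth_map_on_divide smooth_intros)
      (use U(1) in \<open>auto simp: subset_iff\<close>)
  then show ?thesis by (rule smooth_map_on_cong) (simp add: cone_ext_def divide_inverse)
qed

lemma F_sphere: "norm x = 1 \<Longrightarrow> F x = \<xi> x"
  by (simp add: cone_ext_def)

lemma F_scale:
  assumes "c > 0"
  shows "F (c *\<^sub>R x) = c *\<^sub>R F x"
proof -
  have *: "(c *\<^sub>R x) /\<^sub>R norm (c *\<^sub>R x) = x /\<^sub>R norm x"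
    using assms by (cases "x = 0") (auto simp: field_simps)
  show ?thesis unfolding cone_ext_def * using assms by simp
qed

lemma F_norm: "norm (F x) = norm x" and F_orth: "x \<bullet> F x = 0"
proof -
  have *: "norm (\<xi> u) = 1 \<and> u \<bullet> \<xi> u = 0" if "norm u = 1" for u
    using unit_field that by (auto simp: unit_vector_field_sphere_def)
  have "norm (F x) = norm x \<and> x \<bullet> F x = 0"
  proof (cases "x = 0")
    case False
    then have "norm (x /\<^sub>R norm x) = 1" by simp
    from *[OF this] False show ?thesis
      by (simp add: cone_ext_def)
  qed (simp add: cone_ext_def)
  then show "norm (F x) = norm x" "x \<bullet> F x = 0" by simp_all
qed

lemma has_derivative_F: "x \<noteq> 0 \<Longrightarrow> (F has_derivative D x) (at x)"
  by (rule smooth_map_on_has_derivative[OF smooth_F]) simp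

lemma linear_D: "x \<noteq> 0 \<Longrightarrow> linear (D x)"
  by (rule has_derivative_linear[OF has_derivative_F])

lemma F_curve:
  assumes "x t \<noteq> 0" "(x has_vector_derivative X) (at t)"
  shows "((\<lambda>t. F (x t)) has_vector_derivative D (x t) X) (at t)"
  using vector_derivative_diff_chain_within[OF assms(2) has_derivative_at_withinI[OF has_derivative_F[OF assms(1)]]]
  by (simp add: o_def)

lemma line_derivative: "((\<lambda>s. x + s *\<^sub>R y) has_vector_derivative y) (at s)"
  by (auto intro!: derivative_eq_intros)

text \<open>Euler's relation for a map homogeneous of degree one.\<close>

lemma D_radial:
  assumes "x \<noteq> 0"
  shows "D x x = F x"
proof -
  have "((\<lambda>s. F (x + s *\<^sub>R x)) has_vector_derivative D x x) (at 0)"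
    using F_curve[OF _ line_derivative, of x 0 x] assms by simp
  moreover have "((\<lambda>s. F x + s *\<^sub>R F x) has_vector_derivative F x) (at 0)" by (rule line_derivative)
  then have "((\<lambda>s. F (x + s *\<^sub>R x)) has_vector_derivative F x) (at 0)"
    by (rule has_vector_derivative_transform_within_open[where S = "{-1<..<1}"])
      (use F_scale[of "1 + s" x for s] in \<open>auto simp: algebra_simps\<close>)
  ultimately show ?thesis by (rule vector_derivative_unique_at)
qed

text \<open>Obtained by differentiating \<open>F_orth\<close> along a line; \<open>D_inner_F\<close>
  comes from \<open>F_norm\<close> in the same way. They are the source of all later component
  computations.\<close>

lemma D_inner_point:
  assumes "x \<noteq> 0"
  shows "D x y \<bullet> x = - (y \<bullet> F x)"
proof -
  have "((\<lambda>s. (x + s *\<^sub>R y) \<bullet> F (x + s *\<^sub>R y)) has_vector_derivative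
      ((x + 0 *\<^sub>R y) \<bullet> D (x + 0 *\<^sub>R y) y + y \<bullet> F (x + 0 *\<^sub>R y))) (at 0)"
    using assms by (intro bounded_bilinear.has_vector_derivative[OF bounded_bilinear_inner] F_curve line_derivative) simp
  then have "((\<lambda>s. 0 :: real) has_vector_derivative (x \<bullet> D x y + y \<bullet> F x)) (at 0)"
    by (simp only: F_orth) simp
  from vector_derivative_unique_at[OF this has_vector_derivative_const] show ?thesis
    by (simp add: inner_commute)
qed

lemma D_inner_F:
  assumes "x \<noteq> 0"
  shows "D x y \<bullet> F x = y \<bullet> x"
proof -
  have "((\<lambda>s. F (x + s *\<^sub>R y) \<bullet> F (x + s *\<^sub>R y)) has_vector_derivative
      (F (x + 0 *\<^sub>R y) \<bullet> D (x + 0 *\<^sub>R y) y + D (x + 0 *\<^sub>R y) y \<bullet> F (x + 0 *\<^sub>R y))) (at 0)"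
    using assms by (intro bounded_bilinear.has_vector_derivative[OF bounded_bilinear_inner] F_curve line_derivative) simp_all
  moreover have "((\<lambda>s. (x + s *\<^sub>R y) \<bullet> (x + s *\<^sub>R y)) has_vector_derivative
      ((x + 0 *\<^sub>R y) \<bullet> y + y \<bullet> (x + 0 *\<^sub>R y))) (at 0)"
    by (intro bounded_bilinear.has_vector_derivative[OF bounded_bilinear_inner] line_derivative)
  moreover have "F z \<bullet> F z = z \<bullet> z" for z by (simp only: dot_square_norm F_norm)
  ultimately have "F x \<bullet> D x y + D x y \<bullet> F x = x \<bullet> y + y \<bullet> x"
    using vector_derivative_unique_at by force
  then show ?thesis by (simp add: inner_commute)
qed

lemma D_scale:
  assumes "x \<noteq> 0" "c > 0"
  shows "D (c *\<^sub>R x) y = D x y"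
proof -
  have "((\<lambda>s. F (c *\<^sub>R x + s *\<^sub>R (c *\<^sub>R y))) has_vector_derivative D (c *\<^sub>R x) (c *\<^sub>R y)) (at 0)"
    using F_curve[OF _ line_derivative, of "c *\<^sub>R x" 0 "c *\<^sub>R y"] assms by simp
  moreover have "c *\<^sub>R x + s *\<^sub>R (c *\<^sub>R y) = c *\<^sub>R (x + s *\<^sub>R y)" for s by (simp add: algebra_simps)
  ultimately have "((\<lambda>s. c *\<^sub>R F (x + s *\<^sub>R y)) has_vector_derivative D (c *\<^sub>R x) (c *\<^sub>R y)) (at 0)"
    using assms(2) by (simp only: F_scale)
  moreover have "((\<lambda>s. c *\<^sub>R F (x + s *\<^sub>R y)) has_vector_derivative c *\<^sub>R D x y) (at 0)"
    using F_curve[OF _ line_derivative, of x 0 y] assms(1)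
    by (intro bounded_linear.has_vector_derivative[OF bounded_linear_scaleR_right]) simp
  ultimately have "D (c *\<^sub>R x) (c *\<^sub>R y) = c *\<^sub>R D x y" by (rule vector_derivative_unique_at)
  moreover have "D (c *\<^sub>R x) (c *\<^sub>R y) = c *\<^sub>R D (c *\<^sub>R x) y"
    using assms linear_scale[OF linear_D[of "c *\<^sub>R x"]] by simp
  ultimately show ?thesis using assms by simp
qed

lemma D_curve:
  assumes "open I" "\<And>t. t \<in> I \<Longrightarrow> x t \<noteq> 0" "t \<in> I"
    "(x has_vector_derivative X) (at t)" "(y has_vector_derivative Y) (at t)"
  shows "((\<lambda>t. D (x t) (y t)) has_vector_derivative D2 (x t) (y t) X + D (x t) Y) (at t)"
  by (rule frechet_curve_derivative[OF smooth_F assms(1) _ assms(3-5)]) (use assms(2) in simp)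

lemma D2_sym: "x \<noteq> 0 \<Longrightarrow> D2 x y z = D2 x z y"
  by (rule second_derivative_symmetric[OF smooth_F]) simp

lemma linear_D2: "x \<noteq> 0 \<Longrightarrow> linear (D2 x y)"
  by (rule has_derivative_linear[OF smooth_map_on_has_derivative[OF smooth_map_on_frechet[OF smooth_F]]]) simp

text \<open>The inner slot inherits additivity from the outer one by symmetry.\<close>

lemma D2_add_left:
  assumes "x \<noteq> 0"
  shows "D2 x (y + y') z = D2 x y z + D2 x y' z"
  using linear_add[OF linear_D2[OF assms], of z y y'] unfolding D2_sym[OF assms, of z] .

lemma D2_radial:
  assumes "x \<noteq> 0"
  shows "D2 x y x = 0"
proof -
  have "((\<lambda>s. D (x + s *\<^sub>R x) y) has_vector_derivative D2 (x + 0 *\<^sub>R x) y x + D (x + 0 *\<^sub>R x) 0) (at 0)"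
    by (rule D_curve[where I = "{-1<..<1}", OF _ _ _ line_derivative has_vector_derivative_const])
      (use assms scaleR_left_distrib[of 1 _ x, symmetric] in auto)
  then have "((\<lambda>s. D (x + s *\<^sub>R x) y) has_vector_derivative D2 x y x) (at 0)"
    using linear_0[OF linear_D[OF assms]] by simp
  moreover have "((\<lambda>s. D (x + s *\<^sub>R x) y) has_vector_derivative 0) (at 0)"
    by (rule has_vector_derivative_transform_within_open[OF has_vector_derivative_const[of "D x y"], where S = "{-1<..<1}"])
      (use D_scale[OF assms, of "1 + s" for s] in \<open>auto simp: algebra_simps\<close>)
  ultimately show ?thesis by (rule vector_derivative_unique_at)
qed

text \<open>\<xi> and F agree on the sphere only, so their derivatives are compared along a curve
  that stays in it. The second summand removes the component along x, which
  \<open>D_inner_point\<close> computes.\<close>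

lemma shape_op_eq:
  assumes x: "norm x = 1" and X: "x \<bullet> X = 0"
  shows "shape_op \<xi> x X = - (D x X + (F x \<bullet> X) *\<^sub>R x)"
proof -
  have x0: "x \<noteq> 0" using x by auto
  obtain U where U: "sphere 0 1 \<subseteq> U" "smooth_map_on U \<xi>"
    using unit_field by (auto simp: unit_vector_field_sphere_def)
  have "x \<in> U" using U(1) x by auto
  let ?c = "sphere_push x X"
  have "((\<lambda>s. \<xi> (?c s)) has_vector_derivative frechet_derivative \<xi> (at x) X) (at 0)"
    using vector_derivative_diff_chain_within[OF sphere_push_has_vector_derivative has_derivative_at_withinI[OF
          smooth_map_on_has_derivative[OF U(2)]], of x X] \<open>x \<in> U\<close> by (simp add: o_def)
  moreover have "((\<lambda>s. F (?c s)) has_vector_derivative D x X) (at 0)"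
    using F_curve[OF _ sphere_push_has_vector_derivative, of x X] x0 by simp
  moreover have "F (?c s) = \<xi> (?c s)" for s by (rule F_sphere[OF norm_sphere_push[OF x X]])
  ultimately have "frechet_derivative \<xi> (at x) X = D x X"
    using vector_derivative_unique_at by force
  then show ?thesis
    using D_inner_point[OF x0, of X] by (simp add: shape_op_def Let_def inner_commute)
qed

text \<open>The integral curve of F through x has acceleration \<open>D x (F x)\<close> there.
  Criticality of the round energy makes this vector normal to the sphere, and
  \<open>D_inner_point\<close> fixes its component along x.\<close>

lemma D_F_geodesic_unit:
  assumes geo: "geodesic_field_sphere \<xi>" and x: "norm x = 1"
  shows "D x (F x) = - x"
proof -
  have x0: "x \<noteq> 0" using x by auto
  obtain d y where "d > 0" "y 0 = x" and ys: "smooth_map_on {-d<..<d} y"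
    and y0: "\<And>t. t \<in> {-d<..<d} \<Longrightarrow> y t \<in> - {0}"
    and yd: "\<And>t. t \<in> {-d<..<d} \<Longrightarrow> (y has_vector_derivative F (y t)) (at t)"
    using ode_local_existence[OF smooth_F, of x] x0 by auto
  let ?I = "{-d<..<d}"
  have 0: "0 \<in> ?I" using \<open>d > 0\<close> by simp
  have yn: "norm (y t) = 1" if "t \<in> ?I" for t
  proof -
    have "((\<lambda>t. y t \<bullet> y t) has_vector_derivative 0) (at t)" if "t \<in> ?I" for t
      using bounded_bilinear.has_vector_derivative[OF bounded_bilinear_inner yd[OF that] yd[OF that]] F_orth[of "y t"]
      by (simp add: inner_commute)
    from vector_derivative_zero_interval_constant[OF this \<open>t \<in> ?I\<close> 0] show ?thesis
      using \<open>y 0 = x\<close> x by (simp add: norm_eq_1)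
  qed
  have geo_y: "geodesic_in eucl_metric (sphere 0 1) ?I y"
    using geo[unfolded geodesic_field_sphere_def, rule_format, of ?I y] yd yn F_sphere[OF yn] by auto
  have "D x (F x) \<bullet> (u - (u \<bullet> x) *\<^sub>R x) = 0" for u
  proof -
    \<comment> \<open>A constant vector u projected to the tangent spaces along y gives a smooth
      test field with a prescribed tangential value at time 0.\<close>
    define w where "w t = u - (u \<bullet> y t) *\<^sub>R y t" for t
    have ws: "smooth_map_on ?I w" unfolding w_def[abs_def] by (intro smooth_intros ys) auto
    have "euler_lagrange (\<lambda>_ _. 0) y 0 (w 0) = 0"
    proof (rule geodesic_in_euler_lagrange[OF energy_form_eucl geo_y smooth_map_on_continuous[OF ws] _ 0])
      fix a b :: real
      let ?h = "\<lambda>z. sphere_push (y (snd z)) (bump a b (snd z) *\<^sub>R w (snd z)) (fst z)"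
      have [intro]: "open ({-1<..<1::real} \<times> ?I)" by (intro open_Times) auto
      have "smooth_map_on ({-1<..<1} \<times> ?I) ?h"
        by (intro smooth_map_on_sphere_push smooth_map_on_scaleR smooth_map_on_compose[OF ys]
            smooth_map_on_compose[OF ws] smooth_map_on_bump_comp smooth_map_on_snd smooth_map_on_fst smooth_map_on_ident) auto
      moreover have "y t \<bullet> (bump a b t *\<^sub>R w t) = 0" if "t \<in> ?I" for t
        using yn[OF that] by (simp add: w_def inner_diff inner_commute dot_square_norm)
      ultimately show "\<exists>h. smooth_map_on ({-1<..<1} \<times> ?I) h \<and>
        (\<forall>s\<in>{-1<..<1}. \<forall>t\<in>?I. h (s, t) \<in> sphere 0 1 \<and> (bump a b t = 0 \<longrightarrow> h (s, t) = y t)) \<and>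
        (\<forall>t\<in>?I. h (0, t) = y t \<and> ((\<lambda>s. h (s, t)) has_vector_derivative bump a b t *\<^sub>R w t) (at 0))"
        using norm_sphere_push[OF yn] sphere_push_has_vector_derivative by (intro exI[of _ ?h]) auto
    qed
    moreover have "vector_derivative (\<lambda>t. vector_derivative y (at t)) (at 0) = D (y 0) (F (y 0))"
      using second_vector_derivative(2)[OF _ 0 yd F_curve[OF _ yd[OF 0]]] y0[OF 0] by simp
    ultimately show ?thesis
      using \<open>y 0 = x\<close> by (simp add: euler_lagrange_def w_def)
  qed
  moreover have "D x (F x) \<bullet> x = -1"
    using D_inner_point[OF x0] F_norm[of x] x by (simp add: dot_square_norm)
  ultimately have "(D x (F x) + x) \<bullet> u = 0" for u
    by (metis (no_types, lifting) add.inverse_inverse diff_minus_eq_add inner_add_left inner_commute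
        inner_diff_right inner_scaleR_right mult.right_neutral mult_minus_right)
  then have "D x (F x) + x = 0" using inner_eq_zero_iff by blast
  then show ?thesis by (simp add: eq_neg_iff_add_eq_0)
qed

lemma D_F_geodesic:
  assumes geo: "geodesic_field_sphere \<xi>" and x: "x \<noteq> 0"
  shows "D x (F x) = - x"
proof -
  define u where "u = x /\<^sub>R norm x"
  have u: "norm u = 1" "u \<noteq> 0" "x = norm x *\<^sub>R u" and n: "norm x > 0" using x by (auto simp: u_def)
  have "D x (F x) = D (norm x *\<^sub>R u) (F (norm x *\<^sub>R u))" using u(3) by simp
  also have "\<dots> = norm x *\<^sub>R D u (F u)"
    by (simp add: D_scale[OF u(2) n] F_scale[OF n] linear_scale[OF linear_D[OF u(2)]])
  also have "\<dots> = - x" using u(3) D_F_geodesic_unit[OF geo u(1)] by simp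
  finally show ?thesis .
qed

end

section \<open>The lift of a curve to the image of the field\<close>

lemma smooth_map_on_vec_nth: "smooth_map_on U f \<Longrightarrow> smooth_map_on U (\<lambda>z. f z $ i)"
  by (rule smooth_map_on_bounded_linear_comp[OF bounded_linear_vec_nth])

lemma smooth_map_on_vec_lambda:
  fixes f :: "'n::finite \<Rightarrow> 'z::euclidean_space \<Rightarrow> real"
  assumes "open U" "\<And>i. smooth_map_on U (f i)"
  shows "smooth_map_on U (\<lambda>z. \<chi> i. f i z)"
proof (rule smooth_map_on_cong)
  show "smooth_map_on U (\<lambda>z. \<Sum>i\<in>UNIV. f i z *\<^sub>R (axis i 1 :: real^'n))"
    by (intro smooth_intros assms)
  show "(\<Sum>i\<in>UNIV. f i z *\<^sub>R (axis i 1 :: real^'n)) = (\<chi> i. f i z)" for z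
    by (simp add: vec_eq_iff axis_def if_distrib cong: if_cong)
qed

lemma smooth_map_on_det:
  fixes A :: "'z::euclidean_space \<Rightarrow> real^'n^'n"
  assumes "open U" "\<And>i j. smooth_map_on U (\<lambda>z. A z $ i $ j)"
  shows "smooth_map_on U (\<lambda>z. det (A z))"
  unfolding det_def by (intro smooth_intros assms)

text \<open>Cramer's rule writes the solution as quotients of determinants, which are polynomial in
  the entries.\<close>

lemma smooth_linear_solve:
  fixes A :: "'z::euclidean_space \<Rightarrow> real^'n^'n" and b :: "'z \<Rightarrow> real^'n"
  assumes "open U" and A: "\<And>i j. smooth_map_on U (\<lambda>z. A z $ i $ j)" and b: "smooth_map_on U b"
    and det: "\<And>z. z \<in> U \<Longrightarrow> det (A z) \<noteq> 0"
  obtains s where "smooth_map_on U s" "\<And>z. z \<in> U \<Longrightarrow> A z *v s z = b z"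
proof
  let ?s = "\<lambda>z. \<chi> k. det (\<chi> i j. if j = k then b z $ i else A z $ i $ j) / det (A z)"
  have *: "smooth_map_on U (\<lambda>z. (\<chi> i j. if j = k then b z $ i else A z $ i $ j) $ i $ j)" for i j k
    using A b by (cases "j = k") (auto intro: smooth_map_on_vec_nth)
  show "smooth_map_on U ?s"
    by (intro smooth_map_on_vec_lambda smooth_map_on_divide smooth_map_on_det assms * det)
  show "A z *v ?s z = b z" if "z \<in> U" for z
    using cramer[OF det[OF that], of "?s z" "b z"] by simp
qed

lemma euler_lagrange_sasaki:
  fixes c e :: "real \<Rightarrow> 'a::euclidean_space"
  assumes "open I" "t \<in> I"
    and c: "\<And>t. t \<in> I \<Longrightarrow> (c has_vector_derivative c1 t) (at t)" "(c1 has_vector_derivative c2) (at t)"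
    and e: "\<And>t. t \<in> I \<Longrightarrow> (e has_vector_derivative e1 t) (at t)" "(e1 has_vector_derivative e2) (at t)"
  shows "euler_lagrange sasaki_form (\<lambda>t. (c t, e t)) t (a, b) =
    c2 \<bullet> a - (e t \<bullet> c2 + e1 t \<bullet> c1 t) * (e t \<bullet> a) - (e t \<bullet> c1 t) * (e1 t \<bullet> a)
    + (e2 + (e t \<bullet> c1 t) *\<^sub>R c1 t) \<bullet> b"
  using second_vector_derivative[OF assms(1,2) has_vector_derivative_Pair[OF c(1) e(1)] has_vector_derivative_Pair[OF c(2) e(2)]]
  by (simp add: euler_lagrange_def sasaki_form_def Let_def inner_add_left inner_add_right inner_commute)

context unit_field
begin

abbreviation "field_image \<equiv> (\<lambda>x. (x, \<xi> x)) ` sphere 0 1"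

lemma field_image_subset: "field_image \<subseteq> unit_tangent_sphere"
proof
  fix p assume "p \<in> field_image"
  then obtain x where "norm x = 1" "p = (x, F x)" using F_sphere by auto
  then show "p \<in> unit_tangent_sphere"
    using F_norm[of x] F_orth[of x] by (simp add: unit_tangent_sphere_def)
qed

lemma field_image_iff: "p \<in> field_image \<longleftrightarrow> norm (fst p) = 1 \<and> snd p = F (fst p)"
  using F_sphere by (auto simp: image_iff prod_eq_iff)

lemma punctured_line:
  assumes "x \<noteq> 0"
  obtains I :: "real set" where "open I" "0 \<in> I" "\<And>s. s \<in> I \<Longrightarrow> x + s *\<^sub>R z \<noteq> (0::'a)"
proof
  show "open ((\<lambda>s::real. x + s *\<^sub>R z) -` (- {0}))"
    by (rule open_vimage) (intro open_Compl closed_singleton continuous_intros)+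
qed (use assms in auto)

text \<open>\<open>D_inner_point\<close> differentiated once more with y held fixed;
  \<open>D2_inner_F\<close> arises likewise from \<open>D_inner_F\<close>.\<close>

lemma D2_inner_point:
  assumes "x \<noteq> 0"
  shows "D2 x y z \<bullet> x = - (D x y \<bullet> z) - y \<bullet> D x z"
proof -
  obtain I where I: "open I" "0 \<in> I" "\<And>s. s \<in> I \<Longrightarrow> x + s *\<^sub>R z \<noteq> 0"
    using punctured_line[OF assms, where z = z] by metis
  have "((\<lambda>s. D (x + s *\<^sub>R z) y) has_vector_derivative D2 (x + 0 *\<^sub>R z) y z + D (x + 0 *\<^sub>R z) 0) (at 0)"
    by (rule D_curve[OF I(1) I(3) I(2) line_derivative has_vector_derivative_const])
  then have d: "((\<lambda>s. D (x + s *\<^sub>R z) y) has_vector_derivative D2 x y z) (at 0)"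
    using linear_0[OF linear_D[OF assms]] by simp
  have "((\<lambda>s. D (x + s *\<^sub>R z) y \<bullet> (x + s *\<^sub>R z)) has_vector_derivative
      (D (x + 0 *\<^sub>R z) y \<bullet> z + D2 x y z \<bullet> (x + 0 *\<^sub>R z))) (at 0)"
    by (rule bounded_bilinear.has_vector_derivative[OF bounded_bilinear_inner d line_derivative])
  moreover have "((\<lambda>s. D (x + s *\<^sub>R z) y \<bullet> (x + s *\<^sub>R z)) has_vector_derivative - (y \<bullet> D x z)) (at 0)"
  proof (rule has_vector_derivative_transform_within_open[OF _ I(1,2)])
    show "((\<lambda>s. - (y \<bullet> F (x + s *\<^sub>R z))) has_vector_derivative - (y \<bullet> D x z)) (at 0)"
      using bounded_linear.has_vector_derivative[OF bounded_linear_inner_right F_curve[OF _ line_derivative, of x 0 z]] assms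
      by (intro has_vector_derivative_minus) simp
  qed (use I D_inner_point in simp)
  ultimately have "D (x + 0 *\<^sub>R z) y \<bullet> z + D2 x y z \<bullet> (x + 0 *\<^sub>R z) = - (y \<bullet> D x z)"
    by (rule vector_derivative_unique_at)
  then show ?thesis by simp
qed

lemma D2_inner_F:
  assumes "x \<noteq> 0"
  shows "D2 x y z \<bullet> F x = y \<bullet> z - D x y \<bullet> D x z"
proof -
  obtain I where I: "open I" "0 \<in> I" "\<And>s. s \<in> I \<Longrightarrow> x + s *\<^sub>R z \<noteq> 0"
    using punctured_line[OF assms, where z = z] by metis
  have "((\<lambda>s. D (x + s *\<^sub>R z) y) has_vector_derivative D2 (x + 0 *\<^sub>R z) y z + D (x + 0 *\<^sub>R z) 0) (at 0)"
    by (rule D_curve[OF I(1) I(3) I(2) line_derivative has_vector_derivative_const])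
  then have d: "((\<lambda>s. D (x + s *\<^sub>R z) y) has_vector_derivative D2 x y z) (at 0)"
    using linear_0[OF linear_D[OF assms]] by simp
  have "((\<lambda>s. D (x + s *\<^sub>R z) y \<bullet> F (x + s *\<^sub>R z)) has_vector_derivative
      (D (x + 0 *\<^sub>R z) y \<bullet> D (x + 0 *\<^sub>R z) z + D2 x y z \<bullet> F (x + 0 *\<^sub>R z))) (at 0)"
    using assms by (intro bounded_bilinear.has_vector_derivative[OF bounded_bilinear_inner d] F_curve line_derivative) simp
  moreover have "((\<lambda>s. D (x + s *\<^sub>R z) y \<bullet> F (x + s *\<^sub>R z)) has_vector_derivative y \<bullet> z) (at 0)"
  proof (rule has_vector_derivative_transform_within_open[OF _ I(1,2)])
    show "((\<lambda>s. y \<bullet> (x + s *\<^sub>R z)) has_vector_derivative y \<bullet> z) (at 0)"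
      by (rule bounded_linear.has_vector_derivative[OF bounded_linear_inner_right line_derivative])
  qed (use I D_inner_F in simp)
  ultimately have "D (x + 0 *\<^sub>R z) y \<bullet> D (x + 0 *\<^sub>R z) z + D2 x y z \<bullet> F (x + 0 *\<^sub>R z) = y \<bullet> z"
    by (rule vector_derivative_unique_at)
  then show ?thesis by simp
qed

text \<open>The Euler--Lagrange expression of the lift (c, F c) of a curve c in the sphere at the point x
  with velocity y and acceleration b, tested against the variation (w, D x w).\<close>

definition lift_equation :: "'a \<Rightarrow> 'a \<Rightarrow> 'a \<Rightarrow> 'a \<Rightarrow> real" where
  "lift_equation x y b w = b \<bullet> w - (F x \<bullet> b + D x y \<bullet> y) * (F x \<bullet> w) - (F x \<bullet> y) * (D x y \<bullet> w)
     + (D2 x y y + D x b + (F x \<bullet> y) *\<^sub>R y) \<bullet> D x w"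

lemma euler_lagrange_lift:
  assumes "open I" "t \<in> I" "\<And>t. t \<in> I \<Longrightarrow> c t \<noteq> 0"
    and c: "\<And>t. t \<in> I \<Longrightarrow> (c has_vector_derivative y t) (at t)" "(y has_vector_derivative b) (at t)"
  shows "euler_lagrange sasaki_form (\<lambda>t. (c t, F (c t))) t (w, w') = b \<bullet> w
    - (F (c t) \<bullet> b + D (c t) (y t) \<bullet> y t) * (F (c t) \<bullet> w) - (F (c t) \<bullet> y t) * (D (c t) (y t) \<bullet> w)
    + (D2 (c t) (y t) (y t) + D (c t) b + (F (c t) \<bullet> y t) *\<^sub>R y t) \<bullet> w'"
  by (rule euler_lagrange_sasaki[OF assms(1,2) c F_curve[OF assms(3) c(1)] D_curve[OF assms(1,3,2) c(1)[OF assms(2)] c(2)]])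

text \<open>A variation inside the image has the form (q, F q), so its field is (w,
  \<open>D (c t) w\<close>) with w tangent to the sphere; these are exactly the fields that
  \<open>lift_equation\<close> tests.\<close>

lemma geodesic_in_field_imageI:
  assumes I: "open I" and c: "smooth_map_on I c" "\<And>t. t \<in> I \<Longrightarrow> norm (c t) = 1"
    and d: "\<And>t. t \<in> I \<Longrightarrow> (c has_vector_derivative y t) (at t)"
      "\<And>t. t \<in> I \<Longrightarrow> (y has_vector_derivative b t) (at t)"
    and eq: "\<And>t w. t \<in> I \<Longrightarrow> w \<bullet> c t = 0 \<Longrightarrow> lift_equation (c t) (y t) (b t) w = 0"
  shows "geodesic_in sasaki_metric field_image I (\<lambda>t. (c t, F (c t)))"
proof (rule geodesic_inI[OF energy_form_sasaki[OF field_image_subset] I])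
  have c0: "c t \<noteq> 0" if "t \<in> I" for t using c(2)[OF that] by auto
  show "smooth_map_on I (\<lambda>t. (c t, F (c t)))"
    by (intro smooth_map_on_Pair c smooth_map_on_compose[OF smooth_F]) (use c0 in simp)
  show "(\<lambda>t. (c t, F (c t))) ` I \<subseteq> field_image"
    using c(2) by (auto simp only: field_image_iff fst_conv snd_conv)
  fix h :: "real \<times> real \<Rightarrow> 'a \<times> 'a" and \<epsilon> t :: real
  assume \<epsilon>: "\<epsilon> > 0" and h: "smooth_map_on ({-\<epsilon><..<\<epsilon>} \<times> I) h"
    and hN: "\<And>s t. s \<in> {-\<epsilon><..<\<epsilon>} \<Longrightarrow> t \<in> I \<Longrightarrow> h (s, t) \<in> field_image"
    and h0: "\<And>t. t \<in> I \<Longrightarrow> h (0, t) = (c t, F (c t))" and t: "t \<in> I"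
  define w w' where "w = fst (frechet_derivative h (at (0, t)) (1, 0))"
    and "w' = snd (frechet_derivative h (at (0, t)) (1, 0))"
  let ?S = "{-\<epsilon><..<\<epsilon>}"
  have "((\<lambda>s. h (s, t)) has_vector_derivative frechet_derivative h (at (0, t)) (1, 0)) (at 0)"
    by (rule partial_derivative(1)[OF h]) (use \<epsilon> t in simp)
  note dw = bounded_linear.has_vector_derivative[OF bounded_linear_fst this, folded w_def]
    bounded_linear.has_vector_derivative[OF bounded_linear_snd this, folded w'_def]
  have "((\<lambda>s. F (fst (h (s, t)))) has_vector_derivative D (c t) w) (at 0)"
    using F_curve[OF _ dw(1)] c0[OF t] by (simp add: h0[OF t])
  then have "((\<lambda>s. snd (h (s, t))) has_vector_derivative D (c t) w) (at 0)"
    by (rule has_vector_derivative_transform_within_open[where S = ?S])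
      (use \<epsilon> hN[OF _ t] in \<open>simp_all add: field_image_iff\<close>)
  then have w': "w' = D (c t) w" using vector_derivative_unique_at[OF dw(2)] by simp
  have "((\<lambda>s. fst (h (s, t)) \<bullet> fst (h (s, t))) has_vector_derivative c t \<bullet> w + w \<bullet> c t) (at 0)"
    using bounded_bilinear.has_vector_derivative[OF bounded_bilinear_inner dw(1) dw(1)] by (simp add: h0[OF t])
  moreover have "((\<lambda>s. fst (h (s, t)) \<bullet> fst (h (s, t))) has_vector_derivative 0) (at 0)"
    by (rule has_vector_derivative_transform_within_open[OF has_vector_derivative_const[of 1], where S = ?S])
      (use \<epsilon> hN[OF _ t] in \<open>simp_all add: field_image_iff dot_square_norm\<close>)
  ultimately have "c t \<bullet> w + w \<bullet> c t = 0" by (rule vector_derivative_unique_at)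
  then have "w \<bullet> c t = 0" by (simp add: inner_commute)
  from eq[OF t this] have "euler_lagrange sasaki_form (\<lambda>t. (c t, F (c t))) t (w, w') = 0"
    using euler_lagrange_lift[OF I t c0 d(1) d(2)[OF t], of w w'] by (simp add: lift_equation_def w')
  then show "euler_lagrange sasaki_form (\<lambda>t. (c t, F (c t))) t (frechet_derivative h (at (0, t)) (1, 0)) = 0"
    by (simp add: w_def w'_def)
qed

text \<open>The base curve stays fixed while \<open>F (c t)\<close> is rotated inside the unit
  sphere orthogonal to \<open>c t\<close>. The test field (0, w) leaves only the vertical part of
  the Euler-Lagrange expression.\<close>

lemma vertical_variation:
  assumes I: "open I" and c: "smooth_map_on I c" "\<And>t. t \<in> I \<Longrightarrow> norm (c t) = 1"
    and d: "\<And>t. t \<in> I \<Longrightarrow> (c has_vector_derivative y t) (at t)" "(y has_vector_derivative b) (at t)"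
    and geo: "geodesic_in sasaki_metric unit_tangent_sphere I (\<lambda>t. (c t, F (c t)))"
    and t: "t \<in> I" and u: "u \<bullet> c t = 0" "u \<bullet> F (c t) = 0"
  shows "(D2 (c t) (y t) (y t) + D (c t) b + (F (c t) \<bullet> y t) *\<^sub>R y t) \<bullet> u = 0"
proof -
  have c0: "c t \<noteq> 0" if "t \<in> I" for t using c(2)[OF that] by auto
  let ?e = "\<lambda>t. F (c t)"
  have e: "smooth_map_on I ?e"
    by (intro c smooth_map_on_compose[OF smooth_F]) (use c0 in simp)
  have en: "norm (?e t) = 1" "c t \<bullet> ?e t = 0" if "t \<in> I" for t
    using F_norm F_orth c(2)[OF that] by auto
  \<comment> \<open>Orthogonality to \<open>c t\<close> keeps the rotated vector tangent to the
    sphere, orthogonality to \<open>F (c t)\<close> is what \<open>sphere_push\<close> needs to keep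
    its length.\<close>
  define w where "w t = u - (u \<bullet> c t) *\<^sub>R c t - (u \<bullet> ?e t) *\<^sub>R ?e t" for t
  have w: "smooth_map_on I w" unfolding w_def[abs_def]
    by (intro smooth_map_on_diff smooth_map_on_scaleR smooth_map_on_inner smooth_map_on_const c e I)
  have w_orth: "c t \<bullet> w t = 0" "?e t \<bullet> w t = 0" if "t \<in> I" for t
  proof -
    have "c t \<bullet> c t = 1" "?e t \<bullet> ?e t = 1" "c t \<bullet> ?e t = 0" "?e t \<bullet> c t = 0"
      using en[OF that] c(2)[OF that] by (simp_all add: norm_eq_1 inner_commute)
    then show "c t \<bullet> w t = 0" "?e t \<bullet> w t = 0"
      by (simp_all add: w_def inner_diff_right inner_commute[of u])
  qed
  have "euler_lagrange sasaki_form (\<lambda>t. (c t, ?e t)) t (0, w t) = 0"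
  proof (rule geodesic_in_euler_lagrange[OF energy_form_sasaki[OF order_refl] geo _ _ t])
    show "continuous_on I (\<lambda>t. (0, w t))"
      by (intro continuous_intros smooth_map_on_continuous[OF w])
    fix p q :: real
    let ?h = "\<lambda>z. (c (snd z), sphere_push (?e (snd z)) (bump p q (snd z) *\<^sub>R w (snd z)) (fst z))"
    have [intro]: "open ({-1<..<1::real} \<times> I)" by (intro open_Times I) auto
    have "smooth_map_on ({-1<..<1} \<times> I) ?h"
      by (intro smooth_map_on_Pair smooth_map_on_sphere_push smooth_map_on_scaleR smooth_map_on_compose[OF c(1)]
          smooth_map_on_compose[OF e] smooth_map_on_compose[OF w] smooth_map_on_bump_comp
          smooth_map_on_snd smooth_map_on_fst smooth_map_on_ident) auto
    moreover have "?h (s, t) \<in> unit_tangent_sphere" if "t \<in> I" for s t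
    proof -
      have "norm (sphere_push (?e t) (bump p q t *\<^sub>R w t) s) = 1"
        by (rule norm_sphere_push) (simp_all add: en[OF that] w_orth[OF that])
      moreover have "c t \<bullet> sphere_push (?e t) (bump p q t *\<^sub>R w t) s = 0"
        by (simp add: sphere_push_def inner_add_right en[OF that] w_orth[OF that])
      ultimately show ?thesis by (simp add: unit_tangent_sphere_def c(2)[OF that])
    qed
    moreover have "((\<lambda>s. ?h (s, t)) has_vector_derivative bump p q t *\<^sub>R (0, w t)) (at 0)" for t
      using has_vector_derivative_Pair[OF has_vector_derivative_const sphere_push_has_vector_derivative] by simp
    ultimately show "\<exists>h. smooth_map_on ({-1<..<1} \<times> I) h \<and>
        (\<forall>s\<in>{-1<..<1}. \<forall>t\<in>I. h (s, t) \<in> unit_tangent_sphere \<and> (bump p q t = 0 \<longrightarrow> h (s, t) = (c t, ?e t))) \<and>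
        (\<forall>t\<in>I. h (0, t) = (c t, ?e t) \<and> ((\<lambda>s. h (s, t)) has_vector_derivative bump p q t *\<^sub>R (0, w t)) (at 0))"
      by (intro exI[of _ ?h]) simp
  qed
  moreover have "w t = u" using u by (simp add: w_def)
  ultimately show ?thesis
    using euler_lagrange_lift[OF I t c0 d, of 0 u] by simp
qed

end

section \<open>Hopf fields are totally geodesic\<close>

lemma tangent_smooth_curve:
  fixes g :: "real \<Rightarrow> 'a::euclidean_space"
  assumes "smooth_map_on I g"
  obtains g1 g2 where "\<And>t. t \<in> I \<Longrightarrow> (g has_vector_derivative g1 t) (at t)"
    "\<And>t. t \<in> I \<Longrightarrow> (g1 has_vector_derivative g2 t) (at t)"
  using that[OF frechet_derivative_real_line(2)[OF assms]
      frechet_derivative_real_line(2)[OF smooth_map_on_vector_derivative[OF assms]]] by simp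

lemma unit_curve_orthogonal_derivative:
  fixes g :: "real \<Rightarrow> 'a::euclidean_space"
  assumes "open S" "t \<in> S" "\<And>s. s \<in> S \<Longrightarrow> norm (g s) = 1" "(g has_vector_derivative w) (at t)"
  shows "w \<bullet> g t = 0"
proof -
  have "((\<lambda>s. g s \<bullet> g s) has_vector_derivative g t \<bullet> w + w \<bullet> g t) (at t)"
    by (rule bounded_bilinear.has_vector_derivative[OF bounded_bilinear_inner assms(4) assms(4)])
  moreover have "((\<lambda>s. g s \<bullet> g s) has_vector_derivative 0) (at t)"
    by (rule has_vector_derivative_transform_within_open[OF has_vector_derivative_const[of 1] assms(1,2)])
      (use assms(3) in \<open>simp add: dot_square_norm\<close>)
  ultimately have "g t \<bullet> w + w \<bullet> g t = 0" by (rule vector_derivative_unique_at)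
  then show ?thesis by (simp add: inner_commute)
qed

lemma orthogonal_complement_line:
  fixes x E :: "'a::euclidean_space"
  assumes "norm x = 1" "\<And>w. w \<bullet> x = 0 \<Longrightarrow> E \<bullet> w = 0"
  shows "E = (E \<bullet> x) *\<^sub>R x"
proof -
  let ?R = "E - (E \<bullet> x) *\<^sub>R x"
  have R: "?R \<bullet> x = 0" using assms(1) by (simp add: inner_diff_left norm_eq_1)
  have "?R \<bullet> ?R = E \<bullet> ?R - (E \<bullet> x) * (?R \<bullet> x)"
    by (simp only: inner_diff_left inner_scaleR_left inner_commute[of x ?R])
  then have "?R \<bullet> ?R = 0" using R assms(2)[OF R] by simp
  then have "?R = 0" by (simp only: inner_eq_zero_iff)
  then show ?thesis by simp
qed

lemma orthogonal_complement_plane: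
  fixes x v E :: "'a::euclidean_space"
  assumes "norm x = 1" "norm v = 1" "x \<bullet> v = 0" "\<And>w. w \<bullet> x = 0 \<Longrightarrow> w \<bullet> v = 0 \<Longrightarrow> E \<bullet> w = 0"
  shows "E = (E \<bullet> x) *\<^sub>R x + (E \<bullet> v) *\<^sub>R v"
proof -
  let ?R = "E - (E \<bullet> x) *\<^sub>R x - (E \<bullet> v) *\<^sub>R v"
  have "v \<bullet> x = 0" using assms(3) by (simp add: inner_commute)
  then have R: "?R \<bullet> x = 0" "?R \<bullet> v = 0" using assms(1-3) by (simp_all add: inner_diff_left norm_eq_1)
  have "?R \<bullet> ?R = E \<bullet> ?R - (E \<bullet> x) * (?R \<bullet> x) - (E \<bullet> v) * (?R \<bullet> v)"
    by (simp only: inner_diff_left inner_scaleR_left inner_commute[of x ?R] inner_commute[of v ?R])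
  then have "?R \<bullet> ?R = 0" using R assms(4)[OF R] by simp
  then have "?R = 0" by (simp only: inner_eq_zero_iff)
  then show ?thesis by (simp add: algebra_simps)
qed

lemma orthogonal_complex_structure_inner:
  fixes j :: "'a::euclidean_space \<Rightarrow> 'a"
  assumes "\<And>x. j (j x) = - x" "\<And>x y. j x \<bullet> j y = x \<bullet> y"
  shows "y \<bullet> j x = - (j y \<bullet> x)" "j x \<bullet> x = 0" "x \<bullet> j x = 0"
proof -
  show *: "y \<bullet> j x = - (j y \<bullet> x)" for x y using assms(2)[of y "j x"] assms(1) by simp
  show "j x \<bullet> x = 0" using *[of x x] by (simp add: inner_commute)
  then show "x \<bullet> j x = 0" by (simp add: inner_commute)
qed

lemma orthogonal_complex_structure_totally_geodesic:
  fixes \<xi> j :: "'a::euclidean_space \<Rightarrow> 'a"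
  assumes j: "linear j" and jj: "\<And>x. j (j x) = - x" and iso: "\<And>x y. j x \<bullet> j y = x \<bullet> y"
    and \<xi>: "\<And>x. norm x = 1 \<Longrightarrow> \<xi> x = j x"
  shows "totally_geodesic_field \<xi>"
  unfolding totally_geodesic_field_def
proof (intro allI impI)
  let ?N = "(\<lambda>x. (x, \<xi> x)) ` sphere 0 1"
  note skew = orthogonal_complex_structure_inner[of j, OF jj iso]
  have bl: "bounded_linear j" using j by (rule linear_conv_bounded_linear[THEN iffD1])
  have jn: "norm (j x) = norm x" for x using iso[of x x] by (simp add: norm_eq_sqrt_inner)
  have N: "p \<in> ?N \<longleftrightarrow> norm (fst p) = 1 \<and> snd p = j (fst p)" for p
    using \<xi> by (auto simp: image_iff prod_eq_iff)
  have NT: "?N \<subseteq> unit_tangent_sphere"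
  proof
    fix p assume "p \<in> ?N"
    then show "p \<in> unit_tangent_sphere"
      unfolding N by (cases p) (simp add: unit_tangent_sphere_def jn skew(3))
  qed
  fix I \<gamma> assume geo: "geodesic_in sasaki_metric ?N I \<gamma>"
  then have I: "open I" and \<gamma>: "smooth_map_on I \<gamma>" "\<gamma> ` I \<subseteq> ?N" by (simp_all add: geodesic_in_def)
  define c where "c t = fst (\<gamma> t)" for t
  have c: "smooth_map_on I c" unfolding c_def[abs_def] by (rule smooth_map_on_fst[OF \<gamma>(1)])
  have \<gamma>N: "norm (c t) = 1" "snd (\<gamma> t) = j (c t)" "\<gamma> t = (c t, j (c t))" if "t \<in> I" for t
  proof -
    have "\<gamma> t \<in> ?N" using \<gamma>(2) that by blast
    then show "norm (c t) = 1" "snd (\<gamma> t) = j (c t)" "\<gamma> t = (c t, j (c t))"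
      unfolding N by (simp_all add: c_def prod_eq_iff)
  qed
  obtain y b where dc: "\<And>t. t \<in> I \<Longrightarrow> (c has_vector_derivative y t) (at t)"
    "\<And>t. t \<in> I \<Longrightarrow> (y has_vector_derivative b t) (at t)"
    using tangent_smooth_curve[OF c] by metis
  have de: "((\<lambda>t. snd (\<gamma> t)) has_vector_derivative j (y t)) (at t)" if "t \<in> I" for t
    by (rule has_vector_derivative_transform_within_open[OF bounded_linear.has_vector_derivative[OF bl dc(1)[OF that]] I that])
      (simp add: \<gamma>N)
  have EL: "euler_lagrange sasaki_form \<gamma> t (w, w') =
    b t \<bullet> w - (j (c t) \<bullet> b t) * (j (c t) \<bullet> w) - (j (c t) \<bullet> y t) * (j (y t) \<bullet> w)
    + (j (b t) + (j (c t) \<bullet> y t) *\<^sub>R y t) \<bullet> w'" if "t \<in> I" for t w w'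
    using euler_lagrange_sasaki[OF I that dc(1) dc(2)[OF that] de
        bounded_linear.has_vector_derivative[OF bl dc(2)[OF that]], of w w']
    by (simp add: c_def[symmetric] \<gamma>N[OF that] skew(2)) (simp add: c_def)
  have yc: "y t \<bullet> c t = 0" if "t \<in> I" for t
    by (rule unit_curve_orthogonal_derivative[OF I that \<gamma>N(1) dc(1)[OF that]])
  have acc: "\<exists>\<mu>. b t = (j (c t) \<bullet> y t) *\<^sub>R j (y t) + \<mu> *\<^sub>R c t" "j (c t) \<bullet> b t = 0" if t: "t \<in> I" for t
  proof -
    let ?l = "j (c t) \<bullet> y t"
    \<comment> \<open>The vector representing the Euler-Lagrange expression on the fields (w, j w):
      the isometry property doubles the \<open>b t\<close> term, skewness doubles the
      \<open>j (y t)\<close> term.\<close>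
    define E where "E = 2 *\<^sub>R b t - (j (c t) \<bullet> b t) *\<^sub>R j (c t) - (2 * ?l) *\<^sub>R j (y t)"
    have "E \<bullet> u = 0" if u: "u \<bullet> c t = 0" for u
    proof -
      define w where "w t = u - (u \<bullet> c t) *\<^sub>R c t" for t
      have ws: "smooth_map_on I w" unfolding w_def[abs_def]
        by (intro smooth_map_on_diff smooth_map_on_scaleR smooth_map_on_inner smooth_map_on_const c I)
      have wc: "c t \<bullet> w t = 0" if "t \<in> I" for t
        using \<gamma>N(1)[OF that] by (simp add: w_def inner_diff_right norm_eq_1 inner_commute[of u])
      have "euler_lagrange sasaki_form \<gamma> t (w t, j (w t)) = 0"
      proof (rule geodesic_in_euler_lagrange[OF energy_form_sasaki[OF NT] geo _ _ t])
        show "continuous_on I (\<lambda>t. (w t, j (w t)))"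
          by (intro continuous_on_Pair smooth_map_on_continuous[OF ws]
              smooth_map_on_continuous[OF smooth_map_on_bounded_linear_comp[OF bl ws]])
        fix p q :: real
        let ?q = "\<lambda>z. sphere_push (c (snd z)) (bump p q (snd z) *\<^sub>R w (snd z)) (fst z)"
        let ?h = "\<lambda>z. (?q z, j (?q z))"
        have [intro]: "open ({-1<..<1::real} \<times> I)" by (intro open_Times I) auto
        have "smooth_map_on ({-1<..<1} \<times> I) ?q"
          by (intro smooth_map_on_sphere_push smooth_map_on_scaleR smooth_map_on_compose[OF c]
              smooth_map_on_compose[OF ws] smooth_map_on_bump_comp
              smooth_map_on_snd smooth_map_on_fst smooth_map_on_ident) auto
        then have "smooth_map_on ({-1<..<1} \<times> I) ?h"
          by (intro smooth_map_on_Pair smooth_map_on_bounded_linear_comp[OF bl])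
        moreover have "?h (s, t) \<in> ?N" if "t \<in> I" for s t
          unfolding N by (simp add: norm_sphere_push \<gamma>N(1)[OF that] wc[OF that])
        moreover have "((\<lambda>s. ?h (s, t)) has_vector_derivative bump p q t *\<^sub>R (w t, j (w t))) (at 0)" for t
          unfolding scaleR_Pair linear_scale[OF j, symmetric] fst_conv snd_conv
          by (intro has_vector_derivative_Pair sphere_push_has_vector_derivative
            bounded_linear.has_vector_derivative[OF bl])
        ultimately show "\<exists>h. smooth_map_on ({-1<..<1} \<times> I) h \<and>
            (\<forall>s\<in>{-1<..<1}. \<forall>t\<in>I. h (s, t) \<in> ?N \<and> (bump p q t = 0 \<longrightarrow> h (s, t) = \<gamma> t)) \<and>
            (\<forall>t\<in>I. h (0, t) = \<gamma> t \<and> ((\<lambda>s. h (s, t)) has_vector_derivative bump p q t *\<^sub>R (w t, j (w t))) (at 0))"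
          by (intro exI[of _ ?h]) (simp add: \<gamma>N(3))
      qed
      moreover have "w t = u" using u by (simp add: w_def)
      ultimately show "E \<bullet> u = 0"
        unfolding EL[OF t] E_def by (simp add: inner_add_left inner_diff_left iso skew(1)[of "y t" u] algebra_simps)
    qed
    from orthogonal_complement_line[OF \<gamma>N(1)[OF t] this]
    have E: "E = (E \<bullet> c t) *\<^sub>R c t" .
    \<comment> \<open>Pairing with the field itself shows that the acceleration has no component
      along \<open>j (c t)\<close>, because E is a multiple of \<open>c t\<close>.\<close>
    have "E \<bullet> j (c t) = j (c t) \<bullet> b t"
      using \<gamma>N(1)[OF t] yc[OF t]
      by (simp add: E_def inner_diff_left iso norm_eq_1 inner_commute[of "b t"])
    moreover have "E \<bullet> j (c t) = 0" by (subst E) (simp add: skew(1)[of "c t"] skew(2))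
    ultimately show vb: "j (c t) \<bullet> b t = 0" by simp
    obtain \<kappa> where "E = \<kappa> *\<^sub>R c t" using E by blast
    then have "2 *\<^sub>R b t = 2 *\<^sub>R (?l *\<^sub>R j (y t) + (\<kappa> / 2) *\<^sub>R c t)"
      using vb by (simp add: E_def algebra_simps)
    then show "\<exists>\<mu>. b t = ?l *\<^sub>R j (y t) + \<mu> *\<^sub>R c t" by (metis scaleR_cancel_left zero_neq_numeral)
  qed
  show "geodesic_in sasaki_metric unit_tangent_sphere I \<gamma>"
  proof (rule geodesic_inI[OF energy_form_sasaki[OF order_refl] I \<gamma>(1)])
    show "\<gamma> ` I \<subseteq> unit_tangent_sphere" using \<gamma>(2) NT by (rule order_trans)
    fix h :: "real \<times> real \<Rightarrow> 'a \<times> 'a" and \<epsilon> t :: real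
    assume \<epsilon>: "\<epsilon> > 0" and h: "smooth_map_on ({-\<epsilon><..<\<epsilon>} \<times> I) h"
      and hT: "\<And>s t. s \<in> {-\<epsilon><..<\<epsilon>} \<Longrightarrow> t \<in> I \<Longrightarrow> h (s, t) \<in> unit_tangent_sphere"
      and h0: "\<And>t. t \<in> I \<Longrightarrow> h (0, t) = \<gamma> t" and t: "t \<in> I"
    define w w' where "w = fst (frechet_derivative h (at (0, t)) (1, 0))"
      and "w' = snd (frechet_derivative h (at (0, t)) (1, 0))"
    let ?S = "{-\<epsilon><..<\<epsilon>}"
    have "((\<lambda>s. h (s, t)) has_vector_derivative frechet_derivative h (at (0, t)) (1, 0)) (at 0)"
      by (rule partial_derivative(1)[OF h]) (use \<epsilon> t in simp)
    note dw = bounded_linear.has_vector_derivative[OF bounded_linear_fst this, folded w_def]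
      bounded_linear.has_vector_derivative[OF bounded_linear_snd this, folded w'_def]
    have hn: "norm (fst (h (s, t))) = 1" "norm (snd (h (s, t))) = 1" if "s \<in> ?S" for s
      using hT[OF that t] by (auto simp: unit_tangent_sphere_def)
    have "w \<bullet> fst (h (0, t)) = 0"
      by (rule unit_curve_orthogonal_derivative[of ?S 0 "\<lambda>s. fst (h (s, t))", OF _ _ hn(1) dw(1)])
        (use \<epsilon> in auto)
    then have wc: "w \<bullet> c t = 0" by (simp add: h0[OF t] c_def)
    have "w' \<bullet> snd (h (0, t)) = 0"
      by (rule unit_curve_orthogonal_derivative[of ?S 0 "\<lambda>s. snd (h (s, t))", OF _ _ hn(2) dw(2)])
        (use \<epsilon> in auto)
    then have wv: "w' \<bullet> j (c t) = 0" by (simp add: h0[OF t] \<gamma>N(2)[OF t])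
    obtain \<mu> where \<mu>: "b t = (j (c t) \<bullet> y t) *\<^sub>R j (y t) + \<mu> *\<^sub>R c t" using acc(1)[OF t] by blast
    \<comment> \<open>Applying j to the acceleration formula, \<open>j (j (y t))\<close> cancels the
      velocity term. What remains is normal to the fibre sphere and is killed by every admissible
      w'.\<close>
    have "j (b t) + (j (c t) \<bullet> y t) *\<^sub>R y t = \<mu> *\<^sub>R j (c t)"
      by (subst \<mu>) (simp add: linear_add[OF j] linear_scale[OF j] jj)
    moreover have "b t \<bullet> w = (j (c t) \<bullet> y t) * (j (y t) \<bullet> w)"
      by (subst \<mu>) (use wc in \<open>simp add: inner_add_left inner_commute[of "c t" w]\<close>)
    ultimately have "euler_lagrange sasaki_form \<gamma> t (w, w') = 0"
      unfolding EL[OF t] using acc(2)[OF t] wv by (simp add: inner_commute)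
    then show "euler_lagrange sasaki_form \<gamma> t (frechet_derivative h (at (0, t)) (1, 0)) = 0"
      by (simp add: w_def w'_def)
  qed
qed

section \<open>Existence of geodesics in the image of the field\<close>

lemma adjoint_sum_inner:
  fixes L :: "'a::euclidean_space \<Rightarrow> 'b::euclidean_space"
  assumes "linear L"
  shows "(\<Sum>i\<in>Basis. (v \<bullet> L i) *\<^sub>R i) \<bullet> w = v \<bullet> L w"
  by (subst linear_Basis_expansion[OF assms, of w])
     (simp add: inner_sum_left inner_sum_right inner_commute mult.commute)

text \<open>Stated over a real vector space: on real^'d the simplifier also sees the componentwise ring.\<close>

lemma collect_scaleR:
  fixes x v X Z :: "'a::real_vector"
  shows "a *\<^sub>R x + p *\<^sub>R v - (- a *\<^sub>R x + l *\<^sub>R Z + q *\<^sub>R v) - l *\<^sub>R X =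
    - l *\<^sub>R (X + Z) + (2 * a) *\<^sub>R x + (p - q) *\<^sub>R v"
proof -
  have "(2 * a) *\<^sub>R x = a *\<^sub>R x + a *\<^sub>R x" by (simp only: mult_2 scaleR_left_distrib)
  then show ?thesis by (simp add: scaleR_left_distrib scaleR_right_distrib scaleR_left_diff_distrib)
qed

context unit_field
begin

text \<open>On tangent vectors at unit points this is the metric pulled back from the image. The
  division by \<open>x \<bullet> x\<close> keeps it positive definite at every nonzero point, since
  the differential equation is solved on an open set.\<close>

definition sasaki_pullback :: "'a \<Rightarrow> 'a \<Rightarrow> 'a \<Rightarrow> real" where
  "sasaki_pullback x y w = y \<bullet> w - (F x \<bullet> y) * (F x \<bullet> w) / (x \<bullet> x) + D x y \<bullet> D x w"

definition lift_force :: "'a \<Rightarrow> 'a \<Rightarrow> 'a \<Rightarrow> real" where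
  "lift_force x y w = (D x y \<bullet> y) * (F x \<bullet> w) + (F x \<bullet> y) * (D x y \<bullet> w)
     - (D2 x y y + (F x \<bullet> y) *\<^sub>R y) \<bullet> D x w"

lemma lift_equation_sasaki_pullback:
  "norm x = 1 \<Longrightarrow> lift_equation x y b w = sasaki_pullback x b w - lift_force x y w"
  by (simp add: lift_equation_def sasaki_pullback_def lift_force_def dot_square_norm inner_add_left algebra_simps)

text \<open>The negative term is \<open>x \<bullet> D x y\<close> squared over
  \<open>x \<bullet> x\<close>, by \<open>D_inner_point\<close>; Cauchy-Schwarz absorbs it into
  \<open>D x y \<bullet> D x y\<close>.\<close>

lemma sasaki_pullback_ge:
  assumes "x \<noteq> 0"
  shows "sasaki_pullback x y y \<ge> y \<bullet> y"
proof -
  have "(F x \<bullet> y)\<^sup>2 = (x \<bullet> D x y)\<^sup>2"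
    using D_inner_point[OF assms, of y] by (simp add: inner_commute)
  also have "\<dots> \<le> (x \<bullet> x) * (D x y \<bullet> D x y)" by (rule Cauchy_Schwarz_ineq)
  finally have "(F x \<bullet> y)\<^sup>2 / (x \<bullet> x) \<le> D x y \<bullet> D x y"
    using assms by (simp add: pos_divide_le_eq mult.commute)
  then show ?thesis by (simp add: sasaki_pullback_def power2_eq_square)
qed

lemma smooth_D2_diag:
  assumes "smooth_map_on V x" "smooth_map_on V y" "\<And>z. z \<in> V \<Longrightarrow> x z \<noteq> 0"
  shows "smooth_map_on V (\<lambda>z. D2 (x z) (y z) (y z))"
proof (rule smooth_map_on_cong)
  show "smooth_map_on V (\<lambda>z. \<Sum>i\<in>Basis. (y z \<bullet> i) *\<^sub>R D2 (x z) i (y z))"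
    by (intro smooth_map_on_sum smooth_map_on_scaleR smooth_map_on_inner smooth_map_on_const assms
        smooth_map_on_frechet_comp[OF smooth_map_on_frechet[OF smooth_F]] smooth_map_on_open[OF assms(1)])
      (use assms(3) in simp)
  show "(\<Sum>i\<in>Basis. (y z \<bullet> i) *\<^sub>R D2 (x z) i (y z)) = D2 (x z) (y z) (y z)" if "z \<in> V" for z
  proof -
    \<comment> \<open>Smoothness is known for fixed inner directions i, the basis expansion for the
      outer slot; symmetry joins the two.\<close>
    have "D2 (x z) i (y z) = D2 (x z) (y z) i" for i by (rule D2_sym[OF assms(3)[OF that]])
    then have "(\<Sum>i\<in>Basis. (y z \<bullet> i) *\<^sub>R D2 (x z) i (y z)) = (\<Sum>i\<in>Basis. (y z \<bullet> i) *\<^sub>R D2 (x z) (y z) i)"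
      by (intro sum.cong refl arg_cong[where f = "scaleR _"])
    also have "\<dots> = D2 (x z) (y z) (y z)"
      by (rule linear_Basis_expansion[OF linear_D2[OF assms(3)[OF that]], symmetric])
    finally show ?thesis .
  qed
qed

end

section \<open>The geodesic equation of the image as a smooth first-order system\<close>

locale unit_field_vec = unit_field \<xi> for \<xi> :: "real^'d \<Rightarrow> real^'d"
begin

definition pullback_matrix :: "real^'d \<Rightarrow> real^'d^'d" where
  "pullback_matrix x = matrix (\<lambda>y. y - ((F x \<bullet> y) / (x \<bullet> x)) *\<^sub>R F x + (\<Sum>i\<in>Basis. (D x y \<bullet> D x i) *\<^sub>R i))"

lemma pullback_matrix_inner:
  assumes "x \<noteq> 0"
  shows "(pullback_matrix x *v y) \<bullet> w = sasaki_pullback x y w"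
proof -
  note l = linear_add[OF linear_D[OF assms]] linear_scale[OF linear_D[OF assms]]
  have "linear (\<lambda>y. y - ((F x \<bullet> y) / (x \<bullet> x)) *\<^sub>R F x + (\<Sum>i\<in>Basis. (D x y \<bullet> D x i) *\<^sub>R i))"
    by (rule linearI)
      (simp_all add: l inner_add_left inner_add_right scaleR_add_left sum.distrib add_divide_distrib
        scaleR_diff_right scaleR_add_right scaleR_sum_right algebra_simps)
  then show ?thesis
    by (simp add: pullback_matrix_def matrix_works inner_add_left inner_diff_left
        adjoint_sum_inner[OF linear_D[OF assms]] sasaki_pullback_def)
qed

lemma det_pullback_matrix:
  assumes "x \<noteq> 0"
  shows "det (pullback_matrix x) \<noteq> 0"
proof -
  have "y = 0" if "pullback_matrix x *v y = 0" for y
  proof -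
    have "sasaki_pullback x y y = 0" using pullback_matrix_inner[OF assms, of y y] that by simp
    then have "y \<bullet> y \<le> 0" using sasaki_pullback_ge[OF assms, of y] by linarith
    then show ?thesis using inner_gt_zero_iff[of y] by linarith
  qed
  then show ?thesis
    unfolding invertible_det_nz[symmetric] invertible_left_inverse matrix_left_invertible_ker by blast
qed

text \<open>The variational equation determines the acceleration against vectors orthogonal to x
  only. The missing component comes from differentiating |c|^2 = 1 twice, and is imposed through a
  Lagrange multiplier in the direction x.\<close>

lemma acceleration_exists:
  obtains \<Gamma> where "smooth_map_on ((- {0}) \<times> UNIV) \<Gamma>"
    "\<And>x y w. x \<noteq> 0 \<Longrightarrow> w \<bullet> x = 0 \<Longrightarrow> sasaki_pullback x (\<Gamma> (x, y)) w = lift_force x y w"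
    "\<And>x y. x \<noteq> 0 \<Longrightarrow> x \<bullet> \<Gamma> (x, y) = - (y \<bullet> y)"
proof -
  let ?V = "(- {0 :: real^'d}) \<times> (UNIV :: (real^'d) set)"
  have V: "open ?V" by (intro open_Times) auto
  have x0: "fst z \<noteq> 0" if "z \<in> ?V" for z using that by auto
  have sx: "smooth_map_on ?V fst" and sy: "smooth_map_on ?V snd"
    by (intro smooth_map_on_fst smooth_map_on_snd smooth_map_on_ident V)+
  have sF: "smooth_map_on ?V (\<lambda>z. F (fst z))"
    by (rule smooth_map_on_compose[OF smooth_F sx]) (use x0 in simp)
  have sD: "smooth_map_on ?V (\<lambda>z. D (fst z) (w z))" if "smooth_map_on ?V w" for w
    by (rule smooth_map_on_frechet_comp[OF smooth_F sx that]) (use x0 in simp)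
  have A: "smooth_map_on ?V (\<lambda>z. pullback_matrix (fst z) $ i $ j)" for i j
    unfolding pullback_matrix_def matrix_def vec_lambda_beta
    by (intro smooth_map_on_vec_nth smooth_map_on_add smooth_map_on_diff smooth_map_on_sum smooth_map_on_scaleR
        smooth_map_on_divide smooth_map_on_inner smooth_map_on_const sF sD sx V) (use x0 in simp)
  define R where "R z = (D (fst z) (snd z) \<bullet> snd z) *\<^sub>R F (fst z) + (F (fst z) \<bullet> snd z) *\<^sub>R D (fst z) (snd z)
     - (\<Sum>i\<in>Basis. ((D2 (fst z) (snd z) (snd z) + (F (fst z) \<bullet> snd z) *\<^sub>R snd z) \<bullet> D (fst z) i) *\<^sub>R i)"
    for z :: "(real^'d) \<times> (real^'d)"
  have R: "smooth_map_on ?V R" unfolding R_def[abs_def]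
    by (intro smooth_map_on_add smooth_map_on_diff smooth_map_on_sum smooth_map_on_scaleR
        smooth_map_on_inner smooth_map_on_const sF sD sx sy V smooth_D2_diag) (use x0 in simp)
  have R_inner: "R (x, y) \<bullet> w = lift_force x y w" if "x \<noteq> 0" for x y w
    unfolding R_def lift_force_def inner_add_left[of "_ *\<^sub>R _"] inner_diff_left fst_conv snd_conv
      adjoint_sum_inner[OF linear_D[OF that]] inner_scaleR_left ..
  obtain s1 where s1: "smooth_map_on ?V s1" "\<And>z. z \<in> ?V \<Longrightarrow> pullback_matrix (fst z) *v s1 z = R z"
    using smooth_linear_solve[OF V A R det_pullback_matrix[OF x0]] by metis
  obtain s2 where s2: "smooth_map_on ?V s2" "\<And>z. z \<in> ?V \<Longrightarrow> pullback_matrix (fst z) *v s2 z = fst z"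
    using smooth_linear_solve[OF V A sx det_pullback_matrix[OF x0]] by metis
  have pos: "fst z \<bullet> s2 z > 0" if "z \<in> ?V" for z
  proof -
    have "s2 z \<noteq> 0"
    proof
      assume "s2 z = 0"
      then show False using s2(2)[OF that] x0[OF that] by simp
    qed
    then have "s2 z \<bullet> s2 z > 0" by simp
    also have "s2 z \<bullet> s2 z \<le> sasaki_pullback (fst z) (s2 z) (s2 z)"
      by (rule sasaki_pullback_ge[OF x0[OF that]])
    also have "\<dots> = fst z \<bullet> s2 z"
      using pullback_matrix_inner[OF x0[OF that], of "s2 z" "s2 z"] s2(2)[OF that] by simp
    finally show ?thesis .
  qed
  \<comment> \<open>Adding a multiple of s2 changes the right-hand side by a multiple of x,
    invisible to tangent test vectors. This multiple enforces the constraint; its denominator is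
    positive because the pullback metric is definite.\<close>
  define m where "m z = - (snd z \<bullet> snd z + fst z \<bullet> s1 z) / (fst z \<bullet> s2 z)" for z
  define \<Gamma> where "\<Gamma> z = s1 z + m z *\<^sub>R s2 z" for z
  show ?thesis
  proof
    show "smooth_map_on ?V \<Gamma>" unfolding \<Gamma>_def[abs_def] m_def[abs_def]
      by (intro smooth_map_on_add smooth_map_on_scaleR smooth_map_on_divide smooth_map_on_minus
          smooth_map_on_inner s1 s2 sx sy) (use pos in \<open>auto simp: less_le\<close>)
    fix x y w :: "real^'d" assume x: "x \<noteq> 0"
    then have z: "(x, y) \<in> ?V" by simp
    show "x \<bullet> \<Gamma> (x, y) = - (y \<bullet> y)"
      using pos[OF z] by (simp add: \<Gamma>_def m_def inner_add_right)
    assume w: "w \<bullet> x = 0"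
    have "sasaki_pullback x (\<Gamma> (x, y)) w = (pullback_matrix x *v \<Gamma> (x, y)) \<bullet> w"
      by (rule pullback_matrix_inner[OF x, symmetric])
    also have "pullback_matrix x *v \<Gamma> (x, y) = R (x, y) + m (x, y) *\<^sub>R x"
      using s1(2)[OF z] s2(2)[OF z] by (simp add: \<Gamma>_def matrix_vector_right_distrib matrix_vector_mult_scaleR)
    also have "\<dots> \<bullet> w = lift_force x y w"
      using w by (simp add: inner_add_left R_inner[OF x] inner_commute[of x])
    finally show "sasaki_pullback x (\<Gamma> (x, y)) w = lift_force x y w" .
  qed
qed

lemma field_image_geodesic_exists:
  assumes x: "norm x = 1" and X: "x \<bullet> X = 0"
  obtains d c y b where "d > 0" "c 0 = x" "y 0 = X" "smooth_map_on {-d<..<d} c"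
    "\<And>t. t \<in> {-d<..<d} \<Longrightarrow> norm (c t) = 1"
    "\<And>t. t \<in> {-d<..<d} \<Longrightarrow> (c has_vector_derivative y t) (at t)"
    "\<And>t. t \<in> {-d<..<d} \<Longrightarrow> (y has_vector_derivative b t) (at t)"
    "\<And>t w. t \<in> {-d<..<d} \<Longrightarrow> w \<bullet> c t = 0 \<Longrightarrow> lift_equation (c t) (y t) (b t) w = 0"
    "b 0 \<bullet> x = - (X \<bullet> X)"
proof -
  obtain \<Gamma> where \<Gamma>: "smooth_map_on ((- {0}) \<times> UNIV) \<Gamma>"
    "\<And>x y w. x \<noteq> 0 \<Longrightarrow> w \<bullet> x = 0 \<Longrightarrow> sasaki_pullback x (\<Gamma> (x, y)) w = lift_force x y w"
    "\<And>x y. x \<noteq> 0 \<Longrightarrow> x \<bullet> \<Gamma> (x, y) = - (y \<bullet> y)"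
    using acceleration_exists by metis
  let ?V = "(- {0 :: real^'d}) \<times> (UNIV :: (real^'d) set)"
  have V: "open ?V" by (intro open_Times) auto
  have f: "smooth_map_on ?V (\<lambda>z. (snd z, \<Gamma> z))"
    by (intro smooth_map_on_Pair smooth_map_on_snd smooth_map_on_ident V \<Gamma>(1))
  have "(x, X) \<in> ?V" using x by auto
  from ode_local_existence[OF f this] obtain d z where d: "d > 0" and z: "z 0 = (x, X)"
    "smooth_map_on {-d<..<d} z" "\<And>t. t \<in> {-d<..<d} \<Longrightarrow> z t \<in> ?V"
    "\<And>t. t \<in> {-d<..<d} \<Longrightarrow> (z has_vector_derivative (snd (z t), \<Gamma> (z t))) (at t)"
    by metis
  let ?I = "{-d<..<d}"
  have 0: "0 \<in> ?I" using d by simp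
  define c y where "c t = fst (z t)" and "y t = snd (z t)" for t
  have zc: "z t = (c t, y t)" for t by (simp add: c_def y_def)
  have c0: "c t \<noteq> 0" if "t \<in> ?I" for t using z(3)[OF that] by (auto simp: c_def)
  have dc: "(c has_vector_derivative y t) (at t)" if "t \<in> ?I" for t
    using bounded_linear.has_vector_derivative[OF bounded_linear_fst z(4)[OF that]]
    by (simp add: c_def[abs_def] y_def)
  have dy: "(y has_vector_derivative \<Gamma> (z t)) (at t)" if "t \<in> ?I" for t
    using bounded_linear.has_vector_derivative[OF bounded_linear_snd z(4)[OF that]]
    by (simp add: y_def[abs_def])
  \<comment> \<open>The constraint on \<Gamma> makes this product constant; it starts at 0, and then
    the length of c is constant too.\<close>
  have cy: "c t \<bullet> y t = 0" if "t \<in> ?I" for t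
  proof -
    have "((\<lambda>t. c t \<bullet> y t) has_vector_derivative 0) (at t)" if "t \<in> ?I" for t
      using bounded_bilinear.has_vector_derivative[OF bounded_bilinear_inner dc[OF that] dy[OF that]]
        \<Gamma>(3)[OF c0[OF that], of "y t"] by (simp add: zc)
    from vector_derivative_zero_interval_constant[OF this that 0]
    show ?thesis using X z(1) by (simp add: c_def y_def)
  qed
  have cn: "norm (c t) = 1" if "t \<in> ?I" for t
  proof -
    have "((\<lambda>t. c t \<bullet> c t) has_vector_derivative 0) (at t)" if "t \<in> ?I" for t
      using bounded_bilinear.has_vector_derivative[OF bounded_bilinear_inner dc[OF that] dc[OF that]] cy[OF that]
      by (simp add: inner_commute)
    from vector_derivative_zero_interval_constant[OF this that 0]
    show ?thesis using x z(1) by (simp add: c_def norm_eq_1)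
  qed
  show ?thesis
  proof (rule that[OF d _ _ _ cn dc dy])
    show "c 0 = x" "y 0 = X" using z(1) by (simp_all add: c_def y_def)
    show "smooth_map_on ?I c" unfolding c_def[abs_def] by (rule smooth_map_on_fst[OF z(2)])
    show "lift_equation (c t) (y t) (\<Gamma> (z t)) w = 0" if "t \<in> ?I" "w \<bullet> c t = 0" for t w
      using \<Gamma>(2)[OF c0[OF that(1)] that(2), of "y t"] lift_equation_sasaki_pullback[OF cn[OF that(1)]]
      by (simp add: zc)
    show "\<Gamma> (z 0) \<bullet> x = - (X \<bullet> X)" using \<Gamma>(3)[of x X] c0[OF 0] z(1) by (simp add: c_def inner_commute[of _ x])
  qed
qed

text \<open>At time 0 of the geodesic with velocity X, the vertical equations confine Q to the span
  of x and \<open>F x\<close>; the equations of the image then express the acceleration B through X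
  and \<open>D x X\<close>. Substituting B into Q isolates the second derivative.\<close>

lemma totally_geodesic_second_derivative:
  assumes tg: "totally_geodesic_field \<xi>" and DF: "\<And>x. x \<noteq> 0 \<Longrightarrow> D x (F x) = - x"
    and x: "norm x = 1" and X: "x \<bullet> X = 0"
  shows "D2 x X X = - (F x \<bullet> X) *\<^sub>R (X + D x (D x X)) - (2 * (D x X \<bullet> X)) *\<^sub>R x
    + (X \<bullet> X - D x X \<bullet> D x X) *\<^sub>R F x"
proof -
  have x0: "x \<noteq> 0" using x by auto
  obtain d c y b where d: "d > 0" and c: "c 0 = x" "y 0 = X" "smooth_map_on {-d<..<d} c"
    "\<And>t. t \<in> {-d<..<d} \<Longrightarrow> norm (c t) = 1"
    and dc: "\<And>t. t \<in> {-d<..<d} \<Longrightarrow> (c has_vector_derivative y t) (at t)"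
    "\<And>t. t \<in> {-d<..<d} \<Longrightarrow> (y has_vector_derivative b t) (at t)"
    and eq: "\<And>t w. t \<in> {-d<..<d} \<Longrightarrow> w \<bullet> c t = 0 \<Longrightarrow> lift_equation (c t) (y t) (b t) w = 0"
    and bx: "b 0 \<bullet> x = - (X \<bullet> X)"
    using field_image_geodesic_exists[OF x X] by metis
  have 0: "0 \<in> {-d<..<d}" using d by simp
  have "geodesic_in sasaki_metric field_image {-d<..<d} (\<lambda>t. (c t, F (c t)))"
    by (rule geodesic_in_field_imageI[OF open_greaterThanLessThan c(3,4) dc eq])
  then have geo: "geodesic_in sasaki_metric unit_tangent_sphere {-d<..<d} (\<lambda>t. (c t, F (c t)))"
    using tg by (simp add: totally_geodesic_field_def)
  define v N B l Q where "v = F x" and "N = D x X" and "B = b 0" and "l = v \<bullet> X"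
    and "Q = D2 x X X + D x B + l *\<^sub>R X"
  have vn: "norm v = 1" "x \<bullet> v = 0" "v \<bullet> x = 0" using F_norm[of x] F_orth[of x] x by (simp_all add: v_def inner_commute)
  have xx: "x \<bullet> x = 1" "v \<bullet> v = 1" using x vn(1) by (simp_all add: norm_eq_1)
  have vertical: "Q \<bullet> u = 0" if "u \<bullet> x = 0" "u \<bullet> v = 0" for u
    using vertical_variation[OF open_greaterThanLessThan c(3,4) dc(1) dc(2)[OF 0] geo 0, of u] that c(1,2)
    by (simp add: Q_def v_def B_def l_def)
  have Nx: "N \<bullet> x = - l" and Nv: "N \<bullet> v = 0"
    using D_inner_point[OF x0, of X] D_inner_F[OF x0, of X] X by (simp_all add: N_def l_def v_def inner_commute)
  have Xx: "X \<bullet> x = 0" and Xv: "X \<bullet> v = l" using X by (simp_all add: l_def inner_commute)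
  have Bx: "B \<bullet> x = - (X \<bullet> X)" using bx by (simp add: B_def)
  have DBx: "D x B \<bullet> x = - (B \<bullet> v)" and DBv: "D x B \<bullet> v = - (X \<bullet> X)"
    using D_inner_point[OF x0, of B] D_inner_F[OF x0, of B] Bx by (simp_all add: v_def)
  have D2x: "D2 x X X \<bullet> x = - 2 * (N \<bullet> X)" and D2v: "D2 x X X \<bullet> v = X \<bullet> X - N \<bullet> N"
    using D2_inner_point[OF x0, of X X] D2_inner_F[OF x0, of X X] by (simp_all add: N_def v_def inner_commute)
  have Qx: "Q \<bullet> x = - 2 * (N \<bullet> X) - B \<bullet> v" and Qv: "Q \<bullet> v = l * l - N \<bullet> N"
    by (simp_all add: Q_def inner_add_left D2x DBx D2v DBv Xx Xv)
  have Q: "Q = (Q \<bullet> x) *\<^sub>R x + (Q \<bullet> v) *\<^sub>R v"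
    by (rule orthogonal_complement_plane[OF x vn(1,2) vertical])
  \<comment> \<open>For tangent w the vector \<open>D x w\<close> is orthogonal to v and has product
    \<open>- (v \<bullet> w)\<close> with x. As Q lies in the span of x and v, the lift equation
    becomes \<open>E \<bullet> w = 0\<close>.\<close>
  define E where "E = B - (v \<bullet> B + N \<bullet> X + Q \<bullet> x) *\<^sub>R v - l *\<^sub>R N"
  have "E \<bullet> w = 0" if w: "w \<bullet> x = 0" for w
  proof -
    have "x \<bullet> D x w = - (v \<bullet> w)" "v \<bullet> D x w = 0"
      using D_inner_point[OF x0, of w] D_inner_F[OF x0, of w] w by (simp_all add: v_def inner_commute)
    then have "Q \<bullet> D x w = - (Q \<bullet> x) * (v \<bullet> w)"
      by (subst Q) (simp add: inner_add_left)
    moreover have "lift_equation x X B w = 0" using eq[OF 0, of w] w c(1,2) by (simp add: B_def)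
    ultimately show ?thesis
      unfolding lift_equation_def v_def[symmetric] N_def[symmetric] l_def[symmetric] Q_def[symmetric]
      by (simp add: E_def inner_diff_left algebra_simps)
  qed
  from orthogonal_complement_line[OF x this] have E: "E = (E \<bullet> x) *\<^sub>R x" .
  have Ex: "E \<bullet> x = l * l - X \<bullet> X" by (simp add: E_def inner_diff_left Bx vn Nx)
  \<comment> \<open>In this component \<open>v \<bullet> B\<close> cancels and
    \<open>Q \<bullet> x\<close> is determined; comparison with \<open>Qx\<close> then yields
    \<open>v \<bullet> B\<close>.\<close>
  have "E \<bullet> v = 0" by (subst E) (simp add: vn)
  then have "Q \<bullet> x = - (N \<bullet> X)" by (simp add: E_def inner_diff_left xx Nv inner_commute[of B])
  define a where "a = - (N \<bullet> X)"
  have Qa: "Q \<bullet> x = a" and Bv: "v \<bullet> B = a"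
    using \<open>Q \<bullet> x = - (N \<bullet> X)\<close> Qx by (simp_all add: a_def inner_commute[of v])
  have "B = a *\<^sub>R v + l *\<^sub>R N + (l * l - X \<bullet> X) *\<^sub>R x"
    using E unfolding Ex by (simp add: E_def Qa Bv a_def algebra_simps)
  then have "D x B = D x (a *\<^sub>R v + l *\<^sub>R N + (l * l - X \<bullet> X) *\<^sub>R x)" by simp
  also have "\<dots> = - a *\<^sub>R x + l *\<^sub>R D x N + (l * l - X \<bullet> X) *\<^sub>R v"
    using DF[OF x0] D_radial[OF x0]
    by (simp add: linear_add[OF linear_D[OF x0]] linear_scale[OF linear_D[OF x0]] v_def)
  finally have DB: "D x B = - a *\<^sub>R x + l *\<^sub>R D x N + (l * l - X \<bullet> X) *\<^sub>R v" .
  have "D2 x X X = Q - D x B - l *\<^sub>R X" by (simp add: Q_def)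
  also have "\<dots> = a *\<^sub>R x + (l * l - N \<bullet> N) *\<^sub>R v - D x B - l *\<^sub>R X"
    by (subst Q) (simp only: Qa Qv)
  also have "\<dots> = - l *\<^sub>R (X + D x N) + (2 * a) *\<^sub>R x + (X \<bullet> X - N \<bullet> N) *\<^sub>R v"
    unfolding DB collect_scaleR by simp
  finally show ?thesis by (simp add: a_def l_def v_def N_def)
qed

end

section \<open>Totally geodesic covariantly normal fields are Hopf\<close>

context unit_field
begin

text \<open>The product rule applied to the identity \<open>D x (F x) = - x\<close> along a line in
  direction Y.\<close>

lemma D2_F:
  assumes DF: "\<And>x. x \<noteq> 0 \<Longrightarrow> D x (F x) = - x" and x: "x \<noteq> 0"
  shows "D2 x (F x) Y = - Y - D x (D x Y)"
proof -
  obtain I where I: "open I" "0 \<in> I" "\<And>s. s \<in> I \<Longrightarrow> x + s *\<^sub>R Y \<noteq> 0"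
    using punctured_line[OF x, where z = Y] by metis
  have "((\<lambda>s. F (x + s *\<^sub>R Y)) has_vector_derivative D x Y) (at 0)"
    using F_curve[OF _ line_derivative, of x 0 Y] x by simp
  from D_curve[OF I(1,3,2) line_derivative this]
  have "((\<lambda>s. D (x + s *\<^sub>R Y) (F (x + s *\<^sub>R Y))) has_vector_derivative D2 x (F x) Y + D x (D x Y)) (at 0)"
    by simp
  moreover have "((\<lambda>s. D (x + s *\<^sub>R Y) (F (x + s *\<^sub>R Y))) has_vector_derivative - Y) (at 0)"
    by (rule has_vector_derivative_transform_within_open[OF has_vector_derivative_minus[OF line_derivative[of x Y]] I(1,2)])
      (use I(3) DF in simp)
  ultimately have "D2 x (F x) Y + D x (D x Y) = - Y" by (rule vector_derivative_unique_at)
  then show ?thesis by (simp add: eq_diff_eq)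
qed

lemma unit_frame:
  assumes "norm x = 1"
  shows "x \<bullet> x = 1" "F x \<bullet> F x = 1" "x \<bullet> F x = 0" "F x \<bullet> x = 0"
  using assms F_orth[of x] by (simp_all add: dot_square_norm F_norm inner_commute)

lemma tangent_decomposition:
  assumes x: "norm x = 1"
  obtains Y where "X = Y + (X \<bullet> x) *\<^sub>R x + (X \<bullet> F x) *\<^sub>R F x" "Y \<bullet> x = 0" "Y \<bullet> F x = 0"
proof
  let ?Y = "X - (X \<bullet> x) *\<^sub>R x - (X \<bullet> F x) *\<^sub>R F x"
  show "?Y \<bullet> x = 0" "?Y \<bullet> F x = 0" by (simp_all add: inner_diff_left unit_frame[OF x])
qed simp

text \<open>Polarising the quadratic identity in the direction of the field and comparing with the
  derivative of the geodesic equation leaves twice a vector equal to itself.\<close>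

lemma D_D:
  assumes DF: "\<And>x. x \<noteq> 0 \<Longrightarrow> D x (F x) = - x"
    and tg: "\<And>X. x \<bullet> X = 0 \<Longrightarrow> D2 x X X = - (F x \<bullet> X) *\<^sub>R (X + D x (D x X)) - (2 * (D x X \<bullet> X)) *\<^sub>R x
      + (X \<bullet> X - D x X \<bullet> D x X) *\<^sub>R F x"
    and x: "norm x = 1"
  shows "D x (D x X) = - X"
proof -
  have x0: "x \<noteq> 0" using x by auto
  define v where "v = F x"
  note add = linear_add[OF linear_D[OF x0]] and scale = linear_scale[OF linear_D[OF x0]]
  have vx: "v \<bullet> x = 0" "x \<bullet> v = 0" "v \<bullet> v = 1" "x \<bullet> x = 1"
    using unit_frame[OF x] by (simp_all add: v_def)
  have Dv: "D x v = - x" and Dx: "D x x = v" using DF[OF x0] D_radial[OF x0] by (simp_all add: v_def)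
  have Dmx: "D x (- x) = - v" using scale[of "-1" x] Dx by simp
  have main: "D x (D x Y) = - Y" if Yx: "Y \<bullet> x = 0" and Yv: "Y \<bullet> v = 0" for Y
  proof -
    define N where "N = D x Y"
    have xY: "x \<bullet> Y = 0" "v \<bullet> Y = 0" using that by (simp_all add: inner_commute)
    have Nx: "N \<bullet> x = 0" "x \<bullet> N = 0" and Nv: "N \<bullet> v = 0"
      using D_inner_point[OF x0, of Y] D_inner_F[OF x0, of Y] that
      by (simp_all add: N_def v_def inner_commute)
    have DY: "D x (Y + v) = N - x" and DDY: "D x (N - x) = D x N - v"
      using add[of Y v] add[of N "- x"] by (simp_all add: N_def Dv Dmx)
    have vv: "D2 x v v = 0"
      using tg[of v] vx by (simp add: Dv Dmx v_def[symmetric])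
    have YY: "D2 x Y Y = - (2 * (N \<bullet> Y)) *\<^sub>R x + (Y \<bullet> Y - N \<bullet> N) *\<^sub>R v"
      using tg[of Y] xY by (simp add: N_def[symmetric] v_def[symmetric])
    \<comment> \<open>Adding v switches on the first term of the quadratic formula, which is absent
      for Y alone; v contributes nothing to it because \<open>v + D x (D x v) = 0\<close>.\<close>
    have "D2 x (Y + v) (Y + v) = - (Y + D x N) + (- (2 * (N \<bullet> Y)) *\<^sub>R x + (Y \<bullet> Y - N \<bullet> N) *\<^sub>R v)"
    proof -
      have "x \<bullet> (Y + v) = 0" "v \<bullet> (Y + v) = 1" "(N - x) \<bullet> (Y + v) = N \<bullet> Y"
        "(Y + v) \<bullet> (Y + v) - (N - x) \<bullet> (N - x) = Y \<bullet> Y - N \<bullet> N"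
        using vx xY Nx Nv Yx Yv by (simp_all add: inner_add_left inner_add_right inner_diff_left inner_diff_right)
      with tg[of "Y + v"] show ?thesis by (simp add: DY DDY v_def[symmetric])
    qed
    moreover have "D2 x (Y + v) (Y + v) = D2 x Y Y + D2 x v Y + D2 x v Y + D2 x v v"
    proof -
      have "D2 x (Y + v) (Y + v) = (D2 x Y Y + D2 x Y v) + (D2 x v Y + D2 x v v)"
        by (simp only: D2_add_left[OF x0] linear_add[OF linear_D2[OF x0]])
      also have "D2 x Y v = D2 x v Y" by (rule D2_sym[OF x0])
      finally show ?thesis by simp
    qed
    moreover have "D2 x v Y = - Y - D x N" using D2_F[OF DF x0, of Y] by (simp add: v_def N_def)
    ultimately have "(- Y - D x N) + (- Y - D x N) = - (Y + D x N)" using YY vv by simp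
    then show ?thesis by (simp add: N_def algebra_simps eq_neg_iff_add_eq_0)
  qed
  \<comment> \<open>On the plane of x and \<open>F x\<close> the claim is direct: D sends x to
    \<open>F x\<close> and \<open>F x\<close> to -x.\<close>
  obtain Y where Y: "X = Y + (X \<bullet> x) *\<^sub>R x + (X \<bullet> F x) *\<^sub>R F x" "Y \<bullet> x = 0" "Y \<bullet> F x = 0"
    by (rule tangent_decomposition[OF x])
  define p q where "p = X \<bullet> x" and "q = X \<bullet> F x"
  have X: "X = Y + p *\<^sub>R x + q *\<^sub>R v" using Y(1) by (simp add: p_def q_def v_def)
  have "D x (D x X) = D x (D x Y) + p *\<^sub>R D x v + q *\<^sub>R D x (- x)"
    unfolding X by (simp only: add scale Dx Dv)
  also have "\<dots> = - X"
    using main[OF Y(2)] Y(3) by (simp add: v_def Dv[unfolded v_def] Dmx[unfolded v_def] X)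
  finally show ?thesis .
qed

text \<open>The description under THE has a unique solution: L continues the shape operator linearly
  to the whole space, its adjoint is projected off x, and a vector orthogonal to all tangent vectors
  is a multiple of x.\<close>

lemma shape_op_adj_inner:
  assumes x: "norm x = 1"
  shows "x \<bullet> shape_op_adj \<xi> x X = 0"
    and "x \<bullet> Y = 0 \<Longrightarrow> shape_op_adj \<xi> x X \<bullet> Y = X \<bullet> shape_op \<xi> x Y"
proof -
  have x0: "x \<noteq> 0" and xx: "x \<bullet> x = 1" using x by (auto simp: norm_eq_1)
  let ?P = "\<lambda>Z. x \<bullet> Z = 0 \<and> (\<forall>Y. x \<bullet> Y = 0 \<longrightarrow> Z \<bullet> Y = X \<bullet> shape_op \<xi> x Y)"
  define L where "L Y = - (D x Y + (F x \<bullet> Y) *\<^sub>R x)" for Y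
  have L: "linear L" unfolding L_def
    by (rule linearI)
      (simp_all add: linear_add[OF linear_D[OF x0]] linear_scale[OF linear_D[OF x0]] inner_add_right algebra_simps)
  define Z0 where "Z0 = adjoint L X"
  have Z0: "Z0 \<bullet> Y = X \<bullet> L Y" for Y
    using adjoint_works[OF L, of Y X] by (simp add: Z0_def inner_commute)
  have "\<exists>!Z. ?P Z"
  proof (rule ex1I)
    show "?P (Z0 - (x \<bullet> Z0) *\<^sub>R x)"
      using Z0 shape_op_eq[OF x] xx by (simp add: inner_diff_left inner_diff_right L_def)
    fix Z assume Z: "?P Z"
    have "\<And>w. w \<bullet> x = 0 \<Longrightarrow> (Z - Z0) \<bullet> w = 0"
      using Z Z0 shape_op_eq[OF x] by (simp add: inner_diff_left L_def inner_commute[of _ x])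
    from orthogonal_complement_line[OF x this]
    have "Z - Z0 = ((Z - Z0) \<bullet> x) *\<^sub>R x" .
    also have "(Z - Z0) \<bullet> x = - (x \<bullet> Z0)" using Z by (simp add: inner_diff_right inner_commute[of _ x])
    finally show "Z = Z0 - (x \<bullet> Z0) *\<^sub>R x" by (simp add: algebra_simps)
  qed
  from theI'[OF this] have "?P (shape_op_adj \<xi> x X)" unfolding shape_op_adj_def .
  then show "x \<bullet> shape_op_adj \<xi> x X = 0"
    and "x \<bullet> Y = 0 \<Longrightarrow> shape_op_adj \<xi> x X \<bullet> Y = X \<bullet> shape_op \<xi> x Y" by simp_all
qed

text \<open>Orthogonally to x and \<open>F x\<close>, D is minus the shape operator A, so A A = -1
  there. With P = A Y and T the adjoint, normality gives |T P| = |A P| = |Y|, while T P has inner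
  product |P|^2 with Y; Cauchy-Schwarz bounds |P| by |Y|.\<close>

lemma D_isometry:
  assumes nrm: "covariantly_normal \<xi>" and x: "norm x = 1" and DD: "\<And>X. D x (D x X) = - X"
  shows "D x X \<bullet> D x X = X \<bullet> X"
proof -
  have x0: "x \<noteq> 0" using x by auto
  define v where "v = F x"
  have vx: "v \<bullet> x = 0" "x \<bullet> v = 0" "v \<bullet> v = 1" "x \<bullet> x = 1"
    using unit_frame[OF x] by (simp_all add: v_def)
  let ?A = "shape_op \<xi> x" and ?T = "shape_op_adj \<xi> x"
  have W: "D x Y \<bullet> x = 0" "D x Y \<bullet> v = 0" if "Y \<bullet> x = 0" "Y \<bullet> v = 0" for Y
    using D_inner_point[OF x0, of Y] D_inner_F[OF x0, of Y] that by (simp_all add: v_def)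
  have A: "?A Y = - D x Y" if "Y \<bullet> x = 0" "Y \<bullet> v = 0" for Y
    using shape_op_eq[OF x, of Y] that by (simp add: v_def inner_commute)
  have le: "D x Y \<bullet> D x Y \<le> Y \<bullet> Y" if Y: "Y \<bullet> x = 0" "Y \<bullet> v = 0" for Y
  proof -
    define P where "P = ?A Y"
    have P: "P = - D x Y" "P \<bullet> x = 0" "P \<bullet> v = 0" using A[OF Y] W[OF Y] by (simp_all add: P_def)
    have xP: "x \<bullet> P = 0" "x \<bullet> Y = 0" using P(2) Y(1) by (simp_all add: inner_commute)
    have AP: "?A P = - Y"
      using A[OF P(2,3)] linear_neg[OF linear_D[OF x0]] DD[of Y] by (simp add: P(1))
    have "?T P \<bullet> ?T P = P \<bullet> ?A (?T P)"
      by (rule shape_op_adj_inner(2)[OF x shape_op_adj_inner(1)[OF x]])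
    also have "?A (?T P) = ?T (?A P)" using nrm x xP(1) by (simp add: covariantly_normal_def)
    also have "P \<bullet> ?T (?A P) = ?A P \<bullet> ?A P"
      using shape_op_adj_inner(2)[OF x xP(1), of "?A P"] by (simp only: inner_commute)
    also have "\<dots> = Y \<bullet> Y" by (simp add: AP)
    finally have "norm (?T P) = norm Y" by (simp add: norm_eq_sqrt_inner)
    moreover have "?T P \<bullet> Y = P \<bullet> P"
      using shape_op_adj_inner(2)[OF x xP(2), of P] by (simp add: P_def)
    ultimately have "P \<bullet> P \<le> norm Y * norm Y"
      using norm_cauchy_schwarz[of "?T P" Y] by simp
    then show ?thesis by (simp add: P(1) dot_square_norm power2_eq_square)
  qed
  \<comment> \<open>The reverse inequality is the same bound applied to \<open>D x Y\<close>, whose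
    image is -Y.\<close>
  have eq: "D x Y \<bullet> D x Y = Y \<bullet> Y" if Y: "Y \<bullet> x = 0" "Y \<bullet> v = 0" for Y
    using le[OF Y] le[OF W[OF Y]] by (simp add: DD)
  obtain Y where Y: "X = Y + (X \<bullet> x) *\<^sub>R x + (X \<bullet> F x) *\<^sub>R F x" "Y \<bullet> x = 0" "Y \<bullet> F x = 0"
    by (rule tangent_decomposition[OF x])
  define p q where "p = X \<bullet> x" and "q = X \<bullet> F x"
  have X: "X = Y + p *\<^sub>R x + q *\<^sub>R v" using Y(1) by (simp add: p_def q_def v_def)
  have Dx: "D x x = v" using D_radial[OF x0] by (simp add: v_def)
  have Dv: "D x v = - x" using DD[of x] by (simp add: Dx)
  have DX: "D x X = D x Y + p *\<^sub>R v - q *\<^sub>R x"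
    unfolding X by (simp add: linear_add[OF linear_D[OF x0]] linear_scale[OF linear_D[OF x0]] Dx Dv)
  have Yv: "Y \<bullet> v = 0" using Y(3) by (simp add: v_def)
  have "D x X \<bullet> D x X = D x Y \<bullet> D x Y + p * p + q * q"
    unfolding DX using W[OF Y(2) Yv] vx
    by (simp add: inner_add_left inner_add_right inner_diff_left inner_diff_right inner_commute[of v "D x Y"] inner_commute[of x "D x Y"])
  moreover have "X \<bullet> X = Y \<bullet> Y + p * p + q * q"
    using Y(2) Yv vx
    by (simp add: X inner_add_left inner_add_right inner_commute[of v Y] inner_commute[of x Y])
  ultimately show ?thesis using eq[OF Y(2) Yv] by simp
qed

text \<open>D maps X + DX to DX - X; equality of their lengths is the vanishing of the cross
  term.\<close>

lemma D_skew:
  assumes x: "x \<noteq> 0" and DD: "\<And>X. D x (D x X) = - X" and iso: "\<And>X. D x X \<bullet> D x X = X \<bullet> X"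
  shows "D x X \<bullet> X = 0"
proof -
  have "D x (X + D x X) = D x X - X" using linear_add[OF linear_D[OF x]] DD by simp
  then have "(D x X - X) \<bullet> (D x X - X) = (X + D x X) \<bullet> (X + D x X)" using iso[of "X + D x X"] by simp
  then show ?thesis by (simp add: inner_diff inner_add inner_commute)
qed

lemma D2_eq_0_unit:
  assumes x: "norm x = 1" and D2: "\<And>X. x \<bullet> X = 0 \<Longrightarrow> D2 x X X = 0"
  shows "D2 x X Y = 0"
proof -
  have x0: "x \<noteq> 0" and xx: "x \<bullet> x = 1" using x by (auto simp: norm_eq_1)
  have diag: "D2 x Z Z = 0" for Z
  proof -
    let ?Z = "Z - (x \<bullet> Z) *\<^sub>R x"
    have r: "D2 x y (r *\<^sub>R x) = 0" for y r
      using linear_scale[OF linear_D2[OF x0]] D2_radial[OF x0] by simp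
    then have l: "D2 x (r *\<^sub>R x) y = 0" for y r
      using D2_sym[OF x0, of "r *\<^sub>R x" y] by simp
    have "D2 x (?Z + (x \<bullet> Z) *\<^sub>R x) (?Z + (x \<bullet> Z) *\<^sub>R x) = D2 x ?Z ?Z"
      by (simp only: D2_add_left[OF x0] linear_add[OF linear_D2[OF x0]] r l add_0_right)
    then show ?thesis using D2[of ?Z] xx by (simp add: inner_diff_right)
  qed
  have "D2 x (X + Y) (X + Y) = (D2 x X X + D2 x X Y) + (D2 x Y X + D2 x Y Y)"
    by (simp only: D2_add_left[OF x0] linear_add[OF linear_D2[OF x0]])
  then have "D2 x X Y + D2 x X Y = 0" using diag D2_sym[OF x0, of Y X] by simp
  then have "2 *\<^sub>R D2 x X Y = 0" by (simp only: scaleR_2)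
  then show ?thesis by simp
qed

text \<open>The second derivative is homogeneous of degree -1 in the point; scaling the direction
  along with the point avoids a quotient.\<close>

lemma D2_scale:
  assumes x: "x \<noteq> 0" and c: "c > 0"
  shows "D2 (c *\<^sub>R x) y (c *\<^sub>R z) = D2 x y z"
proof -
  obtain I where I: "open I" "0 \<in> I" "\<And>s. s \<in> I \<Longrightarrow> x + s *\<^sub>R z \<noteq> 0"
    using punctured_line[OF x, where z = z] by metis
  have *: "c *\<^sub>R x + s *\<^sub>R (c *\<^sub>R z) = c *\<^sub>R (x + s *\<^sub>R z)" for s by (simp add: algebra_simps)
  have cI: "c *\<^sub>R x + s *\<^sub>R (c *\<^sub>R z) \<noteq> 0" if "s \<in> I" for s
    unfolding * using I(3)[OF that] c by simp
  have "((\<lambda>s. D (c *\<^sub>R x + s *\<^sub>R (c *\<^sub>R z)) y) has_vector_derivative D2 (c *\<^sub>R x) y (c *\<^sub>R z)) (at 0)"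
    using D_curve[OF I(1) cI I(2) line_derivative has_vector_derivative_const, of y]
      linear_0[OF linear_D[of "c *\<^sub>R x"]] x c by simp
  moreover have "((\<lambda>s. D (x + s *\<^sub>R z) y) has_vector_derivative D2 x y z) (at 0)"
    using D_curve[OF I(1,3,2) line_derivative has_vector_derivative_const, of y]
      linear_0[OF linear_D[OF x]] by simp
  then have "((\<lambda>s. D (c *\<^sub>R x + s *\<^sub>R (c *\<^sub>R z)) y) has_vector_derivative D2 x y z) (at 0)"
    by (rule has_vector_derivative_transform_within_open[OF _ I(1,2)])
      (unfold *, use I(3) D_scale[OF _ c] in simp)
  ultimately show ?thesis by (rule vector_derivative_unique_at)
qed

text \<open>The second derivative vanishes on the sphere, hence by homogeneity on the punctured
  space, which is connected from dimension 2 on.\<close>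

lemma D_constant:
  assumes D2: "\<And>x X Y. norm x = 1 \<Longrightarrow> D2 x X Y = 0" and "x \<noteq> 0" "y \<noteq> 0" and dim: "2 \<le> DIM('a)"
  shows "D x X = D y X"
proof (rule has_derivative_zero_unique_connected[where s = "- {0}" and f = "\<lambda>z. D z X"])
  show "connected (- {0::'a})" by (rule connected_punctured_universe[OF dim])
  fix z :: 'a assume z: "z \<in> - {0}"
  have "D2 z X Z = 0" for Z
  proof -
    let ?u = "z /\<^sub>R norm z"
    have "D2 (norm z *\<^sub>R ?u) X (norm z *\<^sub>R (Z /\<^sub>R norm z)) = D2 ?u X (Z /\<^sub>R norm z)"
      by (rule D2_scale) (use z in auto)
    also have "\<dots> = 0" by (rule D2) (use z in simp)
    finally show ?thesis using z by simp
  qed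
  then have "frechet_derivative (\<lambda>z. D z X) (at z) = (\<lambda>Z. 0)" by auto
  then show "((\<lambda>z. D z X) has_derivative (\<lambda>Z. 0)) (at z)"
    using smooth_map_on_has_derivative[OF smooth_map_on_frechet[OF smooth_F] z, of X] by simp
qed (use assms in auto)

lemma dim_ge_2: "2 \<le> DIM('a)"
proof -
  obtain x :: 'a where x: "norm x = 1" using vector_choose_size[of 1] by auto
  have n: "x \<noteq> 0" "F x \<noteq> 0" "x \<bullet> F x = 0" using x F_norm[of x] F_orth[of x] by auto
  then have "x \<noteq> F x" by auto
  have "independent {x, F x}"
    by (rule pairwise_orthogonal_independent)
      (use n in \<open>auto simp: pairwise_def orthogonal_def inner_commute\<close>)
  then have "card {x, F x} \<le> DIM('a)" using independent_bound by blast
  then show ?thesis using \<open>x \<noteq> F x\<close> by simp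
qed

end

text \<open>The determinant of a real J with square -1 has square (-1)^n, which must be
  nonnegative.\<close>

lemma hopf_field_even:
  fixes \<xi> :: "real^'d \<Rightarrow> real^'d"
  assumes "hopf_field \<xi>"
  shows "even CARD('d)"
proof -
  obtain J :: "real^'d^'d" where J: "J ** J = - mat 1" using assms by (auto simp: hopf_field_def)
  have "det (- mat 1 :: real^'d^'d) = (\<Prod>i\<in>UNIV. (- mat 1 :: real^'d^'d) $ i $ i)"
    by (rule det_diagonal) (simp add: mat_def)
  also have "\<dots> = (- 1) ^ CARD('d)" by (simp add: mat_def)
  finally have "det J * det J = (- 1) ^ CARD('d)" by (simp only: det_mul[symmetric] J)
  then show ?thesis
    using zero_le_square[of "det J"] by (cases "even CARD('d)") auto
qed

lemma hopf_field_totally_geodesic: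
  fixes \<xi> :: "real^'d \<Rightarrow> real^'d"
  assumes "hopf_field \<xi>"
  shows "totally_geodesic_field \<xi>"
proof -
  obtain J :: "real^'d^'d" where J: "J ** J = - mat 1" "transpose J ** J = mat 1"
    and \<xi>: "\<And>x. x \<in> sphere 0 1 \<Longrightarrow> \<xi> x = J *v x"
    using assms by (auto simp: hopf_field_def)
  show ?thesis
  proof (rule orthogonal_complex_structure_totally_geodesic[where j = "\<lambda>x. J *v x"])
    show "J *v (J *v x) = - x" for x
      by (simp add: matrix_vector_mul_assoc J(1)) (simp add: vec_eq_iff matrix_vector_mult_def mat_def if_distrib if_distribR sum.delta cong: if_cong)
    show "(J *v x) \<bullet> (J *v y) = x \<bullet> y" for x y
      by (metis J(2) dot_lmul_matrix matrix_vector_mul_assoc matrix_vector_mul_lid transpose_matrix_vector transpose_transpose)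
    show "linear (\<lambda>x. J *v x)" by (rule matrix_vector_mul_linear)
  qed (use \<xi> in simp)
qed

lemma totally_geodesic_normal_hopf:
  fixes \<xi> :: "real^'d \<Rightarrow> real^'d"
  assumes "unit_vector_field_sphere \<xi>" "geodesic_field_sphere \<xi>" "totally_geodesic_field \<xi>" "covariantly_normal \<xi>"
  shows "hopf_field \<xi>"
proof -
  interpret unit_field_vec \<xi> by unfold_locales (rule assms(1))
  note DF = D_F_geodesic[OF assms(2)]
  have x0: "x \<noteq> 0" if "norm x = 1" for x :: "real^'d" using that by auto
  have tg: "D2 x X X = - (F x \<bullet> X) *\<^sub>R (X + D x (D x X)) - (2 * (D x X \<bullet> X)) *\<^sub>R x
      + (X \<bullet> X - D x X \<bullet> D x X) *\<^sub>R F x" if "norm x = 1" "x \<bullet> X = 0" for x X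
    by (rule totally_geodesic_second_derivative[OF assms(3) _ that]) (rule DF)
  have DD: "D x (D x X) = - X" if "norm x = 1" for x X
    by (rule D_D[OF _ tg[OF that] that]) (rule DF)
  have iso: "D x X \<bullet> D x X = X \<bullet> X" if "norm x = 1" for x X
    by (rule D_isometry[OF assms(4) that DD[OF that]])
  \<comment> \<open>The three terms of the formula are killed in turn by \<open>DD\<close>, by
    skewness and by the isometry property.\<close>
  have "D2 x X X = 0" if "norm x = 1" "x \<bullet> X = 0" for x X
    using tg[OF that] DD[OF that(1)] iso[OF that(1)] D_skew[OF x0[OF that(1)] DD[OF that(1)] iso[OF that(1)]]
    by simp
  then have D2: "D2 x X Y = 0" if "norm x = 1" for x X Y
    using D2_eq_0_unit[OF that] that by blast
  obtain x1 :: "real^'d" where x1: "norm x1 = 1" using vector_choose_size[of 1] by auto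
  define J where "J = matrix (D x1)"
  have J: "J *v X = D x1 X" for X
    unfolding J_def by (rule matrix_works) (use linear_D[OF x0[OF x1]] in \<open>simp add: linear_matrix_vector_mul_eq\<close>)
  have "J ** J = - mat 1"
    unfolding matrix_eq
    by (simp add: matrix_vector_mul_assoc[symmetric] J DD[OF x1])
      (simp add: vec_eq_iff matrix_vector_mult_def mat_def if_distrib if_distribR sum.delta cong: if_cong)
  moreover have "orthogonal_transformation (D x1)"
    using linear_D[OF x0[OF x1]] iso[OF x1] by (simp add: orthogonal_transformation norm_eq_sqrt_inner)
  then have "transpose J ** J = mat 1"
    by (simp add: orthogonal_transformation_matrix J_def orthogonal_matrix)
  \<comment> \<open>Euler's relation turns constancy of D into linearity:
    \<open>F x = D x x = D x1 x\<close>.\<close>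
  moreover have "\<xi> x = J *v x" if "norm x = 1" for x
    using D_constant[OF D2 x0[OF that] x0[OF x1] dim_ge_2] D_radial[OF x0[OF that]] F_sphere[OF that]
    by (simp add: J)
  ultimately show ?thesis unfolding hopf_field_def by (intro exI[of _ J]) simp
qed

theorem theorem2:
  fixes \<xi> :: "real^'d \<Rightarrow> real^'d"
  assumes "unit_vector_field_sphere \<xi>"
    and "geodesic_field_sphere \<xi>"
  shows "(even CARD('d) \<and> hopf_field \<xi> \<longrightarrow> totally_geodesic_field \<xi>)
     \<and> (totally_geodesic_field \<xi> \<and> covariantly_normal \<xi>
          \<longrightarrow> even CARD('d) \<and> hopf_field \<xi>)"
  using hopf_field_totally_geodesic totally_geodesic_normal_hopf[OF assms] hopf_field_even by blast

end
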